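(* Let $N\ge 1$, let $y_1,\dots,y_N\in\mathbb{R}$ be distinct points, and for each $k$ let $\mu_k>0$ and $V_k\in L^1(\mathbb{R},(1+|x|)\,dx)\cap L^\infty(\mathbb{R})$, with either $V_k\ge 0$ or $0<\mu_k<1$. Set $\alpha_k=\int V_k\,dx$. Let $\psi_0\in H^1(\mathbb{R})$, let $\psi^\varepsilon$ ($\varepsilon\in(0,1]$) be the global $H^1$-solution of the regularized problem (R$_\varepsilon$) and $\psi$ the global $H^1$-solution of the limit problem (L), both with initial datum $\psi_0$. Let $\delta\in(0,\tfrac12)$ and $T>0$. Then there exists $c>0$ independent of $\varepsilon$ such that $$\sup_{t\in[0,T]}\|\psi^\varepsilon(t)-\psi(t)\|_{L^2(\mathbb{R})}\le c\,\varepsilon^\delta .$$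
   Context: $U(t)$ denotes the free Schrödinger group $e^{it\Delta}$ on $\mathbb{R}$, acting by convolution with the kernel $U(t,x)=\frac{1}{\sqrt{4\pi i t}}e^{i x^2/(4t)}$. The regularized problem (R$_\varepsilon$) is the integral equation $$\psi^\varepsilon(t,x)=U(t)\psi_0(x)-i\sum_{k=1}^N\int_0^t ds\int dy\,U(t-s,x-y)\,\frac{1}{\varepsilon}V_k\!\left(\frac{y-y_k}{\varepsilon}\right)|\psi^\varepsilon(s,y)|^{2\mu_k}\psi^\varepsilon(s,y),$$ and an $H^1$-solution is a function $t\mapsto\psi^\varepsilon(t)\in H^1(\mathbb{R})$, continuous in $t$, satisfying it; under the stated hypotheses a unique global such solution exists. The limit problem (L) is the integral equation $$\psi(t,x)=U(t)\psi_0(x)-i\sum_{k=1}^N\alpha_k\int_0^t ds\,U(t-s,x-y_k)\,|\psi(s,y_k)|^{2\mu_k}\psi(s,y_k),$$ and under the stated hypotheses it has a unique global $H^1$-solution. *)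

theory Defs
  imports "HOL-Analysis.Analysis"
begin

definition square_integrable :: "(real \<Rightarrow> complex) \<Rightarrow> bool" where
  "square_integrable f \<longleftrightarrow>
     f \<in> borel_measurable lborel \<and> integrable lborel (\<lambda>x. (cmod (f x))\<^sup>2)"

definition L2norm :: "(real \<Rightarrow> complex) \<Rightarrow> real" where
  "L2norm f = sqrt (LINT x|lborel. (cmod (f x))\<^sup>2)"

definition test_function :: "(real \<Rightarrow> real) \<Rightarrow> bool" where
  "test_function \<phi> \<longleftrightarrow>
     (\<forall>n x. ((deriv ^^ n) \<phi>) differentiable (at x)) \<and> compact (closure {x. \<phi> x \<noteq> 0})"

definition has_weak_deriv :: "(real \<Rightarrow> complex) \<Rightarrow> (real \<Rightarrow> complex) \<Rightarrow> bool" where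
  "has_weak_deriv f g \<longleftrightarrow>
     (\<forall>\<phi>. test_function \<phi> \<longrightarrow>
        (LINT x|lborel. f x * of_real (deriv \<phi> x)) = - (LINT x|lborel. g x * of_real (\<phi> x)))"

definition H1 :: "(real \<Rightarrow> complex) \<Rightarrow> bool" where
  "H1 f \<longleftrightarrow> square_integrable f \<and> (\<exists>g. square_integrable g \<and> has_weak_deriv f g)"

definition weak_deriv :: "(real \<Rightarrow> complex) \<Rightarrow> real \<Rightarrow> complex" where
  "weak_deriv f = (SOME g. square_integrable g \<and> has_weak_deriv f g)"

definition H1norm :: "(real \<Rightarrow> complex) \<Rightarrow> real" where
  "H1norm f = sqrt ((L2norm f)\<^sup>2 + (L2norm (weak_deriv f))\<^sup>2)"

definition schr_kernel :: "real \<Rightarrow> real \<Rightarrow> complex" where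
  "schr_kernel t x = exp (\<i> * of_real (x\<^sup>2 / (4 * t))) / csqrt (of_real (4 * pi * t) * \<i>)"

definition free_evol :: "real \<Rightarrow> (real \<Rightarrow> complex) \<Rightarrow> (real \<Rightarrow> complex) \<Rightarrow> bool" where
  "free_evol t f g \<longleftrightarrow>
     square_integrable g \<and>
     (if t = 0 then (AE x in lborel. g x = f x)
      else (\<forall>R. square_integrable
                  (\<lambda>x. g x - (LINT y:{-R..R}|lborel. schr_kernel t (x - y) * f y))) \<and>
           ((\<lambda>R. L2norm (\<lambda>x. g x - (LINT y:{-R..R}|lborel. schr_kernel t (x - y) * f y)))
              \<longlongrightarrow> 0) at_top)"

text \<open>Continuity of t \<mapsto> psi(t) in H^1 on [0,\<infinity>); each psi(t) is taken as its continuous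
  representative.\<close>
definition H1_path :: "(real \<Rightarrow> real \<Rightarrow> complex) \<Rightarrow> bool" where
  "H1_path \<psi> \<longleftrightarrow>
     (\<forall>t\<ge>0. H1 (\<psi> t) \<and> continuous_on UNIV (\<psi> t)) \<and>
     (\<forall>t0\<ge>0. ((\<lambda>t. H1norm (\<lambda>x. \<psi> t x - \<psi> t0 x)) \<longlongrightarrow> 0) (at t0 within {0..}))"

definition is_R_solution ::
  "nat \<Rightarrow> (nat \<Rightarrow> real) \<Rightarrow> (nat \<Rightarrow> real) \<Rightarrow> (nat \<Rightarrow> real \<Rightarrow> real) \<Rightarrow> real \<Rightarrow>
   (real \<Rightarrow> complex) \<Rightarrow> (real \<Rightarrow> real \<Rightarrow> complex) \<Rightarrow> bool" where
  "is_R_solution N y \<mu> V \<epsilon> \<psi>0 \<psi> \<longleftrightarrow>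
     H1_path \<psi> \<and>
     (\<forall>t\<ge>0. \<exists>g. free_evol t \<psi>0 g \<and>
        (AE x in lborel. \<psi> t x = g x - \<i> * (\<Sum>k\<in>{1..N}.
           LINT s:{0..t}|lborel. LINT z|lborel.
             schr_kernel (t - s) (x - z) * of_real ((1 / \<epsilon>) * V k ((z - y k) / \<epsilon>))
             * of_real (cmod (\<psi> s z) powr (2 * \<mu> k)) * \<psi> s z)))"

definition is_L_solution ::
  "nat \<Rightarrow> (nat \<Rightarrow> real) \<Rightarrow> (nat \<Rightarrow> real) \<Rightarrow> (nat \<Rightarrow> real) \<Rightarrow>
   (real \<Rightarrow> complex) \<Rightarrow> (real \<Rightarrow> real \<Rightarrow> complex) \<Rightarrow> bool" where
  "is_L_solution N y \<mu> \<alpha> \<psi>0 \<psi> \<longleftrightarrow>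
     H1_path \<psi> \<and>
     (\<forall>t\<ge>0. \<exists>g. free_evol t \<psi>0 g \<and>
        (AE x in lborel. \<psi> t x = g x - \<i> * (\<Sum>k\<in>{1..N}. of_real (\<alpha> k) *
           (LINT s:{0..t}|lborel.
             schr_kernel (t - s) (x - y k)
             * of_real (cmod (\<psi> s (y k)) powr (2 * \<mu> k)) * \<psi> s (y k)))))"

end

theory Submission
  imports Defs "HOL-Probability.Characteristic_Functions"
begin

text \<open>
  Substituting z = y_k + eps w turns the Duhamel term of (R) into an integral against V_k(w) dw in which
  the scale eps appears only in the positions y_k + eps w; at eps = 0 it is exactly the Duhamel term of
  (L). So (L) is the member eps = 0 of one family, and in the difference of two members the free
  evolution cancels.

  The Sobolev embedding makes each solution bounded and 1/2-Hoelder in space, locally uniformly in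
  time. Moving the kernel from x - y_k - eps w to x - y_k - eps' w costs
  |eps - eps'|^theta (1 + |x|)(1 + |w|) |t - s|^(-1/2 - theta), integrable in time for theta < 1/2; this
  gives an estimate of order |eps - eps'|^theta for the difference in the norm with weight 1/(1 + |x|), as
  long as both solutions are bounded. Since the kernel terms are bounded uniformly in x, a continuity
  argument in time bounds solutions with parameter near eps' by a constant depending on the
  solution at eps'; compactness of [0,1] then gives a bound uniform in eps. No conservation law is used.

  The L^2 norm of a superposition of Schroedinger kernels is estimated by expanding the square: the
  pairing of the kernels at times t - s and t - s' is of size |s - s'|^(-1/2), and the second difference
  of pairings under displacements of size h gains (h^2 / |s - s'|)^theta.
\<close>

section \<open>Sobolev embedding on the line\<close>

text \<open>Two features shape the estimates. A displacement of the kernel changes its phase by an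
  amount that grows with x, so two solutions are not visibly close in the unweighted supremum norm;
  the weight restores smallness but gives no bound on a solution. Boundedness therefore has its own
  estimate, in which the kernel difference is taken without any gain. The price is a term that is
  not small but depends on the reference solution alone, while every term that involves the bound to
  be proved carries a small factor, so the bootstrap closes. The weight is harmless on the
  right-hand side: the nonlinearity sees a solution only at points y_k + eps w, where 1 + |x|
  becomes a multiple of 1 + |w|, and the first moment of V_k pays for that.

  In L^2 the square of the norm gains the power 2 theta of the displacement for a factor |s -
  s'|^(-theta) on top of the exponent 1/2. So the L^2 step has the same threshold theta < 1/2 as the
  weighted one, and both can be run with theta equal to the desired rate; the 1/2-Hoelder regularity
  of the solutions covers this range.\<close>

definition bump :: "real poly \<Rightarrow> nat \<Rightarrow> real \<Rightarrow> real" where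
  "bump P m x = (if 0 < x \<and> x < 1
     then poly P x / (x * (1 - x)) ^ m * exp (- 1 / (x * (1 - x))) else 0)"

text \<open>A single term of the exponential series at \<open>1 / q\<close>. It makes the
  exponential factor of a bump beat every pole \<open>1 / q ^ m\<close>.\<close>

lemma exp_neg_inverse_le:
  fixes q :: real
  assumes "0 < q"
  shows "exp (- 1 / q) \<le> fact n * q ^ n"
proof -
  have "(1 / q) ^ n / fact n \<le> exp (1 / q)"
  proof -
    have "(1/q) ^ n /\<^sub>R fact n = (\<Sum>k\<in>{n}. (1/q) ^ k /\<^sub>R fact k)" by simp
    also have "\<dots> \<le> (\<Sum>k. (1/q) ^ k /\<^sub>R fact k)"
      by (rule sum_le_suminf[OF summable_exp_generic]) (use assms in auto)
    finally show ?thesis by (simp add: exp_def divide_inverse mult.commute)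
  qed
  then have "1 \<le> fact n * q ^ n * exp (1 / q)"
    using assms by (simp add: field_simps)
  then show ?thesis
    using assms by (simp add: exp_minus field_simps)
qed

text \<open>Second order vanishing at 0 and 1 is what differentiability with derivative 0 at these
  two points requires; it comes from the preceding bound with exponent \<open>m + 2\<close>.\<close>

lemma bump_quadratic_bound:
  obtains C where "\<And>x. \<bar>bump P m x\<bar> \<le> C * (x * (1 - x))\<^sup>2"
proof -
  have "bounded (poly P ` {0..1})"
    by (intro compact_imp_bounded compact_continuous_image continuous_intros) auto
  then obtain B where B: "\<And>x. x \<in> {0..1} \<Longrightarrow> \<bar>poly P x\<bar> \<le> B" "B > 0"
    unfolding bounded_pos by (metis imageI real_norm_def)
  have "\<bar>bump P m x\<bar> \<le> (B * fact (m + 2)) * (x * (1 - x))\<^sup>2" for x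
  proof (cases "0 < x \<and> x < 1")
    case True
    define q where "q = x * (1 - x)"
    have q: "0 < q" using True by (simp add: q_def)
    have "\<bar>bump P m x\<bar> = \<bar>poly P x\<bar> / q ^ m * exp (- 1 / q)"
      using True q by (simp add: bump_def q_def[symmetric] abs_mult)
    also have "\<dots> \<le> B / q ^ m * (fact (m + 2) * q ^ (m + 2))"
      using q B True by (intro mult_mono divide_right_mono exp_neg_inverse_le) auto
    also have "\<dots> = (B * fact (m + 2)) * q\<^sup>2"
      using q by (simp add: power_add power2_eq_square del: fact_Suc)
    finally show ?thesis by (simp add: q_def)
  next
    case False
    then show ?thesis using B by (auto simp: bump_def)
  qed
  then show ?thesis by (rule that)
qed

text \<open>Functions (polynomial) / q^m times exp(-1/q) with q = x (1 - x) are stable under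
  differentiation: q is \<open>[:0,1,-1:]\<close>, its derivative is \<open>[:1,-2:]\<close>, and
  the new polynomial is the numerator over the common denominator q^(m+2). Smoothness of bumps thus
  needs only first derivatives.\<close>

lemma bump_has_derivative:
  "(bump P m has_real_derivative
    bump (pderiv P * [:0,1,-1:]^2 - smult (of_nat m) (P * [:1,-2:] * [:0,1,-1:]) + P * [:1,-2:]) (m + 2) x) (at x)"
proof -
  consider "x \<in> {0<..<1}" | "x < 0 \<or> x > 1" | "x = 0 \<or> x = 1" by force
  then show ?thesis
  proof cases
    case 1
    define q where "q = (\<lambda>x::real. x * (1 - x))"
    have q: "q x \<noteq> 0" using 1 by (auto simp: q_def)
    have dq: "(q has_real_derivative 1 - 2 * x) (at x)"
      unfolding q_def by (auto intro!: derivative_eq_intros)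
    define D where "D = (poly (pderiv P) x / q x ^ m - of_nat m * poly P x * (1 - 2*x) / q x ^ (m+1)
        + poly P x * (1 - 2*x) / q x ^ (m+2)) * exp (- 1 / q x)"
    have 1: "((\<lambda>x. poly P x * inverse (q x) ^ m * exp (- inverse (q x))) has_real_derivative D) (at x)"
      apply (rule derivative_eq_intros dq q refl poly_DERIV)+
      using q by (cases m; simp add: D_def field_simps power2_eq_square)
    have eq: "D = bump (pderiv P * [:0,1,-1:]^2 - smult (of_nat m) (P * [:1,-2:] * [:0,1,-1:]) + P * [:1,-2:]) (m + 2) x"
    proof -
      have "poly (pderiv P * [:0,1,-1:]^2 - smult (of_nat m) (P * [:1,-2:] * [:0,1,-1:]) + P * [:1,-2:]) x
          = poly (pderiv P) x * (q x)\<^sup>2 - of_nat m * poly P x * (1 - 2 * x) * q x + poly P x * (1 - 2 * x)"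
        by (simp only: poly_add poly_diff poly_mult poly_power poly_smult) (simp add: q_def algebra_simps)
      moreover have "D = (poly (pderiv P) x * (q x)\<^sup>2 - of_nat m * poly P x * (1 - 2 * x) * q x + poly P x * (1 - 2 * x)) / q x ^ (m + 2) * exp (- 1 / q x)"
        unfolding D_def using q by (simp add: field_simps power2_eq_square power_add)
      ultimately show ?thesis
        using \<open>x \<in> _\<close> unfolding bump_def by (simp only: q_def) auto
    qed
    show ?thesis
      unfolding eq[symmetric]
      by (rule has_field_derivative_transform_within_open[OF 1, of "{0<..<1}"])
         (use \<open>x \<in> _\<close> in \<open>auto simp: bump_def q_def divide_inverse power_mult_distrib power_inverse\<close>)
  next
    case 2
    have "((\<lambda>_. 0) has_real_derivative 0) (at x)" by simp
    then have "(bump P m has_real_derivative 0) (at x)"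
      by (rule has_field_derivative_transform_within_open[of _ _ _ "{..<0} \<union> {1<..}"])
         (use 2 in \<open>auto simp: bump_def\<close>)
    then show ?thesis using 2 by (auto simp: bump_def)
  next
    case 3
    obtain C where C: "\<And>x. \<bar>bump P m x\<bar> \<le> C * (x * (1 - x))\<^sup>2"
      using bump_quadratic_bound by blast
    \<comment> \<open>For x = 0 and for x = 1 one has z (1 - z) = (z - x) (1 - x - z), so after
      division by |z - x| one factor |z - x| is left.\<close>
    have *: "((\<lambda>z. C * (z * (1 - z))\<^sup>2 / \<bar>z - x\<bar>) \<longlongrightarrow> 0) (at x)"
    proof -
      have "((\<lambda>z. C * \<bar>z - x\<bar> * (1 - x - z)\<^sup>2) \<longlongrightarrow> 0) (at x)"
        by (auto intro!: tendsto_eq_intros)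
      moreover have "C * \<bar>z - x\<bar> * (1 - x - z)\<^sup>2 = C * (z * (1 - z))\<^sup>2 / \<bar>z - x\<bar>" if "z \<noteq> x" for z
      proof -
        have "(z * (1 - z))\<^sup>2 = (\<bar>z - x\<bar> * \<bar>z - x\<bar>) * (1 - x - z)\<^sup>2"
          using 3 by (auto simp: power2_eq_square algebra_simps)
        then have "C * (z * (1 - z))\<^sup>2 = C * \<bar>z - x\<bar> * (1 - x - z)\<^sup>2 * \<bar>z - x\<bar>"
          by (simp only: mult_ac)
        then show ?thesis using that by (intro nonzero_eq_divide_eq[THEN iffD2]) auto
      qed
      ultimately show ?thesis
        by (elim Lim_transform_eventually) (auto simp: eventually_at_filter)
    qed
    have "((\<lambda>z. (bump P m z - bump P m x) / (z - x)) \<longlongrightarrow> 0) (at x)"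
    proof (rule Lim_null_comparison[OF _ *])
      show "\<forall>\<^sub>F z in at x. norm ((bump P m z - bump P m x) / (z - x)) \<le> C * (z * (1 - z))\<^sup>2 / \<bar>z - x\<bar>"
        using 3 C by (auto simp: bump_def[of _ _ 0] bump_def[of _ _ 1] abs_divide intro!: always_eventually divide_right_mono)
    qed
    then show ?thesis using 3 by (auto simp: has_field_derivative_iff bump_def[of _ _ 0] bump_def[of _ _ 1])
  qed
qed

text \<open>A class of functions closed under differentiation, so its members are smooth.\<close>

definition bump_comb :: "(real \<Rightarrow> real) \<Rightarrow> bool" where
  "bump_comb f \<longleftrightarrow> (\<exists>P m r a b c d. f = (\<lambda>x. c * bump P m (r * (x - a)) + d * bump P m (r * (x - b))))"

text \<open>Two translates with a common dilation occur because the derivative of a smoothed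
  indicator of an interval is a bump at one end minus a bump at the other.\<close>

lemma bump_comb_deriv:
  assumes "bump_comb f"
  shows "f differentiable (at x)" "bump_comb (deriv f)"
proof -
  obtain P m r a b c d where f: "f = (\<lambda>x. c * bump P m (r * (x - a)) + d * bump P m (r * (x - b)))"
    using assms by (auto simp: bump_comb_def)
  define Q where "Q = pderiv P * [:0,1,-1:]^2 - smult (of_nat m) (P * [:1,-2:] * [:0,1,-1:]) + P * [:1,-2:]"
  have 1: "(f has_real_derivative c * r * bump Q (m+2) (r * (x - a)) + d * r * bump Q (m+2) (r * (x - b))) (at x)" for x
    unfolding f Q_def
    by (rule derivative_eq_intros DERIV_chain2[OF bump_has_derivative] refl | simp)+
  then show "f differentiable (at x)"
    using real_differentiable_def by blast
  have "deriv f = (\<lambda>x. c * r * bump Q (m+2) (r * (x - a)) + d * r * bump Q (m+2) (r * (x - b)))"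
    using 1 by (auto intro!: DERIV_imp_deriv)
  then show "bump_comb (deriv f)" unfolding bump_comb_def by blast
qed

lemma bump_comb_higher_deriv: "bump_comb f \<Longrightarrow> bump_comb ((deriv ^^ n) f)"
  by (induction n) (auto intro: bump_comb_deriv)

lemma bump_1: "bump 1 0 x \<ge> 0" "0 < x \<Longrightarrow> x < 1 \<Longrightarrow> bump 1 0 x > 0"
  "x \<le> 0 \<or> x \<ge> 1 \<Longrightarrow> bump 1 0 x = 0"
  by (auto simp: bump_def)

text \<open>A primitive of the bump. Its final value c is the mass of the bump; it is left
  unnormalised and divided out at the end of the argument that uses it.\<close>

lemma smooth_step:
  obtains R :: "real \<Rightarrow> real" and c where
    "\<And>x. (R has_real_derivative bump 1 0 x) (at x)"
    "\<And>x. x \<le> 0 \<Longrightarrow> R x = 0" "\<And>x. x \<ge> 1 \<Longrightarrow> R x = c" "\<And>x. 0 \<le> R x \<and> R x \<le> c" "c > 0"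
proof -
  have cont: "isCont (bump 1 0) x" for x
    by (rule DERIV_isCont[OF bump_has_derivative])
  have "\<exists>F. \<forall>x :: real. -\<infinity> < x \<longrightarrow> x < \<infinity> \<longrightarrow> (F has_vector_derivative bump 1 0 x) (at x)"
    by (rule einterval_antiderivative) (auto intro: cont)
  then obtain F where F: "\<And>x. (F has_real_derivative bump 1 0 x) (at x)"
    by (auto simp: has_real_derivative_iff_has_vector_derivative)
  define R where "R x = F x - F 0" for x
  have R: "(R has_real_derivative bump 1 0 x) (at x)" for x
    unfolding R_def by (auto intro!: derivative_eq_intros F)
  have mono: "R x \<le> R z" if "x \<le> z" for x z
    by (rule DERIV_nonneg_imp_nondecreasing[OF that]) (use R bump_1(1) in blast)
  have R0: "R x = 0" if "x \<le> 0" for x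
  proof (cases "x = 0")
    case False
    have "R 0 = R x"
    proof (rule DERIV_isconst_end[where f = R])
      show "x < 0" using that False by simp
      show "continuous_on {x..0} R"
        by (rule DERIV_continuous_on) (rule has_field_derivative_at_within[OF R])
      show "\<And>z. x < z \<Longrightarrow> z < 0 \<Longrightarrow> (R has_real_derivative 0) (at z)"
        using R bump_1(3) by (metis less_eq_real_def)
    qed
    then show ?thesis by (simp add: R_def)
  qed (simp add: R_def)
  have R1: "R x = R 1" if "x \<ge> 1" for x
  proof (cases "x = 1")
    case False
    show "R x = R 1"
    proof (rule DERIV_isconst_end[where f = R])
      show "1 < x" using that False by simp
      show "continuous_on {1..x} R"
        by (rule DERIV_continuous_on) (rule has_field_derivative_at_within[OF R])
      show "\<And>z. 1 < z \<Longrightarrow> z < x \<Longrightarrow> (R has_real_derivative 0) (at z)"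
        using R bump_1(3) by (metis less_eq_real_def)
    qed
  qed simp
  obtain z where z: "0 < z" "z < 1" "R 1 - R 0 = (1 - 0) * bump 1 0 z"
    using MVT2[of 0 1 R "bump 1 0"] R by auto
  then have "R 1 > 0" using bump_1(2)[of z] by (simp add: R_def)
  moreover have "0 \<le> R x \<and> R x \<le> R 1" for x
  proof
    show "0 \<le> R x" using R0[of x] mono[of 0 x] by (cases "x \<le> 0") (simp_all add: R_def)
    show "R x \<le> R 1" using R1[of x] mono[of x 1] by (cases "1 \<le> x") simp_all
  qed
  ultimately show ?thesis by (intro that[of R "R 1"] R R0 R1)
qed

section \<open>Square integrable functions and weak derivatives\<close>

lemma integrable_if_continuous_compact_support:
  fixes f :: "real \<Rightarrow> 'a::euclidean_space"
  assumes "continuous_on UNIV f" "compact S" "\<And>x. x \<notin> S \<Longrightarrow> f x = 0"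
  shows "integrable lborel f"
proof -
  have "integrable lborel (\<lambda>x. indicator S x *\<^sub>R f x)"
    by (rule borel_integrable_compact) (use assms in \<open>auto intro: continuous_on_subset\<close>)
  moreover have "(\<lambda>x. indicator S x *\<^sub>R f x) = f"
    using assms(3) by (auto simp: indicator_def)
  ultimately show ?thesis by simp
qed

lemma square_integrable_of_continuous_compact_support:
  fixes f :: "real \<Rightarrow> real"
  assumes "continuous_on UNIV f" "compact S" "\<And>x. x \<notin> S \<Longrightarrow> f x = 0"
  shows "square_integrable (\<lambda>x. of_real (f x))"
  unfolding square_integrable_def
proof
  show "(\<lambda>x. complex_of_real (f x)) \<in> borel_measurable lborel"
    using assms(1) by (auto intro!: borel_measurable_continuous_onI continuous_intros)
  show "integrable lborel (\<lambda>x. (cmod (complex_of_real (f x)))\<^sup>2)"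
    by (rule integrable_if_continuous_compact_support[where S = S])
       (use assms in \<open>auto intro!: continuous_intros\<close>)
qed

lemma square_integrable_mult:
  assumes "square_integrable f" "square_integrable g"
  shows "integrable lborel (\<lambda>x. f x * g x)"
proof (rule Bochner_Integration.integrable_bound)
  show "integrable lborel (\<lambda>x. (cmod (f x))\<^sup>2 + (cmod (g x))\<^sup>2)"
    using assms by (auto simp: square_integrable_def)
  show "(\<lambda>x. f x * g x) \<in> borel_measurable lborel"
    using assms by (auto simp: square_integrable_def)
  show "AE x in lborel. norm (f x * g x) \<le> norm ((cmod (f x))\<^sup>2 + (cmod (g x))\<^sup>2)"
  proof (rule AE_I2)
    fix x
    have "2 * (cmod (f x) * cmod (g x)) \<le> (cmod (f x))\<^sup>2 + (cmod (g x))\<^sup>2"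
      using sum_squares_bound[of "cmod (f x)" "cmod (g x)"] by (simp add: mult.assoc)
    moreover have "0 \<le> cmod (f x) * cmod (g x)" by simp
    ultimately have "cmod (f x) * cmod (g x) \<le> (cmod (f x))\<^sup>2 + (cmod (g x))\<^sup>2" by linarith
    then show "norm (f x * g x) \<le> norm ((cmod (f x))\<^sup>2 + (cmod (g x))\<^sup>2)"
      by (simp add: norm_mult)
  qed
qed

lemma norm_add_squared_le:
  fixes a b :: "'a::real_normed_vector"
  shows "(norm (a + b))\<^sup>2 \<le> 2 * (norm a)\<^sup>2 + 2 * (norm b)\<^sup>2"
proof -
  have "(norm (a + b))\<^sup>2 \<le> (norm a + norm b)\<^sup>2"
    by (intro power_mono norm_triangle_ineq) auto
  also have "\<dots> \<le> 2 * (norm a)\<^sup>2 + 2 * (norm b)\<^sup>2"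
    using sum_squares_bound[of "norm a" "norm b"] by (simp add: power2_sum)
  finally show ?thesis .
qed

lemma norm_diff_squared_le:
  fixes a b :: "'a::real_normed_vector"
  shows "(norm (a - b))\<^sup>2 \<le> 2 * (norm a)\<^sup>2 + 2 * (norm b)\<^sup>2"
  using norm_add_squared_le[of a "- b"] by simp

lemma square_integrable_diff:
  assumes "square_integrable f" "square_integrable g"
  shows "square_integrable (\<lambda>x. f x - g x)"
  unfolding square_integrable_def
proof
  show "(\<lambda>x. f x - g x) \<in> borel_measurable lborel"
    using assms by (auto simp: square_integrable_def)
  show "integrable lborel (\<lambda>x. (cmod (f x - g x))\<^sup>2)"
  proof (rule Bochner_Integration.integrable_bound)
    show "integrable lborel (\<lambda>x. 2 * (cmod (f x))\<^sup>2 + 2 * (cmod (g x))\<^sup>2)"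
      using assms by (auto simp: square_integrable_def)
  qed (use assms in \<open>auto simp: square_integrable_def norm_diff_squared_le\<close>)
qed

lemma test_function_square_integrable:
  assumes "test_function \<phi>"
  shows "square_integrable (\<lambda>x. of_real (\<phi> x))" "square_integrable (\<lambda>x. of_real (deriv \<phi> x))"
proof -
  let ?S = "closure {x. \<phi> x \<noteq> 0}"
  have d: "(deriv ^^ n) \<phi> differentiable (at x)" for n x
    using assms by (auto simp: test_function_def)
  have S: "compact ?S" using assms by (auto simp: test_function_def)
  have out: "\<phi> x = 0" if "x \<notin> ?S" for x
    using that closure_subset[of "{x. \<phi> x \<noteq> 0}"] by auto
  have out': "deriv \<phi> x = 0" if "x \<notin> ?S" for x
  proof -
    have "((\<lambda>_. 0) has_real_derivative 0) (at x)" by simp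
    then have "(\<phi> has_real_derivative 0) (at x)"
    proof (rule has_field_derivative_transform_within_open)
      show "open (- ?S)" by (intro open_Compl closed_closure)
      show "x \<in> - ?S" using that by simp
    qed (rule out[symmetric], rule ComplD)
    then show ?thesis by (rule DERIV_imp_deriv)
  qed
  have "continuous_on UNIV \<phi>" "continuous_on UNIV (deriv \<phi>)"
    using d[of 0] d[of 1]
    by (auto intro!: continuous_at_imp_continuous_on differentiable_imp_continuous_within)
  then show "square_integrable (\<lambda>x. of_real (\<phi> x))" "square_integrable (\<lambda>x. of_real (deriv \<phi> x))"
    by (auto intro!: square_integrable_of_continuous_compact_support[OF _ S] out out')
qed

text \<open>\<open>H1_path\<close> expresses continuity through the norm of differences in time, so
  the Sobolev bounds have to be available for differences.\<close>

lemma H1_diff: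
  assumes "H1 f" "H1 g"
  shows "H1 (\<lambda>x. f x - g x)"
proof -
  obtain f' g' where *: "square_integrable f" "square_integrable g" "square_integrable f'" "square_integrable g'"
    "has_weak_deriv f f'" "has_weak_deriv g g'"
    using assms by (auto simp: H1_def)
  have "has_weak_deriv (\<lambda>x. f x - g x) (\<lambda>x. f' x - g' x)"
    unfolding has_weak_deriv_def
  proof (intro allI impI)
    fix \<phi> assume \<phi>: "test_function \<phi>"
    note t = test_function_square_integrable[OF \<phi>]
    have "(LINT x|lborel. (f x - g x) * of_real (deriv \<phi> x)) =
        (LINT x|lborel. f x * of_real (deriv \<phi> x)) - (LINT x|lborel. g x * of_real (deriv \<phi> x))"
      by (simp add: left_diff_distrib square_integrable_mult * t)
    also have "\<dots> = - (LINT x|lborel. f' x * of_real (\<phi> x)) + (LINT x|lborel. g' x * of_real (\<phi> x))"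
      using * \<phi> by (simp add: has_weak_deriv_def)
    also have "\<dots> = - (LINT x|lborel. (f' x - g' x) * of_real (\<phi> x))"
      by (simp add: left_diff_distrib square_integrable_mult * t)
    finally show "(LINT x|lborel. (f x - g x) * of_real (deriv \<phi> x)) = - (LINT x|lborel. (f' x - g' x) * of_real (\<phi> x))" .
  qed
  then show ?thesis
    unfolding H1_def using * square_integrable_diff by blast
qed

lemma bump_integral:
  assumes "\<And>x. (R has_real_derivative bump 1 0 x) (at x)" "R 0 = 0" "R 1 = c"
  shows "integrable lborel (bump 1 0)" "(LINT x|lborel. bump 1 0 x) = c"
proof -
  have cont: "isCont (bump 1 0) x" for x
    by (rule DERIV_isCont[OF bump_has_derivative])
  show "integrable lborel (bump 1 0)"
    by (rule integrable_if_continuous_compact_support[where S = "{0..1}"])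
       (auto intro!: continuous_at_imp_continuous_on cont bump_1(3))
  have "(LINT x|lborel. bump 1 0 x * indicator {0..1} x) = R 1 - R 0"
    by (rule integral_FTC_Icc_real) (auto intro: assms cont)
  moreover have "(\<lambda>x. bump 1 0 x * indicator {0..1} x) = bump 1 0"
    by (auto simp: bump_def indicator_def)
  ultimately show "(LINT x|lborel. bump 1 0 x) = c" using assms by simp
qed

text \<open>The weak derivative is tested against smoothed indicators of the interval from a to b.
  Their derivatives concentrate at the two end points, where the continuity of f turns them into
  point values.\<close>

lemma weak_deriv_FTC:
  assumes f: "continuous_on UNIV f" and g: "square_integrable g" and w: "has_weak_deriv f g"
    and "a \<le> b"
  shows "f b - f a = (LINT x|lborel. indicator {a<..b} x *\<^sub>R g x)"
proof -
  obtain R c where R: "\<And>x. (R has_real_derivative bump 1 0 x) (at x)"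
    and R0: "\<And>x. x \<le> 0 \<Longrightarrow> R x = 0" and R1: "\<And>x. x \<ge> 1 \<Longrightarrow> R x = c" and Rb: "\<And>x. 0 \<le> R x \<and> R x \<le> c"
    and c: "c > 0"
    by (rule smooth_step, rule that)
  note bi = bump_integral[OF R R0[OF order_refl] R1[OF order_refl]]
  have contR: "continuous_on UNIV R"
    using R by (auto intro!: continuous_at_imp_continuous_on DERIV_isCont)
  have contb: "continuous_on UNIV (bump 1 0)"
    using bump_has_derivative by (auto intro!: continuous_at_imp_continuous_on DERIV_isCont)
  define r where "r n = real (Suc n)" for n
  have r: "r n > 0" "r n \<ge> 1" for n by (auto simp: r_def)
  have rz: "1 \<le> r n * z" if "1 \<le> z" for n z
    using mult_mono[of 1 "r n" 1 z] r[of n] that by simp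
  \<comment> \<open>The ramps rise to the right of a and fall to the right of b over a length
    \<open>1 / r n\<close>, which is at most 1; hence the common support in
    \<open>{a..b + 1}\<close>.\<close>
  define \<phi> where "\<phi> n x = R (r n * (x - a)) - R (r n * (x - b))" for n x
  have d\<phi>: "(\<phi> n has_real_derivative r n * bump 1 0 (r n * (x - a)) - r n * bump 1 0 (r n * (x - b))) (at x)" for n x
    unfolding \<phi>_def by (rule derivative_eq_intros DERIV_chain2[OF R] refl | simp)+
  have deriv\<phi>: "deriv (\<phi> n) = (\<lambda>x. r n * bump 1 0 (r n * (x - a)) - r n * bump 1 0 (r n * (x - b)))" for n
    using d\<phi> by (auto intro!: DERIV_imp_deriv)
  have comb: "bump_comb (deriv (\<phi> n))" for n
    unfolding bump_comb_def deriv\<phi>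
    by (rule exI[of _ 1], rule exI[of _ 0], rule exI[of _ "r n"], rule exI[of _ a], rule exI[of _ b],
        rule exI[of _ "r n"], rule exI[of _ "- r n"]) simp
  have supp: "x \<in> {a..b + 1}" if "\<phi> n x \<noteq> 0" for n x
  proof (rule ccontr)
    assume "x \<notin> {a..b + 1}"
    then consider "x < a" | "x > b + 1" by fastforce
    then show False
    proof cases
      case 1
      then have "r n * (x - a) \<le> 0" "r n * (x - b) \<le> 0"
        using \<open>a \<le> b\<close> r[of n] by (auto intro!: mult_nonneg_nonpos)
      then show ?thesis using that R0 by (simp add: \<phi>_def)
    next
      case 2
      then have "1 \<le> r n * (x - a)" "1 \<le> r n * (x - b)"
        using \<open>a \<le> b\<close> by (auto intro!: rz)
      then show ?thesis using that R1 by (simp add: \<phi>_def)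
    qed
  qed
  have test: "test_function (\<phi> n)" for n
    unfolding test_function_def
  proof (intro conjI allI)
    fix k x
    show "(deriv ^^ k) (\<phi> n) differentiable at x"
    proof (cases k)
      case 0
      then show ?thesis using d\<phi> by (auto simp: real_differentiable_def)
    next
      case (Suc j)
      then show ?thesis
        using bump_comb_deriv(1)[OF bump_comb_higher_deriv[OF comb]] by (simp add: funpow_Suc_right del: funpow.simps)
    qed
    have "bounded {x. \<phi> n x \<noteq> 0}"
      using supp by (intro bounded_subset[OF bounded_closed_interval[of a "b + 1"]]) auto
    then show "compact (closure {x. \<phi> n x \<noteq> 0})" by (simp add: compact_closure)
  qed
  \<comment> \<open>The pairing of f with a bump of mass c and width \<open>1 / r n\<close> just to
    the right of a. It tends to c f(a), and the pairing of f with the derivative of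
    \<open>\<phi> n\<close> is the difference of two such terms.\<close>
  define I where "I n a = (LINT x|lborel. f x * of_real (r n * bump 1 0 (r n * (x - a))))" for n a
  have I_int: "integrable lborel (\<lambda>x. f x * of_real (r n * bump 1 0 (r n * (x - a))))" for n a
  proof (rule integrable_if_continuous_compact_support[where S = "{a..a+1}"])
    show "continuous_on UNIV (\<lambda>x. f x * of_real (r n * bump 1 0 (r n * (x - a))))"
      by (intro continuous_intros f continuous_on_compose2[OF contb]) auto
    fix x assume "x \<notin> {a..a+1}"
    then have "r n * (x - a) \<le> 0 \<or> 1 \<le> r n * (x - a)"
      using r[of n] rz[of "x - a" n] by (cases "x < a") (auto intro!: mult_nonneg_nonpos)
    then show "f x * of_real (r n * bump 1 0 (r n * (x - a))) = 0"
      by (auto simp: bump_1(3))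
  qed auto
  have I_lim: "(\<lambda>n. I n a) \<longlonglongrightarrow> f a * of_real c" for a
  proof -
    have I: "I n a = (LINT u|lborel. f (a + u / r n) * of_real (bump 1 0 u))" for n
      unfolding I_def
      by (subst lborel_integral_real_affine[where c = "1 / r n" and t = a])
         (use r[of n] in \<open>auto simp: scaleR_conv_of_real simp flip: integral_mult_right_zero\<close>)
    obtain B where B: "\<And>x. x \<in> {a..a+1} \<Longrightarrow> cmod (f x) \<le> B"
    proof -
      have "bounded (f ` {a..a+1})"
        by (intro compact_imp_bounded compact_continuous_image) (use f continuous_on_subset in auto)
      then show ?thesis using that unfolding bounded_iff by (metis imageI)
    qed
    have "(\<lambda>n. LINT u|lborel. f (a + u / r n) * of_real (bump 1 0 u)) \<longlonglongrightarrow> (LINT u|lborel. f a * of_real (bump 1 0 u))"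
    proof (rule integral_dominated_convergence[where w = "\<lambda>u. B * bump 1 0 u"])
      show "(\<lambda>u. f a * complex_of_real (bump 1 0 u)) \<in> borel_measurable lborel"
        "(\<lambda>u. f (a + u / r n) * of_real (bump 1 0 u)) \<in> borel_measurable lborel" for n
        using f contb r[of n]
        by (auto intro!: borel_measurable_continuous_onI continuous_intros continuous_on_compose2[OF f])
      show "integrable lborel (\<lambda>u. B * bump 1 0 u)" using bi by simp
      show "AE u in lborel. (\<lambda>n. f (a + u / r n) * of_real (bump 1 0 u)) \<longlonglongrightarrow> f a * of_real (bump 1 0 u)"
      proof (rule AE_I2)
        fix u
        have "(\<lambda>n. a + u * inverse (real (Suc n))) \<longlonglongrightarrow> a + u * 0"
          by (intro tendsto_intros LIMSEQ_inverse_real_of_nat)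
        then have "(\<lambda>n. a + u / r n) \<longlonglongrightarrow> a" by (simp add: r_def divide_inverse)
        moreover have "isCont f a" using f by (simp add: continuous_on_eq_continuous_at)
        ultimately have "(\<lambda>n. f (a + u / r n)) \<longlonglongrightarrow> f a" by (rule isCont_tendsto_compose[rotated])
        then show "(\<lambda>n. f (a + u / r n) * of_real (bump 1 0 u)) \<longlonglongrightarrow> f a * of_real (bump 1 0 u)"
          by (intro tendsto_intros)
      qed
      show "AE u in lborel. norm (f (a + u / r n) * of_real (bump 1 0 u)) \<le> B * bump 1 0 u" for n
      proof (rule AE_I2)
        fix u
        show "norm (f (a + u / r n) * of_real (bump 1 0 u)) \<le> B * bump 1 0 u"
        proof (cases "0 < u \<and> u < 1")
          case True
          then have "u / r n \<le> 1" using r[of n] by (simp add: divide_le_eq)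
          then have "cmod (f (a + u / r n)) \<le> B" using True r[of n] by (intro B) auto
          then show ?thesis using bump_1(1)[of u] by (auto simp: norm_mult intro: mult_right_mono)
        next
          case False
          then have "bump 1 0 u = 0" by (intro bump_1(3)) auto
          then show ?thesis by simp
        qed
      qed
    qed
    moreover have "(LINT u|lborel. f a * of_real (bump 1 0 u)) = f a * of_real c"
      by (simp add: bi)
    ultimately show ?thesis by (simp only: I)
  qed
  have 1: "(\<lambda>n. I n a - I n b) \<longlonglongrightarrow> f a * of_real c - f b * of_real c"
    by (intro tendsto_intros I_lim)
  have 2: "I n a - I n b = - (LINT x|lborel. g x * of_real (\<phi> n x))" for n
  proof -
    have "I n a - I n b = (LINT x|lborel. f x * of_real (deriv (\<phi> n) x))"
      unfolding I_def deriv\<phi> by (subst Bochner_Integration.integral_diff[symmetric]) (rule I_int, rule I_int, simp add: right_diff_distrib)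
    then show ?thesis using w test[of n] by (simp add: has_weak_deriv_def)
  qed
  have gm[measurable]: "g \<in> borel_measurable lborel" using g by (simp add: square_integrable_def)
  have 3: "(\<lambda>n. LINT x|lborel. g x * of_real (\<phi> n x)) \<longlonglongrightarrow> (LINT x|lborel. of_real c * (indicator {a<..b} x *\<^sub>R g x))"
  proof (rule integral_dominated_convergence[where w = "\<lambda>x. c * (cmod (g x) * indicator {a..b+1} x)"])
    show "(\<lambda>x. of_real c * (indicator {a<..b} x *\<^sub>R g x)) \<in> borel_measurable lborel"
      by measurable
    have "continuous_on UNIV (\<phi> n)" for n
      unfolding \<phi>_def by (intro continuous_intros continuous_on_compose2[OF contR]) auto
    then have [measurable]: "\<phi> n \<in> borel_measurable borel" for n
      by (rule borel_measurable_continuous_onI)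
    show "(\<lambda>x. g x * of_real (\<phi> n x)) \<in> borel_measurable lborel" for n by measurable
    \<comment> \<open>Square integrability suffices on a bounded interval because |g| is at most
      |g|^2 + 1.\<close>
    have "integrable lborel (\<lambda>x. cmod (g x) * indicator {a..b+1} x)"
    proof (rule Bochner_Integration.integrable_bound[of _ "\<lambda>x. (cmod (g x))\<^sup>2 + indicator {a..b+1} x"])
      show "integrable lborel (\<lambda>x. (cmod (g x))\<^sup>2 + indicator {a..b+1} x :: real)"
        using g by (intro Bochner_Integration.integrable_add integrable_real_indicator)
          (auto simp: square_integrable_def emeasure_lborel_Icc_eq)
      show "AE x in lborel. norm (cmod (g x) * indicator {a..b+1} x) \<le> norm ((cmod (g x))\<^sup>2 + indicator {a..b+1} x)"
      proof (rule AE_I2)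
        fix x
        have "cmod (g x) \<le> (cmod (g x))\<^sup>2 + 1"
          using sum_squares_bound[of "cmod (g x)" 1] by (simp add: add_nonneg_nonneg) (smt (verit) norm_ge_zero zero_le_power2)
        then show "norm (cmod (g x) * indicator {a..b+1} x) \<le> norm ((cmod (g x))\<^sup>2 + indicator {a..b+1} x)"
          by (auto simp: indicator_def)
      qed
    qed measurable
    then show "integrable lborel (\<lambda>x. c * (cmod (g x) * indicator {a..b+1} x))" by simp
    show "AE x in lborel. norm (g x * of_real (\<phi> n x)) \<le> c * (cmod (g x) * indicator {a..b+1} x)" for n
    proof (rule AE_I2)
      fix x
      have "\<bar>\<phi> n x\<bar> \<le> c * indicator {a..b+1} x"
        using supp[of n x] Rb[of "r n * (x - a)"] Rb[of "r n * (x - b)"]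
        by (cases "\<phi> n x = 0") (auto simp: indicator_def \<phi>_def c less_imp_le)
      then show "norm (g x * of_real (\<phi> n x)) \<le> c * (cmod (g x) * indicator {a..b+1} x)"
        using mult_left_mono[of "\<bar>\<phi> n x\<bar>" "c * indicator {a..b+1} x" "cmod (g x)"]
        by (simp add: norm_mult mult.left_commute)
    qed
    show "AE x in lborel. (\<lambda>n. g x * of_real (\<phi> n x)) \<longlonglongrightarrow> of_real c * (indicator {a<..b} x *\<^sub>R g x)"
    proof (rule AE_I2)
      fix x
      have Rlim: "(\<lambda>n. R (r n * z)) \<longlonglongrightarrow> c" if "z > 0" for z
      proof (rule tendsto_eventually)
        obtain m where m: "1 / z < real m" using reals_Archimedean2 by blast
        have "R (r n * z) = c" if "n \<ge> m" for n
        proof (rule R1)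
          have "1 / z \<le> r n" using m that by (simp add: r_def)
          then show "1 \<le> r n * z" using \<open>z > 0\<close> by (simp add: field_simps)
        qed
        then show "\<forall>\<^sub>F n in sequentially. R (r n * z) = c" by (auto simp: eventually_sequentially)
      qed
      have Rlim0: "(\<lambda>n. R (r n * z)) \<longlonglongrightarrow> 0" if "z \<le> 0" for z
        using that r by (simp add: R0 mult_nonneg_nonpos less_imp_le)
      \<comment> \<open>Since R vanishes at 0, the limit is 0 at x = a and c at x = b; this produces
        the half-open interval.\<close>
      have "(\<lambda>n. \<phi> n x) \<longlonglongrightarrow> c * indicator {a<..b} x"
      proof -
        consider "x \<le> a" | "a < x" "x \<le> b" | "b < x" by linarith
        then show ?thesis
        proof cases
          case 1
          then have "(\<lambda>n. \<phi> n x) \<longlonglongrightarrow> 0 - 0"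
            unfolding \<phi>_def using \<open>a \<le> b\<close> by (intro tendsto_diff Rlim0) auto
          then show ?thesis using 1 by simp
        next
          case 2
          then have "(\<lambda>n. \<phi> n x) \<longlonglongrightarrow> c - 0"
            unfolding \<phi>_def by (intro tendsto_diff Rlim0 Rlim) auto
          then show ?thesis using 2 by simp
        next
          case 3
          then have "(\<lambda>n. \<phi> n x) \<longlonglongrightarrow> c - c"
            unfolding \<phi>_def using \<open>a \<le> b\<close> by (intro tendsto_diff Rlim) auto
          then show ?thesis using 3 by simp
        qed
      qed
      then have "(\<lambda>n. g x * of_real (\<phi> n x)) \<longlonglongrightarrow> g x * of_real (c * indicator {a<..b} x)"
        by (intro tendsto_intros)
      moreover have "g x * of_real (c * indicator {a<..b} x) = of_real c * (indicator {a<..b} x *\<^sub>R g x)"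
        by (simp add: indicator_def)
      ultimately show "(\<lambda>n. g x * of_real (\<phi> n x)) \<longlonglongrightarrow> of_real c * (indicator {a<..b} x *\<^sub>R g x)"
        by simp
    qed
  qed
  have "f a * of_real c - f b * of_real c = - (LINT x|lborel. of_real c * (indicator {a<..b} x *\<^sub>R g x))"
    using LIMSEQ_unique[OF 1[unfolded 2] tendsto_minus[OF 3]] .
  also have "\<dots> = - of_real c * (LINT x|lborel. (indicator {a<..b} x *\<^sub>R g x))"
    by (simp only: integral_mult_right_zero mult_minus_left)
  finally have "of_real c * (f b - f a) = of_real c * (LINT x|lborel. (indicator {a<..b} x *\<^sub>R g x))"
    by (simp add: algebra_simps)
  then show ?thesis using c by simp
qed

lemma weak_deriv_H1:
  assumes "H1 f"
  shows "square_integrable (weak_deriv f)" "has_weak_deriv f (weak_deriv f)"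
proof -
  have "\<exists>g. square_integrable g \<and> has_weak_deriv f g" using assms by (simp add: H1_def)
  from someI_ex[OF this]
  show "square_integrable (weak_deriv f)" "has_weak_deriv f (weak_deriv f)"
    by (simp_all add: weak_deriv_def)
qed

section \<open>Sobolev bounds, and their uniformity along a path\<close>

lemma L2norm_nonneg: "0 \<le> L2norm f"
  by (simp add: L2norm_def)

lemma L2norm_squared: "(L2norm f)\<^sup>2 = (LINT x|lborel. (cmod (f x))\<^sup>2)"
  by (simp add: L2norm_def)

lemma L2norm_le_H1norm: "L2norm f \<le> H1norm f" "L2norm (weak_deriv f) \<le> H1norm f"
  unfolding H1norm_def by (auto intro!: real_le_rsqrt)

text \<open>The statement also covers f that is not integrable: its integral is then 0 by
  convention, and g is nonnegative as an upper bound of a norm.\<close>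

lemma norm_integral_le:
  fixes f :: "'a \<Rightarrow> 'b::{banach, second_countable_topology}"
  assumes "integrable M g" "\<And>x. norm (f x) \<le> g x"
  shows "norm (integral\<^sup>L M f) \<le> integral\<^sup>L M g"
proof -
  have "norm (integral\<^sup>L M f) \<le> (LINT x|M. norm (f x))" by (rule integral_norm_bound)
  also have "\<dots> \<le> integral\<^sup>L M g"
    using assms by (intro integral_mono') (auto intro: order_trans[OF norm_ge_zero])
  finally show ?thesis .
qed

text \<open>Cauchy-Schwarz in the form of a weighted arithmetic-geometric inequality. A strictly
  positive upper bound n replaces the norm so that it may be divided by.\<close>

lemma norm_integral_interval_le:
  assumes g: "square_integrable g" and n: "L2norm g \<le> n" "0 < n" and "a \<le> b"
  shows "cmod (LINT x|lborel. indicator {a<..b} x *\<^sub>R g x) \<le> n * sqrt (b - a)"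
proof (cases "a = b")
  case False
  then have "a < b" using assms by simp
  \<comment> \<open>This weight makes the two contributions equal: \<open>l / 2 * n\<^sup>2\<close>
    and \<open>(b - a) / (2 * l)\<close> are both half of the claimed bound.\<close>
  define l where "l = sqrt (b - a) / n"
  have l: "0 < l" using \<open>a < b\<close> n by (simp add: l_def)
  have gi: "integrable lborel (\<lambda>x. (cmod (g x))\<^sup>2)" "g \<in> borel_measurable borel"
    using g by (auto simp: square_integrable_def)
  have "cmod (LINT x|lborel. indicator {a<..b} x *\<^sub>R g x)
      \<le> (LINT x|lborel. l / 2 * (cmod (g x))\<^sup>2 + 1 / (2 * l) * indicator {a<..b} x)"
  proof (rule norm_integral_le)
    fix x
    have "2 * (l * cmod (g x)) \<le> (l * cmod (g x))\<^sup>2 + 1"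
      using sum_squares_bound[of "l * cmod (g x)" 1] by simp
    then have "cmod (g x) \<le> l / 2 * (cmod (g x))\<^sup>2 + 1 / (2 * l)"
      using l by (simp add: field_simps power2_eq_square)
    then show "cmod (indicator {a<..b} x *\<^sub>R g x) \<le> l / 2 * (cmod (g x))\<^sup>2 + 1 / (2 * l) * indicator {a<..b} x"
      using l by (auto simp: indicator_def)
  qed (use gi in \<open>intro Bochner_Integration.integrable_add integrable_mult_right integrable_real_indicator;
      auto simp: emeasure_lborel_Ioc \<open>a < b\<close> less_imp_le\<close>)
  also have "\<dots> = l / 2 * (L2norm g)\<^sup>2 + 1 / (2 * l) * (b - a)"
    using gi \<open>a < b\<close> by (simp add: L2norm_squared)
  also have "\<dots> \<le> l / 2 * n\<^sup>2 + 1 / (2 * l) * (b - a)"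
    using n l by (intro add_right_mono mult_left_mono power_mono L2norm_nonneg) auto
  also have "\<dots> = n * sqrt (b - a)"
  proof -
    have "b - a = sqrt (b - a) * sqrt (b - a)" using \<open>a < b\<close> by simp
    then have "1 / (2 * l) * (b - a) = n * sqrt (b - a) / 2"
      unfolding l_def using \<open>a < b\<close> n by (simp add: field_simps)
    moreover have "l / 2 * n\<^sup>2 = n * sqrt (b - a) / 2"
      unfolding l_def using n by (simp add: power2_eq_square)
    ultimately show ?thesis by linarith
  qed
  finally show ?thesis .
qed simp

lemma H1_Hoelder:
  assumes f: "H1 f" "continuous_on UNIV f" and n: "H1norm f \<le> n" "0 < n"
  shows "cmod (f x - f z) \<le> n * sqrt \<bar>x - z\<bar>"
proof -
  have *: "cmod (f b - f a) \<le> n * sqrt (b - a)" if "a \<le> b" for a b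
    using norm_integral_interval_le[OF weak_deriv_H1(1)[OF f(1)] _ n(2) that]
      weak_deriv_FTC[OF f(2) weak_deriv_H1[OF f(1)] that] L2norm_le_H1norm(2)[of f] n
    by simp
  show ?thesis
    using *[of x z] *[of z x] by (cases "x \<le> z") (auto simp: norm_minus_commute)
qed

text \<open>Averaging over the unit interval \<open>{x..x+1}\<close>: there f deviates from f(x) by
  at most n, so |f(x)|^2 is at most 2 |f(z)|^2 + 2 n^2, and integration in z gives 4 n^2.\<close>

lemma H1_sup_bound:
  assumes f: "H1 f" "continuous_on UNIV f" and n: "H1norm f \<le> n" "0 < n"
  shows "cmod (f x) \<le> 2 * n"
proof -
  have fi: "integrable lborel (\<lambda>z. (cmod (f z))\<^sup>2)" "f \<in> borel_measurable borel"
    using f by (auto simp: square_integrable_def H1_def)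
  have "(cmod (f x))\<^sup>2 = (LINT z|lborel. indicator {x..x+1} z * (cmod (f x))\<^sup>2)"
    by simp
  also have "\<dots> \<le> (LINT z|lborel. 2 * (cmod (f z))\<^sup>2 + indicator {x..x+1} z * (2 * n\<^sup>2))"
  proof (rule integral_mono)
    fix z
    show "indicator {x..x+1} z * (cmod (f x))\<^sup>2 \<le> 2 * (cmod (f z))\<^sup>2 + indicator {x..x+1} z * (2 * n\<^sup>2)"
    proof (cases "z \<in> {x..x+1}")
      case True
      have "cmod (f x - f z) \<le> n * sqrt \<bar>x - z\<bar>" by (rule H1_Hoelder[OF assms])
      also have "\<dots> \<le> n * 1" using True n by (intro mult_left_mono) auto
      finally have "(cmod (f x - f z))\<^sup>2 \<le> n\<^sup>2" by (intro power_mono) auto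
      then show ?thesis
        using norm_add_squared_le[of "f z" "f x - f z"] True by simp
    qed simp
  qed (use fi in auto)
  also have "\<dots> = 2 * (L2norm f)\<^sup>2 + 2 * n\<^sup>2"
    using fi by (simp add: L2norm_squared)
  also have "\<dots> \<le> 2 * n\<^sup>2 + 2 * n\<^sup>2"
    using n L2norm_le_H1norm(1)[of f] by (intro add_right_mono mult_left_mono power_mono L2norm_nonneg) auto
  finally have "(cmod (f x))\<^sup>2 \<le> (2 * n)\<^sup>2" by (simp add: power2_eq_square)
  then show ?thesis by (rule power2_le_imp_le) (use n in simp)
qed

text \<open>Continuity in H^1 is used from here on only through these two consequences, one for the
  supremum and one for the Hoelder seminorm in space.\<close>

lemma H1_path_continuity:
  assumes "H1_path \<psi>" "0 \<le> t0" "0 < e"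
  obtains d where "0 < d" "\<And>t x. 0 \<le> t \<Longrightarrow> \<bar>t - t0\<bar> < d \<Longrightarrow> cmod (\<psi> t x - \<psi> t0 x) \<le> e"
    "\<And>t x z. 0 \<le> t \<Longrightarrow> \<bar>t - t0\<bar> < d \<Longrightarrow>
       cmod ((\<psi> t x - \<psi> t0 x) - (\<psi> t z - \<psi> t0 z)) \<le> e * sqrt \<bar>x - z\<bar>"
proof -
  have "((\<lambda>t. H1norm (\<lambda>x. \<psi> t x - \<psi> t0 x)) \<longlongrightarrow> 0) (at t0 within {0..})"
    using assms by (auto simp: H1_path_def)
  then obtain d where d: "0 < d"
    "\<And>t. t \<in> {0..} \<Longrightarrow> 0 < dist t t0 \<and> dist t t0 < d \<Longrightarrow> dist (H1norm (\<lambda>x. \<psi> t x - \<psi> t0 x)) 0 < e / 2"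
    unfolding Lim_within using assms(3) by (metis half_gt_zero)
  have H: "H1 (\<lambda>x. \<psi> t x - \<psi> t0 x)" "continuous_on UNIV (\<lambda>x. \<psi> t x - \<psi> t0 x)" if "0 \<le> t" for t
    using assms that by (auto simp: H1_path_def intro!: H1_diff continuous_intros)
  \<comment> \<open>The limit in \<open>H1_path\<close> says nothing about t = t0 itself, where the
    difference is the zero function. The half of e pays for the factor 2 in
    \<open>H1_sup_bound\<close>.\<close>
  have small: "H1norm (\<lambda>x. \<psi> t x - \<psi> t0 x) \<le> e / 2" if "0 \<le> t" "\<bar>t - t0\<bar> < d" "t \<noteq> t0" for t
    using d(2)[of t] that by (auto simp: dist_real_def)
  show ?thesis
  proof (rule that[OF \<open>0 < d\<close>])
    fix t x assume t: "0 \<le> t" "\<bar>t - t0\<bar> < d"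
    show "cmod (\<psi> t x - \<psi> t0 x) \<le> e"
      using H1_sup_bound[OF H[OF t(1)] small, of x] t assms(3) by (cases "t = t0") auto
  next
    fix t x z assume t: "0 \<le> t" "\<bar>t - t0\<bar> < d"
    show "cmod ((\<psi> t x - \<psi> t0 x) - (\<psi> t z - \<psi> t0 z)) \<le> e * sqrt \<bar>x - z\<bar>"
    proof (cases "t = t0")
      case False
      have "cmod ((\<psi> t x - \<psi> t0 x) - (\<psi> t z - \<psi> t0 z)) \<le> e / 2 * sqrt \<bar>x - z\<bar>"
        using H1_Hoelder[OF H[OF t(1)] small, of x z] t assms(3) False by auto
      also have "\<dots> \<le> e * sqrt \<bar>x - z\<bar>" using assms(3) by (intro mult_right_mono) auto
      finally show ?thesis .
    qed (use assms in auto)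
  qed
qed

text \<open>A finite subcover and the maximum of finitely many bounds. It serves twice: for times in
  \<open>{0..T}\<close> along one path, and for scales in \<open>{0..1}\<close> across the whole
  family of solutions.\<close>

lemma compact_locally_bounded_imp_bounded:
  fixes S :: "'a::metric_space set" and P :: "'a \<Rightarrow> real \<Rightarrow> bool"
  assumes "compact S"
    and loc: "\<And>x. x \<in> S \<Longrightarrow> \<exists>d>0. \<exists>M. \<forall>z\<in>S. dist z x < d \<longrightarrow> P z M"
    and mono: "\<And>z M M'. P z M \<Longrightarrow> M \<le> M' \<Longrightarrow> P z M'"
  shows "\<exists>M. \<forall>z\<in>S. P z M"
proof -
  obtain d M where dM: "\<And>x. x \<in> S \<Longrightarrow> 0 < d x" "\<And>x z. x \<in> S \<Longrightarrow> z \<in> S \<Longrightarrow> dist z x < d x \<Longrightarrow> P z (M x)"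
    using loc by metis
  have "S \<subseteq> (\<Union>x\<in>S. ball x (d x))" using dM by auto
  then obtain C where C: "C \<subseteq> S" "finite C" "S \<subseteq> (\<Union>x\<in>C. ball x (d x))"
    using compactE_image[OF \<open>compact S\<close>, of S "\<lambda>x. ball x (d x)"] by auto
  have "P z (Max (M ` C))" if zS: "z \<in> S" for z
  proof -
    obtain x where "x \<in> C" "dist z x < d x" using subsetD[OF C(3) zS] by (auto simp: dist_commute)
    then have "P z (M x)" "M x \<le> Max (M ` C)"
      using dM(2)[of x z] C(1,2) zS by (blast, simp)
    then show ?thesis by (rule mono)
  qed
  then show ?thesis by blast
qed

lemma H1_path_bounds:
  assumes "H1_path \<psi>"
  obtains M where "0 < M" "\<And>t x. 0 \<le> t \<Longrightarrow> t \<le> T \<Longrightarrow> cmod (\<psi> t x) \<le> M"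
    "\<And>t x z. 0 \<le> t \<Longrightarrow> t \<le> T \<Longrightarrow> cmod (\<psi> t x - \<psi> t z) \<le> M * sqrt \<bar>x - z\<bar>"
proof -
  define P where "P t M \<longleftrightarrow> (\<forall>x. cmod (\<psi> t x) \<le> M) \<and> (\<forall>x z. cmod (\<psi> t x - \<psi> t z) \<le> M * sqrt \<bar>x - z\<bar>)" for t M
  have "\<exists>M. \<forall>t\<in>{0..T}. P t M"
  proof (rule compact_locally_bounded_imp_bounded)
    show "P t M'" if "P t M" "M \<le> M'" for t M M'
      using that unfolding P_def by (meson mult_right_mono order_trans real_sqrt_ge_zero abs_ge_zero)
    fix t0 assume t0: "t0 \<in> {0..T}"
    obtain d where d: "0 < d" "\<And>t x. 0 \<le> t \<Longrightarrow> \<bar>t - t0\<bar> < d \<Longrightarrow> cmod (\<psi> t x - \<psi> t0 x) \<le> 1"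
    "\<And>t x z. 0 \<le> t \<Longrightarrow> \<bar>t - t0\<bar> < d \<Longrightarrow>
       cmod ((\<psi> t x - \<psi> t0 x) - (\<psi> t z - \<psi> t0 z)) \<le> 1 * sqrt \<bar>x - z\<bar>"
      using H1_path_continuity[OF assms, of t0 1] t0 by auto
    have H: "H1 (\<psi> t0)" "continuous_on UNIV (\<psi> t0)"
      using assms t0 by (auto simp: H1_path_def)
    define n where "n = \<bar>H1norm (\<psi> t0)\<bar> + 1"
    have n: "H1norm (\<psi> t0) \<le> n" "0 < n" by (auto simp: n_def)
    have "P t (2 * n + 1)" if t: "t \<in> {0..T}" "dist t t0 < d" for t
      unfolding P_def
    proof (intro conjI allI)
      fix x z
      have 1: "cmod (\<psi> t x - \<psi> t0 x) \<le> 1" 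
        "cmod ((\<psi> t x - \<psi> t0 x) - (\<psi> t z - \<psi> t0 z)) \<le> 1 * sqrt \<bar>x - z\<bar>"
        using d(2,3)[of t x] t by (auto simp: dist_real_def)
      have 2: "cmod (\<psi> t0 x) \<le> 2 * n" "cmod (\<psi> t0 x - \<psi> t0 z) \<le> n * sqrt \<bar>x - z\<bar>"
        by (rule H1_sup_bound[OF H n] H1_Hoelder[OF H n])+
      show "cmod (\<psi> t x) \<le> 2 * n + 1"
        using norm_triangle_ineq[of "\<psi> t x - \<psi> t0 x" "\<psi> t0 x"] 1 2 by simp
      have "cmod (\<psi> t x - \<psi> t z) \<le> n * sqrt \<bar>x - z\<bar> + 1 * sqrt \<bar>x - z\<bar>"
        using norm_triangle_ineq[of "(\<psi> t x - \<psi> t0 x) - (\<psi> t z - \<psi> t0 z)" "\<psi> t0 x - \<psi> t0 z"] 1 2 by simp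
      also have "\<dots> \<le> (2 * n + 1) * sqrt \<bar>x - z\<bar>"
        using n by (simp add: algebra_simps)
      finally show "cmod (\<psi> t x - \<psi> t z) \<le> (2 * n + 1) * sqrt \<bar>x - z\<bar>" .
    qed
    then show "\<exists>d>0. \<exists>M. \<forall>t\<in>{0..T}. dist t t0 < d \<longrightarrow> P t M" using \<open>0 < d\<close> by blast
  qed simp
  then obtain M where M: "\<And>t. t \<in> {0..T} \<Longrightarrow> P t M" by blast
  have "P t (max M 1)" if "t \<in> {0..T}" for t
    using M[OF that] unfolding P_def
    by (meson max.cobounded1 mult_right_mono order_trans real_sqrt_ge_zero abs_ge_zero)
  then show ?thesis by (intro that[of "max M 1"]) (auto simp: P_def)
qed

text \<open>This is the source of the joint measurability of the Duhamel integrands in time and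
  space.\<close>

lemma H1_path_jointly_continuous:
  assumes "H1_path \<psi>"
  shows "continuous_on ({0..} \<times> UNIV) (\<lambda>p. \<psi> (fst p) (snd p))"
  unfolding continuous_on_iff
proof (intro ballI allI impI)
  fix p :: "real \<times> real" and e :: real
  assume p: "p \<in> {0..} \<times> UNIV" and e: "0 < e"
  obtain t0 x0 where p_eq: "p = (t0, x0)" "0 \<le> t0" using p by auto
  obtain d where d: "0 < d" "\<And>t x. 0 \<le> t \<Longrightarrow> \<bar>t - t0\<bar> < d \<Longrightarrow> cmod (\<psi> t x - \<psi> t0 x) \<le> e / 3"
    by (rule H1_path_continuity[OF assms \<open>0 \<le> t0\<close>, of "e / 3"]) (use e in simp, rule that)
  have "continuous_on UNIV (\<psi> t0)" using assms \<open>0 \<le> t0\<close> by (auto simp: H1_path_def)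
  then have "\<exists>d'>0. \<forall>x\<in>UNIV. dist x x0 < d' \<longrightarrow> dist (\<psi> t0 x) (\<psi> t0 x0) < e / 3"
    using divide_pos_pos[OF e zero_less_numeral] unfolding continuous_on_iff by blast
  then obtain d' where "0 < d'" and d'': "\<forall>x\<in>UNIV. dist x x0 < d' \<longrightarrow> dist (\<psi> t0 x) (\<psi> t0 x0) < e / 3"
    by blast
  then have d': "0 < d'" "\<And>x. \<bar>x - x0\<bar> < d' \<Longrightarrow> cmod (\<psi> t0 x - \<psi> t0 x0) < e / 3"
    by (simp_all add: dist_norm)
  show "\<exists>d>0. \<forall>q\<in>{0..} \<times> UNIV. dist q p < d \<longrightarrow> dist (\<psi> (fst q) (snd q)) (\<psi> (fst p) (snd p)) < e"
  proof (intro exI[of _ "min d d'"] conjI ballI impI)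
    fix q :: "real \<times> real" assume q: "q \<in> {0..} \<times> UNIV" "dist q p < min d d'"
    have "\<bar>fst q - t0\<bar> < d" "\<bar>snd q - x0\<bar> < d'"
      using q(2) dist_fst_le[of q p] dist_snd_le[of q p] by (auto simp: p_eq dist_real_def)
    then have "cmod (\<psi> (fst q) (snd q) - \<psi> t0 (snd q)) \<le> e / 3" "cmod (\<psi> t0 (snd q) - \<psi> t0 x0) < e / 3"
      using d d' q by auto
    then show "dist (\<psi> (fst q) (snd q)) (\<psi> (fst p) (snd p)) < e"
      using norm_triangle_ineq[of "\<psi> (fst q) (snd q) - \<psi> t0 (snd q)" "\<psi> t0 (snd q) - \<psi> t0 x0"] e
      by (simp add: p_eq dist_norm)
  qed (use d d' in auto)
qed

section \<open>Complex Gaussian integrals\<close>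

text \<open>The form of integration by parts on the line that yields the moment identities for
  complex Gaussians.\<close>

lemma integral_deriv_eq_0:
  fixes F f :: "real \<Rightarrow> complex"
  assumes F: "\<And>x. (F has_vector_derivative f x) (at x)" and f: "\<And>x. isCont f x" "integrable lborel f"
    and lim: "(F \<longlongrightarrow> 0) at_infinity"
  shows "(LINT x|lborel. f x) = 0"
proof -
  have "(LBINT x=-\<infinity>..\<infinity>. f x) = 0 - 0"
  proof (rule interval_integral_FTC_integrable[where F = F])
    show "((F \<circ> real_of_ereal) \<longlongrightarrow> 0) (at_right (-\<infinity>))" "((F \<circ> real_of_ereal) \<longlongrightarrow> 0) (at_left \<infinity>)"
      using tendsto_mono[OF at_bot_le_at_infinity lim] tendsto_mono[OF at_top_le_at_infinity lim]
      by (simp_all add: ereal_tendsto_simps)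
    show "set_integrable lborel (einterval (- \<infinity>) \<infinity>) f"
      using f by (simp add: set_integrable_def)
  qed (use F f in auto)
  then show ?thesis by (simp add: interval_lebesgue_integral_def set_lebesgue_integral_def)
qed

text \<open>A Gaussian with complex width p at the Fourier frequency \<open>\<kappa>\<close>. For Re
  p > 0 it is integrable, while Im p carries the quadratic phase of a product of Schroedinger
  kernels.\<close>

definition gauss :: "complex \<Rightarrow> real \<Rightarrow> real \<Rightarrow> complex" where
  "gauss p \<kappa> x = exp (- p * of_real (x\<^sup>2) + \<i> * of_real (\<kappa> * x))"

lemma norm_gauss: "cmod (gauss p \<kappa> x) = exp (- Re p * x\<^sup>2)"
  by (simp add: gauss_def norm_exp_eq_Re)

lemma gauss_has_derivative:
  "(gauss p \<kappa> has_vector_derivative (- 2 * p * of_real x + \<i> * of_real \<kappa>) * gauss p \<kappa> x) (at x)"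
proof -
  have "((\<lambda>z. exp (- p * z\<^sup>2 + \<i> * of_real \<kappa> * z)) has_field_derivative
      (- 2 * p * of_real x + \<i> * of_real \<kappa>) * exp (- p * (of_real x)\<^sup>2 + \<i> * of_real \<kappa> * of_real x)) (at (of_real x))"
    by (rule derivative_eq_intros refl | simp add: algebra_simps)+
  from has_vector_derivative_real_field[OF this] show ?thesis
    by (simp add: gauss_def[abs_def] mult.assoc)
qed

lemma isCont_gauss: "isCont (gauss p \<kappa>) x"
  by (rule has_vector_derivative_continuous[OF gauss_has_derivative])

lemma gauss_measurable [measurable]: "gauss p \<kappa> \<in> borel_measurable borel"
  by (intro borel_measurable_continuous_onI continuous_at_imp_continuous_on ballI isCont_gauss)

lemma integrable_gaussian_moment:
  assumes "0 < (\<eta>::real)"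
  shows "integrable lborel (\<lambda>x. \<bar>x\<bar> ^ k * exp (- \<eta> * x\<^sup>2))"
proof -
  define \<sigma> where "\<sigma> = 1 / sqrt (2 * \<eta>)"
  have \<sigma>: "0 < \<sigma>" "\<sigma>\<^sup>2 = 1 / (2 * \<eta>)" using assms by (auto simp: \<sigma>_def power_divide)
  have "integrable lborel (\<lambda>x. sqrt (2 * pi * \<sigma>\<^sup>2) * (normal_density 0 \<sigma> x * \<bar>x - 0\<bar> ^ k))"
    by (intro integrable_mult_right integrable_normal_moment_abs \<sigma>)
  moreover have "sqrt (2 * pi * \<sigma>\<^sup>2) * (normal_density 0 \<sigma> x * \<bar>x - 0\<bar> ^ k) = \<bar>x\<bar> ^ k * exp (- \<eta> * x\<^sup>2)" for x
  proof -
    have "sqrt (2 * pi * \<sigma>\<^sup>2) \<noteq> 0" using \<sigma> assms by simp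
    then have "sqrt (2 * pi * \<sigma>\<^sup>2) * normal_density 0 \<sigma> x = exp (- x\<^sup>2 / (2 * \<sigma>\<^sup>2))"
      by (simp add: normal_density_def)
    then show ?thesis using \<sigma> by (simp add: mult_ac)
  qed
  ultimately show ?thesis by (simp only:)
qed

lemma integral_gaussian:
  assumes "0 < (\<eta>::real)"
  shows "(LINT x|lborel. exp (- \<eta> * x\<^sup>2)) = sqrt (pi / \<eta>)"
proof -
  define \<sigma> where "\<sigma> = 1 / sqrt (2 * \<eta>)"
  have \<sigma>: "0 < \<sigma>" "\<sigma>\<^sup>2 = 1 / (2 * \<eta>)" using assms by (auto simp: \<sigma>_def power_divide)
  have "sqrt (2 * pi * \<sigma>\<^sup>2) * normal_density 0 \<sigma> x = exp (- \<eta> * x\<^sup>2)" for x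
  proof -
    have "sqrt (2 * pi * \<sigma>\<^sup>2) \<noteq> 0" using \<sigma> assms by simp
    then have "sqrt (2 * pi * \<sigma>\<^sup>2) * normal_density 0 \<sigma> x = exp (- x\<^sup>2 / (2 * \<sigma>\<^sup>2))"
      by (simp add: normal_density_def)
    then show ?thesis using \<sigma> by (simp add: mult_ac)
  qed
  then have "(LINT x|lborel. exp (- \<eta> * x\<^sup>2)) = (LINT x|lborel. sqrt (2 * pi * \<sigma>\<^sup>2) * normal_density 0 \<sigma> x)"
    by simp
  also have "\<dots> = sqrt (2 * pi * \<sigma>\<^sup>2)" using \<sigma> by simp
  finally show ?thesis using \<sigma> by simp
qed

lemma integrable_gauss_moment:
  assumes "0 < Re p"
  shows "integrable lborel (\<lambda>x. of_real x ^ k * gauss p \<kappa> x)"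
  by (rule Bochner_Integration.integrable_bound[OF integrable_gaussian_moment[OF assms, of k]])
     (auto simp: norm_mult norm_gauss norm_power)

lemma gauss_moment_tendsto_0:
  assumes "0 < Re p" "k \<le> 1"
  shows "((\<lambda>x. of_real x ^ k * gauss p \<kappa> x) \<longlongrightarrow> 0) at_infinity"
proof (rule Lim_null_comparison)
  show "((\<lambda>x::real. 1 / Re p * norm (inverse x)) \<longlongrightarrow> 0) at_infinity"
    by (rule tendsto_eq_intros tendsto_inverse_0 refl | simp)+
  show "\<forall>\<^sub>F x in at_infinity. norm (of_real x ^ k * gauss p \<kappa> x) \<le> 1 / Re p * norm (inverse x)"
    unfolding eventually_at_infinity
  proof (intro exI[of _ 1] allI impI)
    fix x :: real assume x: "1 \<le> norm x"
    have "norm (of_real x ^ k * gauss p \<kappa> x) = \<bar>x\<bar> ^ k * exp (- (Re p * x\<^sup>2))"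
      by (simp add: norm_mult norm_power norm_gauss)
    also have "\<dots> \<le> \<bar>x\<bar> * (1 / (Re p * x\<^sup>2))"
    proof (rule mult_mono)
      show "\<bar>x\<bar> ^ k \<le> \<bar>x\<bar>" using assms(2) x by (cases k) auto
      have pos: "0 < Re p * x\<^sup>2" using assms(1) x by (intro mult_pos_pos) auto
      have "Re p * x\<^sup>2 \<le> exp (Re p * x\<^sup>2)"
        using exp_ge_add_one_self[of "Re p * x\<^sup>2"] by linarith
      then show "exp (- (Re p * x\<^sup>2)) \<le> 1 / (Re p * x\<^sup>2)"
        using pos by (simp add: exp_minus field_simps)
    qed auto
    also have "\<dots> = 1 / Re p * norm (inverse x)"
    proof -
      have "x\<^sup>2 = \<bar>x\<bar> * \<bar>x\<bar>" by (simp add: power2_eq_square)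
      then show ?thesis using x assms(1) by (simp add: field_simps)
    qed
    finally show "norm (of_real x ^ k * gauss p \<kappa> x) \<le> 1 / Re p * norm (inverse x)" .
  qed
qed

text \<open>The integral of the derivative of \<open>gauss p \<kappa>\<close> vanishes.\<close>

lemma gauss_first_moment:
  assumes "0 < Re p"
  shows "2 * p * (LINT x|lborel. of_real x * gauss p \<kappa> x) = \<i> * of_real \<kappa> * (LINT x|lborel. gauss p \<kappa> x)"
proof -
  note i = integrable_gauss_moment[OF assms, of 1 \<kappa>] integrable_gauss_moment[OF assms, of 0 \<kappa>]
  have "(LINT x|lborel. (- 2 * p * of_real x + \<i> * of_real \<kappa>) * gauss p \<kappa> x) = 0"
  proof (rule integral_deriv_eq_0[OF gauss_has_derivative])
    have "integrable lborel (\<lambda>x. - 2 * p * (of_real x * gauss p \<kappa> x) + \<i> * of_real \<kappa> * gauss p \<kappa> x)"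
      using i by (intro Bochner_Integration.integrable_add integrable_mult_right) auto
    then show "integrable lborel (\<lambda>x. (- 2 * p * of_real x + \<i> * of_real \<kappa>) * gauss p \<kappa> x)"
      by (simp add: algebra_simps)
    show "(gauss p \<kappa> \<longlongrightarrow> 0) at_infinity"
      using gauss_moment_tendsto_0[OF assms, of 0 \<kappa>] by simp
  qed (intro continuous_intros isCont_gauss)
  moreover have "(LINT x|lborel. (- 2 * p * of_real x + \<i> * of_real \<kappa>) * gauss p \<kappa> x) =
      (LINT x|lborel. - 2 * p * (of_real x * gauss p \<kappa> x) + \<i> * of_real \<kappa> * gauss p \<kappa> x)"
    by (simp add: algebra_simps)
  moreover have "\<dots> = - 2 * p * (LINT x|lborel. of_real x * gauss p \<kappa> x) + \<i> * of_real \<kappa> * (LINT x|lborel. gauss p \<kappa> x)"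
    using i by (subst Bochner_Integration.integral_add) auto
  ultimately show ?thesis by simp
qed

text \<open>The integral of the derivative of x times the Gaussian vanishes.\<close>

lemma gauss_second_moment:
  assumes "0 < Re p"
  shows "2 * p * (LINT x|lborel. of_real x ^ 2 * gauss p 0 x) = (LINT x|lborel. gauss p 0 x)"
proof -
  note i = integrable_gauss_moment[OF assms, of 2 0] integrable_gauss_moment[OF assms, of 0 0]
  let ?f = "\<lambda>x. gauss p 0 x + - 2 * p * (of_real x ^ 2 * gauss p 0 x)"
  have "(LINT x|lborel. ?f x) = 0"
  proof (rule integral_deriv_eq_0)
    show "((\<lambda>x. of_real x * gauss p 0 x) has_vector_derivative ?f x) (at x)" for x
      by (rule derivative_eq_intros gauss_has_derivative refl | simp add: power2_eq_square algebra_simps)+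
    show "integrable lborel ?f"
      using i by (intro Bochner_Integration.integrable_add integrable_mult_right) auto
    show "((\<lambda>x. of_real x * gauss p 0 x) \<longlongrightarrow> 0) at_infinity"
      using gauss_moment_tendsto_0[OF assms, of 1 0] by simp
  qed (intro continuous_intros isCont_gauss)
  moreover have "(LINT x|lborel. ?f x) = (LINT x|lborel. gauss p 0 x) + - 2 * p * (LINT x|lborel. of_real x ^ 2 * gauss p 0 x)"
    using i by (subst Bochner_Integration.integral_add) auto
  ultimately show ?thesis by (simp add: algebra_simps)
qed

lemma norm_iexp_remainder: "cmod (exp (\<i> * of_real u) - 1 - \<i> * of_real u) \<le> u\<^sup>2"
proof -
  have "cmod (exp (\<i> * of_real u) - 1 - \<i> * of_real u) \<le> u\<^sup>2 / 2"
    using iexp_approx1[of u 1] by (simp add: numeral_2_eq_2 diff_diff_eq power2_eq_square)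
  then show ?thesis by (rule order_trans) simp
qed

text \<open>The remainder |exp(iu) - 1 - iu| is at most u^2, so integrability against a^2 controls
  the difference quotient directly. It is used with a(x) = x, to vary the frequency, and with a(x) =
  x^2, to vary Im p.\<close>

lemma has_vector_derivative_phase_integral:
  fixes g :: "real \<Rightarrow> complex" and a :: "real \<Rightarrow> real"
  assumes g: "integrable lborel g" and ag: "integrable lborel (\<lambda>x. of_real (a x) * g x)"
    and aag: "integrable lborel (\<lambda>x. of_real ((a x)\<^sup>2) * g x)" and a[measurable]: "a \<in> borel_measurable borel"
  shows "((\<lambda>t. LINT x|lborel. exp (\<i> * of_real (t * a x)) * g x) has_vector_derivative
     (LINT x|lborel. \<i> * of_real (a x) * exp (\<i> * of_real (t * a x)) * g x)) (at t)"
proof -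
  have [measurable]: "g \<in> borel_measurable borel" using g by auto
  let ?e = "\<lambda>t x. exp (\<i> * of_real (t * a x)) * g x"
  let ?d = "\<lambda>x. \<i> * of_real (a x) * exp (\<i> * of_real (t * a x)) * g x"
  let ?C = "LINT x|lborel. (a x)\<^sup>2 * cmod (g x)"
  have i1: "integrable lborel (?e t)" for t
    by (rule Bochner_Integration.integrable_bound[OF g]) (auto simp: norm_mult)
  have i2: "integrable lborel ?d"
    by (rule Bochner_Integration.integrable_bound[OF ag]) (auto simp: norm_mult)
  have i3: "integrable lborel (\<lambda>x. (a x)\<^sup>2 * cmod (g x))"
    using integrable_norm[OF aag] by (simp add: norm_mult norm_power)
  let ?R = "\<lambda>s. (LINT x|lborel. ?e s x) - (LINT x|lborel. ?e t x) - (s - t) *\<^sub>R (LINT x|lborel. ?d x)"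
  have main: "cmod (?R s)
      \<le> (s - t)\<^sup>2 * ?C" for s
  proof -
    have eq: "?R s
       = (LINT x|lborel. ?e s x - ?e t x - (s - t) *\<^sub>R ?d x)"
      using i1 i2 by simp
    have "cmod (LINT x|lborel. ?e s x - ?e t x - (s - t) *\<^sub>R ?d x)
        \<le> (LINT x|lborel. (s - t)\<^sup>2 * ((a x)\<^sup>2 * cmod (g x)))"
    proof (rule norm_integral_le)
      show "integrable lborel (\<lambda>x. (s - t)\<^sup>2 * ((a x)\<^sup>2 * cmod (g x)))" using i3 by simp
      fix x
      have "exp (\<i> * of_real (s * a x)) = exp (\<i> * of_real (t * a x)) * exp (\<i> * of_real ((s - t) * a x))"
        by (simp add: exp_add[symmetric] algebra_simps)
      then have "?e s x - ?e t x - (s - t) *\<^sub>R ?d x =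
         exp (\<i> * of_real (t * a x)) * (exp (\<i> * of_real ((s - t) * a x)) - 1 - \<i> * of_real ((s - t) * a x)) * g x"
        by (simp add: scaleR_conv_of_real algebra_simps)
      then have "cmod (?e s x - ?e t x - (s - t) *\<^sub>R ?d x) =
         cmod (exp (\<i> * of_real ((s - t) * a x)) - 1 - \<i> * of_real ((s - t) * a x)) * cmod (g x)"
        by (simp add: norm_mult)
      also have "\<dots> \<le> ((s - t) * a x)\<^sup>2 * cmod (g x)"
        by (intro mult_right_mono norm_iexp_remainder) auto
      finally show "cmod (?e s x - ?e t x - (s - t) *\<^sub>R ?d x) \<le> (s - t)\<^sup>2 * ((a x)\<^sup>2 * cmod (g x))"
        by (simp only: power_mult_distrib mult.assoc)
    qed
    also have "\<dots> = (s - t)\<^sup>2 * ?C" by (rule integral_mult_right_zero)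
    finally show ?thesis unfolding eq .
  qed
  show ?thesis
    unfolding has_vector_derivative_def has_derivative_iff_norm
  proof
    show "bounded_linear (\<lambda>x. x *\<^sub>R integral\<^sup>L lborel ?d)" by (rule bounded_linear_scaleR_left)
    show "((\<lambda>s. cmod (?R s) / norm (s - t)) \<longlongrightarrow> 0) (at t)"
    proof (rule Lim_null_comparison)
      show "((\<lambda>s. norm (s - t) * ?C) \<longlongrightarrow> 0) (at t)"
        by (rule tendsto_eq_intros refl | simp)+
      have "norm (cmod (?R s) / norm (s - t)) \<le> norm (s - t) * ?C" if "s \<noteq> t" for s
      proof -
        have "cmod (?R s) \<le> norm (s - t) * ?C * norm (s - t)"
        proof -
          have "norm (s - t) * ?C * norm (s - t) = \<bar>s - t\<bar> * \<bar>s - t\<bar> * ?C" by (simp only: real_norm_def mult_ac)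
          then show ?thesis using main[of s] by (simp only: power2_eq_square abs_mult_self_eq)
        qed
        moreover have "0 < norm (s - t)" using that by simp
        ultimately show ?thesis by (simp only: norm_divide real_norm_def abs_divide abs_norm_cancel abs_abs pos_divide_le_eq)
      qed
      then show "\<forall>\<^sub>F s in at t. norm (cmod (?R s) / norm (s - t)) \<le> norm (s - t) * ?C"
        by (auto simp: eventually_at_filter)
    qed
  qed
qed

text \<open>By the first moment identity, the integral as a function F of the frequency solves the
  linear equation F' = - \<open>\<kappa>\<close> / (2 p) F.\<close>

lemma integral_gauss_shift:
  assumes "0 < Re p"
  shows "(LINT x|lborel. gauss p \<kappa> x) = (LINT x|lborel. gauss p 0 x) * exp (- of_real (\<kappa>\<^sup>2) / (4 * p))"
proof -
  define F where "F \<kappa> = (LINT x|lborel. gauss p \<kappa> x)" for \<kappa>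
  have p: "p \<noteq> 0" using assms by auto
  have F': "(F has_vector_derivative - of_real \<kappa> / (2 * p) * F \<kappa>) (at \<kappa>)" for \<kappa>
  proof -
    have eq: "gauss p k x = exp (\<i> * of_real (k * x)) * gauss p 0 x" for k x
      by (simp only: gauss_def exp_add) (simp add: mult.commute)
    have "((\<lambda>k. LINT x|lborel. exp (\<i> * of_real (k * x)) * gauss p 0 x) has_vector_derivative
        (LINT x|lborel. \<i> * of_real x * exp (\<i> * of_real (\<kappa> * x)) * gauss p 0 x)) (at \<kappa>)"
      using integrable_gauss_moment[OF assms, of 0 0] integrable_gauss_moment[OF assms, of 1 0]
        integrable_gauss_moment[OF assms, of 2 0]
      by (intro has_vector_derivative_phase_integral) auto
    moreover have "(LINT x|lborel. \<i> * of_real x * exp (\<i> * of_real (\<kappa> * x)) * gauss p 0 x)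
        = \<i> * (LINT x|lborel. of_real x * gauss p \<kappa> x)"
      by (simp add: eq[of \<kappa>] mult.assoc)
    moreover have "(LINT x|lborel. of_real x * gauss p \<kappa> x) = \<i> * of_real \<kappa> / (2 * p) * F \<kappa>"
      using gauss_first_moment[OF assms, of \<kappa>] p by (simp add: F_def field_simps)
    ultimately show ?thesis
      unfolding F_def[abs_def] eq[symmetric] by (simp add: field_simps)
  qed
  have e: "((\<lambda>k. exp (of_real (k\<^sup>2) / (4 * p))) has_vector_derivative of_real \<kappa> / (2 * p) * exp (of_real (\<kappa>\<^sup>2) / (4 * p))) (at \<kappa>)" for \<kappa>
  proof -
    have "((\<lambda>z. exp (z\<^sup>2 / (4 * p))) has_field_derivative of_real \<kappa> / (2 * p) * exp ((of_real \<kappa>)\<^sup>2 / (4 * p))) (at (of_real \<kappa>))"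
      by (rule derivative_eq_intros refl | use p in \<open>simp add: field_simps\<close>)+
    from has_vector_derivative_real_field[OF this] show ?thesis by simp
  qed
  \<comment> \<open>Multiplication by the integrating factor makes the function constant.\<close>
  have "((\<lambda>k. F k * exp (of_real (k\<^sup>2) / (4 * p))) has_vector_derivative 0) (at k)" for k
    by (rule has_vector_derivative_eq_rhs[OF has_vector_derivative_mult[OF F' e]]) (simp add: algebra_simps)
  then obtain c where c: "\<And>k. F k * exp (of_real (k\<^sup>2) / (4 * p)) = c"
    using has_vector_derivative_zero_constant[of UNIV "\<lambda>k. F k * exp (of_real (k\<^sup>2) / (4 * p))"] by auto
  have "F \<kappa> * exp (of_real (\<kappa>\<^sup>2) / (4 * p)) = F 0"
    using c[of \<kappa>] c[of 0] by simp
  then show ?thesis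
    unfolding F_def by (simp add: exp_minus field_simps)
qed

text \<open>Im p is moved continuously from 0, where the integral is real and known, by means of the
  second moment identity. Working with the square of the integral and stating only its modulus
  avoids choosing a branch of the square root of p.\<close>

lemma norm_integral_gauss:
  assumes "0 < Re p"
  shows "(cmod (LINT x|lborel. gauss p 0 x))\<^sup>2 = pi / cmod p"
proof -
  define \<eta> where "\<eta> = Re p"
  define q where "q b = of_real \<eta> - \<i> * of_real b" for b
  have q: "0 < Re (q b)" "q b \<noteq> 0" for b using assms by (auto simp: q_def \<eta>_def complex_eq_iff)
  define F where "F b = (LINT x|lborel. gauss (q b) 0 x)" for b
  have F': "(F has_vector_derivative \<i> / (2 * q b) * F b) (at b)" for b
  proof -
    have eq: "gauss (q b) 0 x = exp (\<i> * of_real (b * x\<^sup>2)) * gauss (of_real \<eta>) 0 x" for b x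
      by (simp add: gauss_def q_def algebra_simps exp_diff flip: exp_add)
    have *: "0 < Re (complex_of_real \<eta>)" using assms by (simp add: \<eta>_def)
    have "((\<lambda>b. LINT x|lborel. exp (\<i> * of_real (b * x\<^sup>2)) * gauss (of_real \<eta>) 0 x) has_vector_derivative
        (LINT x|lborel. \<i> * of_real (x\<^sup>2) * exp (\<i> * of_real (b * x\<^sup>2)) * gauss (of_real \<eta>) 0 x)) (at b)"
      using integrable_gauss_moment[OF *, of 0 0] integrable_gauss_moment[OF *, of 2 0]
        integrable_gauss_moment[OF *, of 4 0]
      by (intro has_vector_derivative_phase_integral) auto
    moreover have "(LINT x|lborel. \<i> * of_real (x\<^sup>2) * exp (\<i> * of_real (b * x\<^sup>2)) * gauss (of_real \<eta>) 0 x)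
        = \<i> * (LINT x|lborel. of_real x ^ 2 * gauss (q b) 0 x)"
      by (simp add: eq mult.assoc)
    moreover have "(LINT x|lborel. of_real x ^ 2 * gauss (q b) 0 x) = 1 / (2 * q b) * F b"
      using gauss_second_moment[OF q(1), of b] q by (simp add: F_def field_simps)
    ultimately show ?thesis
      unfolding F_def[abs_def] eq[symmetric] by (simp add: field_simps)
  qed
  have q': "(q has_vector_derivative - \<i>) (at b)" for b
    unfolding q_def by (rule derivative_eq_intros refl | simp add: has_vector_derivative_mult_right has_vector_derivative_of_real)+
  \<comment> \<open>F' = i F / (2 q) and q' = -i make the derivative of F^2 q vanish; the constant
    is pi, by the real Gaussian at b = 0.\<close>
  have "((\<lambda>b. F b * F b * q b) has_vector_derivative 0) (at b)" for b
    using q(2)[of b]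
    by (intro has_vector_derivative_eq_rhs[OF has_vector_derivative_mult[OF has_vector_derivative_mult[OF F' F'] q']])
       (simp add: field_simps)
  then obtain c where c: "\<And>b. F b * F b * q b = c"
    using has_vector_derivative_zero_constant[of UNIV "\<lambda>b. F b * F b * q b"] by auto
  have "gauss (q 0) 0 x = of_real (exp (- \<eta> * x\<^sup>2))" for x
    by (simp add: gauss_def q_def flip: exp_of_real)
  then have "F 0 = (LINT x|lborel. complex_of_real (exp (- \<eta> * x\<^sup>2)))"
    by (simp only: F_def)
  also have "\<dots> = of_real (sqrt (pi / \<eta>))"
    using integral_gaussian[of \<eta>] assms by (simp add: \<eta>_def)
  finally have "F 0 = of_real (sqrt (pi / \<eta>))" .
  then have "F 0 * F 0 * q 0 = of_real (sqrt (pi / \<eta>) * sqrt (pi / \<eta>) * \<eta>)"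
    by (simp only: q_def of_real_mult) simp
  also have "\<dots> = of_real pi" using assms by (simp add: \<eta>_def)
  finally have "F (- Im p) * F (- Im p) * q (- Im p) = of_real pi" using c by metis
  moreover have "q (- Im p) = p" by (simp add: q_def \<eta>_def complex_eq_iff)
  ultimately have "cmod (F (- Im p) * F (- Im p) * p) = pi" by simp
  moreover have "p \<noteq> 0" using assms by auto
  ultimately show ?thesis
    unfolding F_def \<open>q (- Im p) = p\<close> by (simp add: norm_mult power2_eq_square field_simps)
qed

section \<open>The Schroedinger kernel\<close>

lemma (in pair_sigma_finite) integrable_tensor:
  fixes f :: "'a \<Rightarrow> 'c::{real_normed_field, banach, second_countable_topology}"
  assumes f: "integrable M1 f" and g: "integrable M2 g"
  shows "integrable (M1 \<Otimes>\<^sub>M M2) (\<lambda>p. f (fst p) * g (snd p))"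
    and "(LINT p|(M1 \<Otimes>\<^sub>M M2). f (fst p) * g (snd p)) = (LINT x|M1. f x) * (LINT x|M2. g x)"
proof -
  have [measurable]: "f \<in> borel_measurable M1" "g \<in> borel_measurable M2" using f g by auto
  show *: "integrable (M1 \<Otimes>\<^sub>M M2) (\<lambda>p. f (fst p) * g (snd p))"
  proof (rule Fubini_integrable)
    show "integrable M1 (\<lambda>x. LINT y|M2. norm (f (fst (x, y)) * g (snd (x, y))))"
      using f g by (simp add: norm_mult)
    show "AE x in M1. integrable M2 (\<lambda>y. f (fst (x, y)) * g (snd (x, y)))"
      using g by simp
  qed measurable
  have "(LINT p|(M1 \<Otimes>\<^sub>M M2). f (fst p) * g (snd p)) = (LINT x|M1. LINT y|M2. f x * g y)"
    using integral_fst'[OF *] by simp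
  then show "(LINT p|(M1 \<Otimes>\<^sub>M M2). f (fst p) * g (snd p)) = (LINT x|M1. f x) * (LINT x|M2. g x)"
    by simp
qed

text \<open>The cut-off makes the singularity integrable on the whole line, so that translates in
  time all have the same mass. At r = 0 the value is 0 because \<open>0 powr a = 0\<close>, in
  agreement with \<open>schr_kernel 0 x = 0\<close>, which comes from division by 0.\<close>

definition sing_kernel :: "real \<Rightarrow> real \<Rightarrow> real \<Rightarrow> real" where
  "sing_kernel T \<gamma> r = indicator {-T..T} r * \<bar>r\<bar> powr - \<gamma>"

lemma sing_kernel_nonneg: "0 \<le> sing_kernel T \<gamma> r"
  by (simp add: sing_kernel_def)

lemma sing_kernel_measurable [measurable]: "sing_kernel T \<gamma> \<in> borel_measurable borel"
  unfolding sing_kernel_def by measurable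

lemma integrable_sing_kernel:
  assumes "0 \<le> T" "\<gamma> < 1"
  shows "integrable lborel (sing_kernel T \<gamma>)"
proof -
  have int: "((\<lambda>x. x powr - \<gamma>) has_integral (T powr (- \<gamma> + 1) / (- \<gamma> + 1))) {0..T}"
    using assms by (intro has_integral_powr_from_0) auto
  have eq: "(\<lambda>x. indicator {0..} x *\<^sub>R sing_kernel T \<gamma> x) = (\<lambda>x. if x \<in> {0..T} then x powr - \<gamma> else 0)"
    using assms by (auto simp: sing_kernel_def indicator_def fun_eq_iff)
  have "((\<lambda>x. indicator {0..} x *\<^sub>R sing_kernel T \<gamma> x) has_integral (T powr (- \<gamma> + 1) / (- \<gamma> + 1))) UNIV"
    unfolding eq has_integral_restrict_UNIV by (rule int)
  then have "(\<integral>\<^sup>+x. ennreal (indicator {0..} x *\<^sub>R sing_kernel T \<gamma> x) \<partial>lborel) = ennreal (T powr (- \<gamma> + 1) / (- \<gamma> + 1))"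
    by (intro nn_integral_has_integral_lborel) (auto simp: sing_kernel_nonneg)
  then have "integrable lborel (\<lambda>x. indicator {0..} x *\<^sub>R sing_kernel T \<gamma> x)"
    by (intro integrableI_nonneg) (auto simp: sing_kernel_nonneg)
  then have "has_bochner_integral lborel (\<lambda>x. indicator {0..} x *\<^sub>R sing_kernel T \<gamma> x)
      (LINT x|lborel. indicator {0..} x *\<^sub>R sing_kernel T \<gamma> x)"
    by (rule has_bochner_integral_integrable)
  moreover have "sing_kernel T \<gamma> (- x) = sing_kernel T \<gamma> x" for x
    by (auto simp: sing_kernel_def indicator_def)
  ultimately show ?thesis
    by (intro integrable.intros[OF has_bochner_integral_even_function])
qed

definition sing_mass :: "real \<Rightarrow> real \<Rightarrow> real" where
  "sing_mass T \<gamma> = (LINT r|lborel. sing_kernel T \<gamma> r)"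

lemma sing_mass_nonneg: "0 \<le> sing_mass T \<gamma>"
  unfolding sing_mass_def by (intro Bochner_Integration.integral_nonneg sing_kernel_nonneg)

lemma sing_kernel_shift:
  assumes "0 \<le> T" "\<gamma> < 1"
  shows "integrable lborel (\<lambda>s. sing_kernel T \<gamma> (t - s))"
    "(LINT s|lborel. sing_kernel T \<gamma> (t - s)) = sing_mass T \<gamma>"
proof -
  show "integrable lborel (\<lambda>s. sing_kernel T \<gamma> (t - s))"
    using lborel_integrable_real_affine[OF integrable_sing_kernel[OF assms], of "-1" t] by simp
  show "(LINT s|lborel. sing_kernel T \<gamma> (t - s)) = sing_mass T \<gamma>"
    using lborel_integral_real_affine[of "-1" "sing_kernel T \<gamma>" t] by (simp add: sing_mass_def)
qed

lemma tensor_sing_kernel: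
  assumes "0 \<le> T" "\<gamma> < 1" "integrable lborel m"
  shows "integrable (lborel \<Otimes>\<^sub>M lborel) (\<lambda>p. sing_kernel T \<gamma> (t - fst p) * m (snd p))"
    "(LINT p|(lborel \<Otimes>\<^sub>M lborel). sing_kernel T \<gamma> (t - fst p) * m (snd p)) = sing_mass T \<gamma> * (LINT w|lborel. m w)"
proof -
  note i = sing_kernel_shift[OF assms(1,2), of t]
  show "integrable (lborel \<Otimes>\<^sub>M lborel) (\<lambda>p. sing_kernel T \<gamma> (t - fst p) * m (snd p))"
    by (rule lborel_pair.integrable_tensor(1)[OF i(1) assms(3)])
  show "(LINT p|(lborel \<Otimes>\<^sub>M lborel). sing_kernel T \<gamma> (t - fst p) * m (snd p)) = sing_mass T \<gamma> * (LINT w|lborel. m w)"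
    unfolding lborel_pair.integrable_tensor(2)[OF i(1) assms(3)] i(2) ..
qed

section \<open>Size, increments and pairings of the Schroedinger kernel\<close>

lemma csqrt_mult_i:
  "csqrt (of_real r * \<i>) = of_real (sqrt (\<bar>r\<bar> / 2)) + \<i> * of_real ((if r = 0 then 1 else sgn r) * sqrt (\<bar>r\<bar> / 2))"
  by (rule complex_eqI) (simp_all add: norm_mult)

text \<open>Measurability in the time variable is read off the explicit square root in
  \<open>csqrt_mult_i\<close>, which is elementary in |r| and the sign of r.\<close>

lemma schr_kernel_measurable [measurable (raw)]:
  assumes [measurable]: "f \<in> borel_measurable M" "g \<in> borel_measurable M"
  shows "(\<lambda>x. schr_kernel (f x) (g x)) \<in> borel_measurable M"
  unfolding schr_kernel_def csqrt_mult_i sgn_if by measurable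

lemma isCont_schr_kernel: "isCont (schr_kernel t) x"
proof (cases "t = 0")
  case True
  then have "schr_kernel t = (\<lambda>_. 0)" by (auto simp: schr_kernel_def)
  then show ?thesis by simp
next
  case False
  then show ?thesis
    unfolding schr_kernel_def[abs_def] by (intro continuous_intros) auto
qed

lemma norm_schr_kernel: "cmod (schr_kernel t x) = 1 / sqrt (4 * pi * \<bar>t\<bar>)"
proof -
  have "cmod (exp (\<i> * of_real (x\<^sup>2 / (4 * t)))) = 1" by (simp only: norm_exp_i_times)
  then show ?thesis by (simp add: schr_kernel_def norm_divide norm_mult)
qed

lemma powr_neg_half: "0 \<le> r \<Longrightarrow> r powr - (1/2) = 1 / sqrt r" for r :: real
  by (simp only: powr_minus_divide powr_half_sqrt)

lemma norm_schr_kernel_le: "cmod (schr_kernel t x) \<le> \<bar>t\<bar> powr - (1/2)"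
proof (cases "t = 0")
  case False
  have "1 * \<bar>t\<bar> \<le> 4 * pi * \<bar>t\<bar>" using pi_ge_two by (intro mult_right_mono) auto
  then show ?thesis
    using False unfolding norm_schr_kernel by (simp add: powr_neg_half frac_le)
qed (simp add: schr_kernel_def)

text \<open>The exponential is 1-Lipschitz on the closed left half-plane, a convex set on which its
  derivative has modulus at most 1.\<close>

lemma norm_exp_minus_1_le:
  assumes "Re w \<le> 0"
  shows "cmod (exp w - 1) \<le> cmod w"
proof -
  have "cmod (exp w - exp 0) \<le> 1 * cmod (w - 0)"
  proof (rule field_differentiable_bound)
    show "convex {z. Re z \<le> 0}" by (rule convex_halfspace_Re_le)
    show "(exp has_field_derivative exp z) (at z within {z. Re z \<le> 0})" for z :: complex
      by (rule has_field_derivative_at_within[OF DERIV_exp])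
  qed (use assms in auto)
  then show ?thesis by simp
qed

text \<open>Interpolation between a trivial bound and a linear one; the source of every fractional
  gain \<open>\<theta>\<close> in the kernel estimates.\<close>

lemma le_powr_interpolate:
  fixes x r \<theta> :: real
  assumes "x \<le> 2" "x \<le> r" "0 \<le> r" "0 < \<theta>" "\<theta> \<le> 1"
  shows "x \<le> 2 * r powr \<theta>"
proof (cases "r \<le> 1")
  case True
  have "r \<le> r powr \<theta>"
  proof (cases "r = 0")
    case False
    then have "r powr 1 \<le> r powr \<theta>" using assms True by (intro powr_mono') auto
    then show ?thesis using False assms by simp
  qed simp
  moreover have "0 \<le> r powr \<theta>" by simp
  ultimately show ?thesis using assms by linarith
next
  case False
  then have "1 \<le> r powr \<theta>" using assms by (intro ge_one_powr_ge_zero) auto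
  then show ?thesis using assms by linarith
qed

lemma norm_exp_minus_1_le_powr:
  assumes "Re w \<le> 0" "cmod w \<le> r" "0 < \<theta>" "\<theta> \<le> 1"
  shows "cmod (exp w - 1) \<le> 2 * r powr \<theta>"
proof (rule le_powr_interpolate)
  have "cmod (exp w) \<le> 1" using assms by (simp add: norm_exp_eq_Re)
  then show "cmod (exp w - 1) \<le> 2" using norm_triangle_ineq4[of "exp w" 1] unfolding norm_one by linarith
  show "cmod (exp w - 1) \<le> r" using norm_exp_minus_1_le[OF assms(1)] assms(2) by simp
  show "0 \<le> r" using norm_ge_zero[of w] assms(2) by linarith
qed (use assms in auto)

text \<open>At equal times two kernel values differ by the unimodular factor exp(i (a^2 - b^2) / (4
  t)), whose distance to 1 is interpolated with exponent \<open>\<theta>\<close>.\<close>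

lemma norm_schr_kernel_diff_le:
  assumes "0 < \<theta>" "\<theta> \<le> 1"
  shows "cmod (schr_kernel t a - schr_kernel t b) \<le> 2 * \<bar>a\<^sup>2 - b\<^sup>2\<bar> powr \<theta> * \<bar>t\<bar> powr - (1/2 + \<theta>)"
proof (cases "t = 0")
  case False
  let ?w = "\<i> * of_real ((a\<^sup>2 - b\<^sup>2) / (4 * t))"
  have "schr_kernel t a - schr_kernel t b = schr_kernel t b * (exp ?w - 1)"
  proof -
    have "exp (\<i> * of_real (a\<^sup>2 / (4 * t))) = exp (\<i> * of_real (b\<^sup>2 / (4 * t))) * exp ?w"
      by (simp add: exp_add[symmetric] diff_divide_distrib algebra_simps)
    then show ?thesis by (simp add: schr_kernel_def algebra_simps diff_divide_distrib)
  qed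
  then have "cmod (schr_kernel t a - schr_kernel t b) = cmod (schr_kernel t b) * cmod (exp ?w - 1)"
    by (simp add: norm_mult)
  also have "\<dots> \<le> \<bar>t\<bar> powr - (1/2) * (2 * (\<bar>a\<^sup>2 - b\<^sup>2\<bar> / \<bar>t\<bar>) powr \<theta>)"
  proof (intro mult_mono norm_schr_kernel_le norm_exp_minus_1_le_powr)
    have "\<bar>a\<^sup>2 - b\<^sup>2\<bar> / (4 * \<bar>t\<bar>) \<le> \<bar>a\<^sup>2 - b\<^sup>2\<bar> / \<bar>t\<bar>"
      using False by (intro divide_left_mono) auto
    moreover have "cmod ?w = \<bar>a\<^sup>2 - b\<^sup>2\<bar> / (4 * \<bar>t\<bar>)"
      by (simp only: norm_mult norm_ii norm_of_real abs_divide abs_mult abs_numeral mult_1)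
    ultimately show "cmod ?w \<le> \<bar>a\<^sup>2 - b\<^sup>2\<bar> / \<bar>t\<bar>" by simp
  qed (use assms in auto)
  also have "\<dots> = 2 * \<bar>a\<^sup>2 - b\<^sup>2\<bar> powr \<theta> * \<bar>t\<bar> powr - (1/2 + \<theta>)"
  proof -
    have "\<bar>t\<bar> powr - (1/2 + \<theta>) = \<bar>t\<bar> powr - (1/2) * (1 / \<bar>t\<bar> powr \<theta>)"
      by (simp only: minus_add_distrib powr_add powr_minus_divide[of _ \<theta>])
    moreover have "(\<bar>a\<^sup>2 - b\<^sup>2\<bar> / \<bar>t\<bar>) powr \<theta> = \<bar>a\<^sup>2 - b\<^sup>2\<bar> powr \<theta> * (1 / \<bar>t\<bar> powr \<theta>)"
      by (simp add: powr_divide)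
    ultimately show ?thesis by (simp only: mult_ac)
  qed
  finally show ?thesis .
qed (simp add: schr_kernel_def)

text \<open>
  The Gaussian weight makes the pairing absolutely convergent. As \<eta> tends to 0, the exponent w
  tends to that of the kernel at time a - b; the bounds stated here do not depend on \<eta>.
\<close>

lemma schr_pairing:
  assumes a: "0 < a" "a \<le> T" and b: "0 < b" "b \<le> T" and "a \<noteq> b" and \<eta>: "0 < \<eta>" "4 * \<eta> * T \<le> 1"
  obtains Z where "cmod Z \<le> \<bar>a - b\<bar> powr - (1/2)"
    "\<And>h h'. \<exists>w. Re w \<le> 0 \<and> cmod w \<le> (h\<^sup>2 + h'\<^sup>2) / \<bar>a - b\<bar> \<and>
       (LINT x|lborel. of_real (exp (- \<eta> * x\<^sup>2)) * (schr_kernel a (x - h) * cnj (schr_kernel b (x - h')))) = Z * exp w"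
proof -
  \<comment> \<open>The coefficient of x^2 in the phase of one kernel times the conjugate of the
    other; c collects the two prefactors.\<close>
  define \<beta> where "\<beta> = (1 / a - 1 / b) / 4"
  define p where "p = of_real \<eta> - \<i> * of_real \<beta>"
  define c where "c = csqrt (of_real (4 * pi * a) * \<i>) * cnj (csqrt (of_real (4 * pi * b) * \<i>))"
  define Z where "Z = (LINT x|lborel. gauss p 0 x) / c"
  have p: "0 < Re p" "p \<noteq> 0" using \<eta> by (auto simp: p_def complex_eq_iff)
  have norm_p: "\<bar>a - b\<bar> / (4 * (a * b)) \<le> cmod p"
  proof -
    have "\<bar>\<beta>\<bar> = \<bar>(b - a) / (4 * (a * b))\<bar>" using a b by (simp add: \<beta>_def field_simps)
    also have "\<dots> = \<bar>a - b\<bar> / (4 * (a * b))"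
      using a b by (simp add: abs_divide abs_mult abs_minus_commute)
    finally show ?thesis using abs_Im_le_cmod[of p] by (simp add: p_def)
  qed
  have norm_c: "(cmod c)\<^sup>2 = 16 * pi\<^sup>2 * (a * b)"
    using a b by (simp add: c_def norm_mult power_mult_distrib power2_eq_square algebra_simps)
  \<comment> \<open>|p| is bounded below by |Im p| = |a - b| / (4 a b), uniformly in
    \<open>\<eta>\<close>. The factor a b cancels against |c|^2 = 16 pi^2 a b, so that only the time
    difference remains.\<close>
  have Z: "cmod Z \<le> \<bar>a - b\<bar> powr - (1/2)"
  proof -
    have pos: "0 < \<bar>a - b\<bar>" "0 < a * b" "0 < cmod p" using assms p by auto
    have "(cmod Z)\<^sup>2 = pi / cmod p / (16 * pi\<^sup>2 * (a * b))"
      unfolding Z_def norm_divide power_divide norm_integral_gauss[OF p(1)] norm_c ..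
    also have "\<dots> \<le> pi / (\<bar>a - b\<bar> / (4 * (a * b))) / (16 * pi\<^sup>2 * (a * b))"
      using pos norm_p by (intro divide_right_mono divide_left_mono mult_pos_pos) auto
    also have "\<dots> = (1 / (4 * pi)) * (1 / \<bar>a - b\<bar>)"
      using pos a b by (simp add: field_simps power2_eq_square)
    also have "\<dots> \<le> 1 * (1 / \<bar>a - b\<bar>)"
      using pi_ge_two by (intro mult_right_mono) auto
    finally have "(cmod Z)\<^sup>2 \<le> (1 / sqrt \<bar>a - b\<bar>)\<^sup>2" by (simp add: power_divide)
    then have "cmod Z \<le> 1 / sqrt \<bar>a - b\<bar>" by (rule power2_le_imp_le) simp
    then show ?thesis by (simp add: powr_neg_half)
  qed
  show ?thesis
  proof (rule that[OF Z])
    fix h h' :: real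
    \<comment> \<open>The linear and the constant coefficient of the phase after expanding (x - h)^2
      / (4 a) - (x - h')^2 / (4 b).\<close>
    define \<kappa> where "\<kappa> = - (h / a - h' / b) / 2"
    define r where "r = (h\<^sup>2 / a - h'\<^sup>2 / b) / 4"
    define w where "w = - of_real (\<kappa>\<^sup>2) / (4 * p) + \<i> * of_real r"
    have "of_real (exp (- \<eta> * x\<^sup>2)) * (schr_kernel a (x - h) * cnj (schr_kernel b (x - h'))) =
        gauss p \<kappa> x * (exp (\<i> * of_real r) / c)" for x
    proof -
      have "of_real (- \<eta> * x\<^sup>2) + \<i> * of_real ((x - h)\<^sup>2 / (4 * a)) + - \<i> * of_real ((x - h')\<^sup>2 / (4 * b))
          = (- p * of_real (x\<^sup>2) + \<i> * of_real (\<kappa> * x)) + \<i> * of_real r"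
        using a b unfolding p_def \<kappa>_def r_def \<beta>_def
        by (simp add: complex_eq_iff field_simps power2_eq_square)
      then have "exp (of_real (- \<eta> * x\<^sup>2)) * exp (\<i> * of_real ((x - h)\<^sup>2 / (4 * a))) * exp (- \<i> * of_real ((x - h')\<^sup>2 / (4 * b)))
          = gauss p \<kappa> x * exp (\<i> * of_real r)"
        unfolding gauss_def by (simp only: exp_add[symmetric])
      moreover have "cnj (schr_kernel b (x - h')) = exp (- \<i> * of_real ((x - h')\<^sup>2 / (4 * b))) / cnj (csqrt (of_real (4 * pi * b) * \<i>))"
        by (simp add: schr_kernel_def exp_cnj)
      ultimately show ?thesis
        by (simp only: schr_kernel_def[of a] c_def exp_of_real[symmetric] times_divide_eq_right times_divide_eq_left divide_divide_eq_left mult_ac)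
    qed
    then have int: "(LINT x|lborel. of_real (exp (- \<eta> * x\<^sup>2)) * (schr_kernel a (x - h) * cnj (schr_kernel b (x - h')))) = Z * exp w"
      using integral_gauss_shift[OF p(1), of \<kappa>] by (simp only: Z_def w_def exp_add integral_mult_left_zero) simp
    have Re: "Re w \<le> 0"
    proof -
      have "0 \<le> Re (of_real (\<kappa>\<^sup>2) / (4 * p))"
        using p unfolding Re_divide by (intro divide_nonneg_nonneg add_nonneg_nonneg) auto
      then show ?thesis by (simp add: w_def)
    qed
    \<comment> \<open>Multiplying by p exposes a cancellation: without the terms in
      \<open>\<eta>\<close> only - (h - h')^2 / (a b) is left, which over |p| is of size (h - h')^2
      / |a - b| with no singularity at a = 0 or b = 0.\<close>
    have "16 * p * w = - 4 * of_real (\<kappa>\<^sup>2) + 16 * p * (\<i> * of_real r)"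
      using p by (simp add: w_def field_simps)
    also have "\<dots> = \<i> * of_real (4 * \<eta> * (h\<^sup>2 / a - h'\<^sup>2 / b)) - of_real ((h - h')\<^sup>2 / (a * b))"
      using a b unfolding p_def \<kappa>_def r_def \<beta>_def
      by (simp add: complex_eq_iff field_simps power2_eq_square)
    finally have pw: "16 * p * w = \<dots>" .
    have "\<bar>a - b\<bar> / (4 * (a * b)) * (16 * cmod w) \<le> cmod p * (16 * cmod w)"
      by (intro mult_right_mono norm_p) auto
    also have "\<dots> = cmod (16 * p * w)" by (simp add: norm_mult)
    also have "\<dots> \<le> \<bar>4 * \<eta> * (h\<^sup>2 / a - h'\<^sup>2 / b)\<bar> + \<bar>(h - h')\<^sup>2 / (a * b)\<bar>"
      unfolding pw by (rule order_trans[OF norm_triangle_ineq4]) (simp only: norm_mult norm_of_real norm_ii mult_1 order_refl)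
    also have "\<dots> \<le> 4 * \<eta> * (h\<^sup>2 / a + h'\<^sup>2 / b) + (h - h')\<^sup>2 / (a * b)"
    proof (intro add_mono)
      have "\<bar>h\<^sup>2 / a - h'\<^sup>2 / b\<bar> \<le> h\<^sup>2 / a + h'\<^sup>2 / b"
        using a b by (simp add: abs_le_iff)
      then have "4 * \<eta> * \<bar>h\<^sup>2 / a - h'\<^sup>2 / b\<bar> \<le> 4 * \<eta> * (h\<^sup>2 / a + h'\<^sup>2 / b)"
        using \<eta> by (intro mult_left_mono) auto
      then show "\<bar>4 * \<eta> * (h\<^sup>2 / a - h'\<^sup>2 / b)\<bar> \<le> 4 * \<eta> * (h\<^sup>2 / a + h'\<^sup>2 / b)"
        using \<eta> by (simp add: abs_mult)
    qed (use a b in simp)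
    finally have e1: "\<bar>a - b\<bar> / (4 * (a * b)) * (16 * cmod w) * (a * b) \<le>
        (4 * \<eta> * (h\<^sup>2 / a + h'\<^sup>2 / b) + (h - h')\<^sup>2 / (a * b)) * (a * b)"
      using a b by (intro mult_right_mono) auto
    have e2: "\<bar>a - b\<bar> / (4 * (a * b)) * (16 * cmod w) * (a * b) = 4 * (\<bar>a - b\<bar> * cmod w)"
      using a b by (simp add: field_simps)
    have e3: "(4 * \<eta> * (h\<^sup>2 / a + h'\<^sup>2 / b) + (h - h')\<^sup>2 / (a * b)) * (a * b) =
        h\<^sup>2 * (4 * \<eta> * b) + h'\<^sup>2 * (4 * \<eta> * a) + (h - h')\<^sup>2"
      using a b by (simp add: field_simps)
    \<comment> \<open>The condition \<open>4 * \<eta> * T \<le> 1\<close> makes the error terms in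
      \<open>\<eta>\<close> no larger than h^2 + h'^2; the total 3 (h^2 + h'^2) fits under the
      factor 4 of the left-hand side.\<close>
    have e4: "h\<^sup>2 * (4 * \<eta> * b) + h'\<^sup>2 * (4 * \<eta> * a) + (h - h')\<^sup>2 \<le> h\<^sup>2 * 1 + h'\<^sup>2 * 1 + 2 * (h\<^sup>2 + h'\<^sup>2)"
    proof (intro add_mono mult_left_mono)
      have "4 * \<eta> * b \<le> 4 * \<eta> * T" "4 * \<eta> * a \<le> 4 * \<eta> * T"
        using a b \<eta> by (auto intro!: mult_left_mono)
      then show "4 * \<eta> * b \<le> 1" "4 * \<eta> * a \<le> 1" using \<eta> by linarith+
      show "(h - h')\<^sup>2 \<le> 2 * (h\<^sup>2 + h'\<^sup>2)" using norm_diff_squared_le[of h h'] by simp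
    qed auto
    have "4 * (\<bar>a - b\<bar> * cmod w) \<le> 3 * (h\<^sup>2 + h'\<^sup>2)"
      using order_trans[OF e1[unfolded e2 e3] e4] by simp
    moreover have "0 \<le> h\<^sup>2 + h'\<^sup>2" by simp
    moreover have "u \<le> v" if "4 * u \<le> 3 * v" "0 \<le> v" for u v :: real using that by linarith
    ultimately have "\<bar>a - b\<bar> * cmod w \<le> h\<^sup>2 + h'\<^sup>2" by blast
    then have "cmod w \<le> (h\<^sup>2 + h'\<^sup>2) / \<bar>a - b\<bar>"
      using \<open>a \<noteq> b\<close> by (simp add: pos_le_divide_eq mult.commute)
    with Re int show "\<exists>w. Re w \<le> 0 \<and> cmod w \<le> (h\<^sup>2 + h'\<^sup>2) / \<bar>a - b\<bar> \<and>
       (LINT x|lborel. of_real (exp (- \<eta> * x\<^sup>2)) * (schr_kernel a (x - h) * cnj (schr_kernel b (x - h')))) = Z * exp w"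
      by blast
  qed
qed

section \<open>L^2 bounds by the TT* method\<close>

lemma TT_star:
  fixes k :: "real \<Rightarrow> 'b \<Rightarrow> complex"
  assumes M: "sigma_finite_measure M"
    and k[measurable]: "(\<lambda>p. k (fst p) (snd p)) \<in> borel_measurable (lborel \<Otimes>\<^sub>M M)"
    and kB: "\<And>x \<omega>. cmod (k x \<omega>) \<le> B \<omega>" and B: "integrable M B"
    and \<rho>: "integrable lborel \<rho>" "\<And>x. 0 \<le> \<rho> x"
    and pair: "\<And>\<omega>. AE \<omega>' in M. cmod (LINT x|lborel. of_real (\<rho> x) * (k x \<omega> * cnj (k x \<omega>'))) \<le> K \<omega> \<omega>'"
    and K: "(\<integral>\<^sup>+\<omega>. \<integral>\<^sup>+\<omega>'. ennreal (K \<omega> \<omega>') \<partial>M \<partial>M) \<le> ennreal C"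
  shows "(\<integral>\<^sup>+x. ennreal (\<rho> x * (cmod (LINT \<omega>|M. k x \<omega>))\<^sup>2) \<partial>lborel) \<le> ennreal C"
proof -
  interpret M: sigma_finite_measure M by (rule M)
  interpret MM: pair_sigma_finite M M ..
  interpret P: sigma_finite_measure "M \<Otimes>\<^sub>M M" by (rule sigma_finite_pair_measure[OF M M])
  interpret LP: pair_sigma_finite lborel "M \<Otimes>\<^sub>M M" ..
  have [measurable]: "\<rho> \<in> borel_measurable borel" "B \<in> borel_measurable M" using \<rho> B by auto
  have k1[measurable]: "k x \<in> borel_measurable M" for x
    using measurable_Pair2[OF k, of x] by simp
  have kint: "integrable M (k x)" for x
    by (rule Bochner_Integration.integrable_bound[OF B])
       (use kB in \<open>auto intro: order_trans[OF _ abs_ge_self]\<close>)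
  define J where "J x = (LINT \<omega>|M. k x \<omega>)" for x
  \<comment> \<open>The square of the inner integral is an integral over pairs of parameters. The
    weight \<open>\<rho>\<close> and the majorant B make H absolutely integrable in all variables,
    so x can be integrated first, where the oscillation is felt, before absolute values are
    taken.\<close>
  define H where "H x q = of_real (\<rho> x) * (k x (fst q) * cnj (k x (snd q)))" for x q
  have H_meas[measurable]: "(\<lambda>p. H (fst p) (snd p)) \<in> borel_measurable (lborel \<Otimes>\<^sub>M (M \<Otimes>\<^sub>M M))"
  proof -
    have 1: "(\<lambda>p. k (fst p) (fst (snd p))) \<in> borel_measurable (lborel \<Otimes>\<^sub>M (M \<Otimes>\<^sub>M M))"
      using measurable_compose[of "\<lambda>p. (fst p, fst (snd p))" "lborel \<Otimes>\<^sub>M (M \<Otimes>\<^sub>M M)" "lborel \<Otimes>\<^sub>M M", OF _ k] by simp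
    have 2: "(\<lambda>p. k (fst p) (snd (snd p))) \<in> borel_measurable (lborel \<Otimes>\<^sub>M (M \<Otimes>\<^sub>M M))"
      using measurable_compose[of "\<lambda>p. (fst p, snd (snd p))" "lborel \<Otimes>\<^sub>M (M \<Otimes>\<^sub>M M)" "lborel \<Otimes>\<^sub>M M", OF _ k] by simp
    have 3: "(\<lambda>p. complex_of_real (\<rho> (fst p))) \<in> borel_measurable (lborel \<Otimes>\<^sub>M (M \<Otimes>\<^sub>M M))" by measurable
    show ?thesis unfolding H_def
      by (intro borel_measurable_times 1 3
          measurable_compose[OF 2 borel_measurable_continuous_onI[OF continuous_on_cnj[OF continuous_on_id]]])
  qed
  have H_int: "integrable (lborel \<Otimes>\<^sub>M (M \<Otimes>\<^sub>M M)) (\<lambda>p. H (fst p) (snd p))"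
  proof (rule Bochner_Integration.integrable_bound)
    show "integrable (lborel \<Otimes>\<^sub>M (M \<Otimes>\<^sub>M M)) (\<lambda>p. \<rho> (fst p) * (\<lambda>q. B (fst q) * B (snd q)) (snd p))"
      by (rule LP.integrable_tensor(1)[OF \<rho>(1) MM.integrable_tensor(1)[OF B B]])
    have "cmod (H x q) \<le> \<rho> x * (B (fst q) * B (snd q))" for x q
      unfolding H_def using \<rho>(2)[of x] kB[of x "fst q"] kB[of x "snd q"]
        order_trans[OF norm_ge_zero kB[of x "fst q"]]
      by (simp add: norm_mult) (intro mult_left_mono mult_mono; simp)
    then show "AE p in lborel \<Otimes>\<^sub>M (M \<Otimes>\<^sub>M M). norm (H (fst p) (snd p)) \<le>
        norm (\<rho> (fst p) * (\<lambda>q. B (fst q) * B (snd q)) (snd p))"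
      by (intro AE_I2) (simp only: real_norm_def order_trans[OF _ abs_ge_self])
  qed (rule H_meas)
  have inner: "(LINT q|(M \<Otimes>\<^sub>M M). H x q) = of_real (\<rho> x * (cmod (J x))\<^sup>2)" for x
  proof -
    have "(LINT q|(M \<Otimes>\<^sub>M M). H x q) = of_real (\<rho> x) * (LINT q|(M \<Otimes>\<^sub>M M). k x (fst q) * cnj (k x (snd q)))"
      unfolding H_def by simp
    also have "(LINT q|(M \<Otimes>\<^sub>M M). k x (fst q) * cnj (k x (snd q))) = J x * cnj (J x)"
      unfolding J_def using MM.integrable_tensor(2)[OF kint[of x], of "\<lambda>\<omega>. cnj (k x \<omega>)"] kint[of x]
      by simp
    finally show ?thesis by (simp add: complex_norm_square[symmetric] flip: of_real_power)
  qed
  have H_int': "integrable (lborel \<Otimes>\<^sub>M (M \<Otimes>\<^sub>M M)) (\<lambda>(x, q). H x q)"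
    using H_int by (simp add: case_prod_beta')
  have "integrable lborel (\<lambda>x. LINT q|(M \<Otimes>\<^sub>M M). H x q)"
    using LP.integrable_fst'[OF H_int] by simp
  then have int: "integrable lborel (\<lambda>x. \<rho> x * (cmod (J x))\<^sup>2)"
    unfolding inner by (simp only: complex_of_real_integrable_eq)
  define Pq where "Pq q = (LINT x|lborel. H x q)" for q
  have P_int: "integrable (M \<Otimes>\<^sub>M M) Pq"
    unfolding Pq_def by (rule LP.integrable_snd[OF H_int'])
  have "of_real (LINT x|lborel. \<rho> x * (cmod (J x))\<^sup>2) = (LINT x|lborel. LINT q|(M \<Otimes>\<^sub>M M). H x q)"
    unfolding inner by (simp only: integral_complex_of_real)
  also have "\<dots> = (LINT q|(M \<Otimes>\<^sub>M M). Pq q)"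
    unfolding Pq_def by (rule LP.Fubini_integral[OF H_int', symmetric])
  finally have eq: "complex_of_real (LINT x|lborel. \<rho> x * (cmod (J x))\<^sup>2) = (LINT q|(M \<Otimes>\<^sub>M M). Pq q)" .
  have "(LINT x|lborel. \<rho> x * (cmod (J x))\<^sup>2) \<le> cmod (LINT q|(M \<Otimes>\<^sub>M M). Pq q)"
    unfolding eq[symmetric] by simp
  also have "\<dots> \<le> (LINT q|(M \<Otimes>\<^sub>M M). cmod (Pq q))" by (rule integral_norm_bound)
  finally have "ennreal (LINT x|lborel. \<rho> x * (cmod (J x))\<^sup>2) \<le> ennreal (LINT q|(M \<Otimes>\<^sub>M M). cmod (Pq q))"
    by (rule ennreal_leI)
  also have "\<dots> = (\<integral>\<^sup>+q. ennreal (cmod (Pq q)) \<partial>(M \<Otimes>\<^sub>M M))"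
    by (rule nn_integral_eq_integral[symmetric]) (use P_int in auto)
  also have "\<dots> = (\<integral>\<^sup>+\<omega>. \<integral>\<^sup>+\<omega>'. ennreal (cmod (Pq (\<omega>, \<omega>'))) \<partial>M \<partial>M)"
    by (rule M.nn_integral_fst[symmetric]) (use P_int in measurable)
  also have "\<dots> \<le> (\<integral>\<^sup>+\<omega>. \<integral>\<^sup>+\<omega>'. ennreal (K \<omega> \<omega>') \<partial>M \<partial>M)"
  proof (rule nn_integral_mono, rule nn_integral_mono_AE)
    fix \<omega>
    show "AE \<omega>' in M. ennreal (cmod (Pq (\<omega>, \<omega>'))) \<le> ennreal (K \<omega> \<omega>')"
      using pair[of \<omega>] by eventually_elim (auto simp: Pq_def H_def intro!: ennreal_leI)
  qed
  also note K
  finally show ?thesis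
    using nn_integral_eq_integral[OF int] \<rho>(2) unfolding J_def by simp
qed

text \<open>Fatou's lemma along the weights with parameter e0 / (n + 1); it also yields square
  integrability, which is not known beforehand.\<close>

lemma L2norm_le_of_gaussian_weights:
  assumes J[measurable]: "J \<in> borel_measurable borel" and "0 < e0" "0 \<le> C"
    and bound: "\<And>\<eta>. 0 < \<eta> \<Longrightarrow> \<eta> \<le> e0 \<Longrightarrow> (\<integral>\<^sup>+x. ennreal (exp (- \<eta> * x\<^sup>2) * (cmod (J x))\<^sup>2) \<partial>lborel) \<le> ennreal C"
  shows "square_integrable J" "(L2norm J)\<^sup>2 \<le> C"
proof -
  define e where "e n = e0 * inverse (real (Suc n))" for n
  have e: "0 < e n" "e n \<le> e0" for n
  proof -
    show "0 < e n" using \<open>0 < e0\<close> by (simp add: e_def)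
    have "e0 * inverse (real (Suc n)) \<le> e0 * 1"
      using \<open>0 < e0\<close> by (intro mult_left_mono) (auto simp: field_simps)
    then show "e n \<le> e0" by (simp add: e_def)
  qed
  have "(\<lambda>n. ennreal (exp (- e n * x\<^sup>2) * (cmod (J x))\<^sup>2)) \<longlonglongrightarrow> ennreal (exp (- (e0 * 0) * x\<^sup>2) * (cmod (J x))\<^sup>2)" for x
    unfolding e_def by (intro tendsto_intros tendsto_ennrealI LIMSEQ_inverse_real_of_nat)
  then have lim: "liminf (\<lambda>n. ennreal (exp (- e n * x\<^sup>2) * (cmod (J x))\<^sup>2)) = ennreal ((cmod (J x))\<^sup>2)" for x
    by (intro lim_imp_Liminf) auto
  have "(\<integral>\<^sup>+x. ennreal ((cmod (J x))\<^sup>2) \<partial>lborel) = (\<integral>\<^sup>+x. liminf (\<lambda>n. ennreal (exp (- e n * x\<^sup>2) * (cmod (J x))\<^sup>2)) \<partial>lborel)"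
    by (simp only: lim)
  also have "\<dots> \<le> liminf (\<lambda>n. \<integral>\<^sup>+x. ennreal (exp (- e n * x\<^sup>2) * (cmod (J x))\<^sup>2) \<partial>lborel)"
    by (rule nn_integral_liminf) measurable
  also have "\<dots> \<le> ennreal C"
    by (intro Liminf_le always_eventually allI bound e) auto
  finally have nn: "(\<integral>\<^sup>+x. ennreal ((cmod (J x))\<^sup>2) \<partial>lborel) \<le> ennreal C" .
  then have int: "integrable lborel (\<lambda>x. (cmod (J x))\<^sup>2)"
    by (intro integrableI_nonneg) (auto simp: less_top[symmetric] top_unique)
  then show "square_integrable J" by (simp add: square_integrable_def)
  show "(L2norm J)\<^sup>2 \<le> C"
    using nn nn_integral_eq_integral[OF int] \<open>0 \<le> C\<close> by (simp add: L2norm_squared)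
qed

text \<open>The bound on the pairings is a product of a convolution kernel in time and masses in w,
  so the double integral is explicit: T from s, \<open>sing_mass T \<gamma>\<close> from s', and the
  square of the total mass of m.\<close>

lemma L2_estimate_from_pairing:
  fixes k :: "real \<Rightarrow> real \<times> real \<Rightarrow> complex"
  assumes T: "0 < T" and \<gamma>: "\<gamma> < 1" and D: "0 \<le> D"
    and k[measurable]: "(\<lambda>p. k (fst p) (snd p)) \<in> borel_measurable (lborel \<Otimes>\<^sub>M (lborel \<Otimes>\<^sub>M lborel))"
    and kB: "\<And>x s w. cmod (k x (s, w)) \<le> B * (sing_kernel T (1/2) (t - s) * m w)"
    and m: "integrable lborel m" "\<And>w. 0 \<le> m w"
    and pair: "\<And>\<eta> s w s' w'. 0 < \<eta> \<Longrightarrow> 4 * \<eta> * T \<le> 1 \<Longrightarrow> s \<noteq> s' \<Longrightarrow>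
       cmod (LINT x|lborel. of_real (exp (- \<eta> * x\<^sup>2)) * (k x (s, w) * cnj (k x (s', w'))))
       \<le> D * (indicator {0..T} s * m w) * (sing_kernel T \<gamma> (s - s') * m w')"
  shows "square_integrable (\<lambda>x. LINT p|(lborel \<Otimes>\<^sub>M lborel). k x p)"
    "(L2norm (\<lambda>x. LINT p|(lborel \<Otimes>\<^sub>M lborel). k x p))\<^sup>2 \<le> D * T * sing_mass T \<gamma> * (LINT w|lborel. m w)\<^sup>2"
proof -
  let ?M = "lborel \<Otimes>\<^sub>M lborel :: (real \<times> real) measure"
  have M: "sigma_finite_measure ?M" by (rule lborel_pair.sigma_finite_measure_axioms)
  define I where "I = (LINT w|lborel. m w)"
  have I: "0 \<le> I" unfolding I_def using m by (intro Bochner_Integration.integral_nonneg) auto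
  have mm[measurable]: "m \<in> borel_measurable borel" using m by auto
  define C where "C = D * T * sing_mass T \<gamma> * I\<^sup>2"
  have C: "0 \<le> C" using T D sing_mass_nonneg[of T \<gamma>] I by (simp add: C_def)
  define K where "K p q = D * (indicator {0..T} (fst p) * m (snd p)) * (sing_kernel T \<gamma> (fst p - fst q) * m (snd q))"
    for p q :: "real \<times> real"
  have K: "(\<integral>\<^sup>+p. \<integral>\<^sup>+q. ennreal (K p q) \<partial>?M \<partial>?M) \<le> ennreal C"
  proof -
    have "(\<integral>\<^sup>+q. ennreal (K p q) \<partial>?M) = ennreal ((indicator {0..T} (fst p) * m (snd p)) * (D * sing_mass T \<gamma> * I))" for p
    proof -
      have "(\<integral>\<^sup>+q. ennreal (K p q) \<partial>?M) = ennreal (LINT q|?M. K p q)"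
        unfolding K_def using T \<gamma> m D
        by (intro nn_integral_eq_integral integrable_mult_right tensor_sing_kernel) (auto simp: sing_kernel_nonneg)
      also have "(LINT q|?M. K p q) = D * (indicator {0..T} (fst p) * m (snd p)) * (sing_mass T \<gamma> * I)"
        unfolding K_def I_def using T \<gamma> m by (simp only: integral_mult_right_zero tensor_sing_kernel(2) less_imp_le)
      finally show ?thesis by (simp add: mult_ac)
    qed
    then have "(\<integral>\<^sup>+p. \<integral>\<^sup>+q. ennreal (K p q) \<partial>?M \<partial>?M) = (\<integral>\<^sup>+p. ennreal ((indicator {0..T} (fst p) * m (snd p)) * (D * sing_mass T \<gamma> * I)) \<partial>?M)"
      by simp
    also have "\<dots> = ennreal (LINT p|?M. (indicator {0..T} (fst p) * m (snd p)) * (D * sing_mass T \<gamma> * I))"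
    proof (rule nn_integral_eq_integral)
      have "integrable ?M (\<lambda>p. indicator {0..T} (fst p) * m (snd p))"
        by (rule lborel_pair.integrable_tensor(1)) (use m T in \<open>auto simp: emeasure_lborel_Icc_eq\<close>)
      then show "integrable ?M (\<lambda>p. (indicator {0..T} (fst p) * m (snd p)) * (D * sing_mass T \<gamma> * I))"
        by (rule integrable_mult_left)
    qed (use m D I sing_mass_nonneg in auto)
    also have "(LINT p|?M. (indicator {0..T} (fst p) * m (snd p)) * (D * sing_mass T \<gamma> * I)) = T * I * (D * sing_mass T \<gamma> * I)"
    proof -
      have "(LINT p|?M. indicator {0..T} (fst p) * m (snd p)) = T * I"
        unfolding I_def using T m
        by (subst lborel_pair.integrable_tensor(2)) (auto simp: emeasure_lborel_Icc_eq)
      then show ?thesis by (simp only: integral_mult_left_zero)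
    qed
    finally show ?thesis by (simp add: C_def power2_eq_square mult_ac)
  qed
  have AE_neq: "AE q in ?M. fst q \<noteq> s" for s :: real
  proof -
    have "AE x in lborel. AE y in lborel. fst (x, y::real) \<noteq> s"
      using AE_lborel_singleton[of s] by eventually_elim auto
    moreover have "{q \<in> space ?M. fst q \<noteq> s} \<in> sets ?M" by measurable
    ultimately show ?thesis by (intro lborel_pair.AE_pair_measure)
  qed
  have kM[measurable]: "k x \<in> borel_measurable ?M" for x
    using measurable_Pair2[OF k, of x] by simp
  have Jm: "(\<lambda>x. LINT p|?M. k x p) \<in> borel_measurable borel"
    using sigma_finite_measure.borel_measurable_lebesgue_integral[OF M, of "\<lambda>x p. k x p" lborel] k
    by (simp add: case_prod_beta')
  have bound: "(\<integral>\<^sup>+x. ennreal (exp (- \<eta> * x\<^sup>2) * (cmod (LINT p|?M. k x p))\<^sup>2) \<partial>lborel) \<le> ennreal C"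
    if \<eta>: "0 < \<eta>" "\<eta> \<le> 1 / (4 * T)" for \<eta>
  proof (rule TT_star[OF M k, where K = K])
    show "cmod (k x p) \<le> B * (sing_kernel T (1/2) (t - fst p) * m (snd p))" for x p
      using kB[of x "fst p" "snd p"] by simp
    show "integrable ?M (\<lambda>p. B * (sing_kernel T (1/2) (t - fst p) * m (snd p)))"
      using T m by (intro integrable_mult_right tensor_sing_kernel) auto
    show "integrable lborel (\<lambda>x. exp (- \<eta> * x\<^sup>2))"
      using integrable_gaussian_moment[OF \<eta>(1), of 0] by simp
    show "AE q in ?M. cmod (LINT x|lborel. of_real (exp (- \<eta> * x\<^sup>2)) * (k x p * cnj (k x q))) \<le> K p q" for p
      using AE_neq[of "fst p"]
    proof eventually_elim
      case (elim q)
      have "4 * \<eta> * T \<le> 1" using \<eta>(2) T by (simp add: field_simps)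
      then show ?case
        unfolding K_def using pair[OF \<eta>(1), of "fst p" "fst q" "snd p" "snd q"] elim by simp
    qed
  qed (use K in auto)
  note fin = L2norm_le_of_gaussian_weights[OF Jm _ C bound, of "1 / (4 * T)"]
  show "square_integrable (\<lambda>x. LINT p|?M. k x p)" using fin(1) T by simp
  show "(L2norm (\<lambda>x. LINT p|?M. k x p))\<^sup>2 \<le> D * T * sing_mass T \<gamma> * (LINT w|lborel. m w)\<^sup>2"
    using fin(2) T by (simp add: C_def I_def)
qed

lemma sing_kernel_eq:
  assumes "s \<in> {0..t}" "t \<le> T"
  shows "sing_kernel T \<gamma> (t - s) = \<bar>t - s\<bar> powr - \<gamma>"
  using assms by (auto simp: sing_kernel_def)

lemma schr_kernel_0 [simp]: "schr_kernel 0 x = 0"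
  by (simp add: schr_kernel_def)

lemma borel_measurable_cnj [measurable]: "cnj \<in> borel_measurable borel"
  by (intro borel_measurable_continuous_onI continuous_intros)

text \<open>The positions \<open>c w\<close> are arbitrary: they enter a pairing only through
  \<open>exp z\<close> with Re z at most 0, which has modulus at most 1.\<close>

lemma schr_L2_estimate:
  fixes A :: "real \<times> real \<Rightarrow> complex"
  assumes T: "0 < T" and t: "0 \<le> t" "t \<le> T"
    and A[measurable]: "A \<in> borel_measurable (lborel \<Otimes>\<^sub>M lborel)" and c[measurable]: "c \<in> borel_measurable borel"
    and AB: "\<And>s w. cmod (A (s, w)) \<le> indicator {0..t} s * m w"
    and m: "integrable lborel m" "\<And>w. 0 \<le> m w"
  defines "J \<equiv> \<lambda>x. LINT p|(lborel \<Otimes>\<^sub>M lborel). schr_kernel (t - fst p) (x - c (snd p)) * A p"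
  shows "square_integrable J" "(L2norm J)\<^sup>2 \<le> T * sing_mass T (1/2) * (LINT w|lborel. m w)\<^sup>2"
proof -
  let ?k = "\<lambda>x p. schr_kernel (t - fst p) (x - c (snd p)) * A p"
  have km: "(\<lambda>p. ?k (fst p) (snd p)) \<in> borel_measurable (lborel \<Otimes>\<^sub>M (lborel \<Otimes>\<^sub>M lborel))"
    by measurable
  have kB: "cmod (?k x (s, w)) \<le> 1 * (sing_kernel T (1/2) (t - s) * m w)" for x s w
  proof (cases "s \<in> {0..t}")
    case True
    then show ?thesis
      using AB[of s w] norm_schr_kernel_le[of "t - s" "x - c w"] sing_kernel_eq[OF True t(2), of "1/2"]
      by (auto simp: norm_mult intro!: mult_mono)
  next
    case False
    then have "A (s, w) = 0" using AB[of s w] by simp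
    then show ?thesis using m(2)[of w] by (simp add: sing_kernel_nonneg)
  qed
  have pair: "cmod (LINT x|lborel. of_real (exp (- \<eta> * x\<^sup>2)) * (?k x (s, w) * cnj (?k x (s', w'))))
       \<le> 1 * (indicator {0..T} s * m w) * (sing_kernel T (1/2) (s - s') * m w')"
    if \<eta>: "0 < \<eta>" "4 * \<eta> * T \<le> 1" and ss: "s \<noteq> s'" for \<eta> s w s' w'
  proof (cases "s \<in> {0..<t} \<and> s' \<in> {0..<t}")
    case True
    have pre: "0 < t - s" "t - s \<le> T" "0 < t - s'" "t - s' \<le> T" "t - s \<noteq> t - s'"
      using True t ss by auto
    obtain Z where Z: "cmod Z \<le> \<bar>(t - s) - (t - s')\<bar> powr - (1/2)"
     "\<And>h h'. \<exists>z. Re z \<le> 0 \<and> cmod z \<le> (h\<^sup>2 + h'\<^sup>2) / \<bar>(t - s) - (t - s')\<bar> \<and>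
       (LINT x|lborel. of_real (exp (- \<eta> * x\<^sup>2)) * (schr_kernel (t - s) (x - h) * cnj (schr_kernel (t - s') (x - h')))) = Z * exp z"
      by (rule schr_pairing[OF pre \<eta>], rule that)
    obtain z where z: "Re z \<le> 0"
       "(LINT x|lborel. of_real (exp (- \<eta> * x\<^sup>2)) * (schr_kernel (t - s) (x - c w) * cnj (schr_kernel (t - s') (x - c w')))) = Z * exp z"
      using Z(2)[of "c w" "c w'"] by blast
    have "of_real (exp (- \<eta> * x\<^sup>2)) * (?k x (s, w) * cnj (?k x (s', w'))) =
        (A (s, w) * cnj (A (s', w'))) * (of_real (exp (- \<eta> * x\<^sup>2)) * (schr_kernel (t - s) (x - c w) * cnj (schr_kernel (t - s') (x - c w'))))" for x
      by (simp add: mult_ac)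
    then have "(LINT x|lborel. of_real (exp (- \<eta> * x\<^sup>2)) * (?k x (s, w) * cnj (?k x (s', w')))) =
       (A (s, w) * cnj (A (s', w'))) * (Z * exp z)"
      by (simp only: integral_mult_right_zero z)
    then have "cmod (LINT x|lborel. of_real (exp (- \<eta> * x\<^sup>2)) * (?k x (s, w) * cnj (?k x (s', w'))))
        = (cmod (A (s, w)) * cmod (A (s', w'))) * (cmod Z * cmod (exp z))"
      by (simp only: norm_mult complex_mod_cnj)
    also have "\<dots> \<le> (m w * m w') * (\<bar>(t - s) - (t - s')\<bar> powr - (1/2) * 1)"
      using AB[of s w] AB[of s' w'] True z(1) m(2)[of w] m(2)[of w'] Z(1)
      by (intro mult_mono) (auto simp: indicator_def)
    also have "\<dots> = 1 * (indicator {0..T} s * m w) * (sing_kernel T (1/2) (s - s') * m w')"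
      using True t by (auto simp: sing_kernel_def indicator_def abs_minus_commute)
    finally show ?thesis .
  next
    case False
    \<comment> \<open>The pairing lemma requires positive times t - s. Outside \<open>{0..t}\<close>
      the amplitude vanishes, and at s = t the kernel itself does.\<close>
    have "?k x (s, w) = 0 \<or> ?k x (s', w') = 0" for x
    proof (rule ccontr)
      assume "\<not> ?thesis"
      then have "A (s, w) \<noteq> 0" "A (s', w') \<noteq> 0" "t \<noteq> s" "t \<noteq> s'" by auto
      then show False using False AB[of s w] AB[of s' w'] by (auto simp: indicator_def split: if_splits)
    qed
    then have "of_real (exp (- \<eta> * x\<^sup>2)) * (?k x (s, w) * cnj (?k x (s', w'))) = 0" for x
      by (metis complex_cnj_zero mult_zero_left mult_zero_right)
    then show ?thesis
      using m(2)[of w] m(2)[of w'] by (simp only:) (simp add: sing_kernel_nonneg)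
  qed
  show "square_integrable J" "(L2norm J)\<^sup>2 \<le> T * sing_mass T (1/2) * (LINT w|lborel. m w)\<^sup>2"
    using L2_estimate_from_pairing[where k = ?k and \<gamma> = "1/2" and D = 1, OF T _ _ km kB m pair]
    unfolding J_def by auto
qed

text \<open>Because 2 \<open>\<theta>\<close> is below 1, the displacement costs at most one factor
  1 + |w| and one factor 1 + |w'|, so first moments suffice.\<close>

lemma sum_squares_powr_le:
  fixes e w w' \<theta> :: real
  assumes "0 \<le> e" "0 < \<theta>" "\<theta> < 1/2"
  shows "((e * w)\<^sup>2 + (e * w')\<^sup>2) powr \<theta> \<le> e powr (2 * \<theta>) * ((1 + \<bar>w\<bar>) * (1 + \<bar>w'\<bar>))"
proof -
  define Y where "Y = (1 + \<bar>w\<bar>) * (1 + \<bar>w'\<bar>)"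
  have Y: "1 \<le> Y" unfolding Y_def using mult_mono[of 1 "1 + \<bar>w\<bar>" 1 "1 + \<bar>w'\<bar>"] by simp
  have "w\<^sup>2 + w'\<^sup>2 \<le> Y\<^sup>2"
  proof -
    have "\<bar>w\<bar> + \<bar>w'\<bar> \<le> Y" by (simp add: Y_def algebra_simps)
    then have "(\<bar>w\<bar> + \<bar>w'\<bar>)\<^sup>2 \<le> Y\<^sup>2" by (intro power_mono) auto
    moreover have "w\<^sup>2 + w'\<^sup>2 \<le> (\<bar>w\<bar> + \<bar>w'\<bar>)\<^sup>2" by (simp add: power2_sum)
    ultimately show ?thesis by simp
  qed
  then have "(e * w)\<^sup>2 + (e * w')\<^sup>2 \<le> (e * Y)\<^sup>2"
    using mult_left_mono[of "w\<^sup>2 + w'\<^sup>2" "Y\<^sup>2" "e\<^sup>2"] by (simp add: power_mult_distrib distrib_left)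
  then have "((e * w)\<^sup>2 + (e * w')\<^sup>2) powr \<theta> \<le> ((e * Y)\<^sup>2) powr \<theta>"
    using assms by (intro powr_mono2) auto
  also have "\<dots> = (e * Y) powr (2 * \<theta>)"
  proof (cases "e = 0")
    case False
    then have "0 < e * Y" using assms Y by (intro mult_pos_pos) auto
    then show ?thesis by (simp add: powr_powr flip: powr_numeral)
  qed simp
  also have "\<dots> = e powr (2 * \<theta>) * Y powr (2 * \<theta>)"
    using assms Y by (simp add: powr_mult)
  also have "\<dots> \<le> e powr (2 * \<theta>) * Y powr 1"
    using assms Y by (intro mult_left_mono powr_mono) auto
  finally show ?thesis using Y by (simp add: Y_def)
qed

text \<open>Pairing a kernel difference with another one is a second difference of pairings at
  displacements 0 and e w. Estimating the two kernels separately instead would gain nothing.\<close>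

lemma schr_shift_L2_estimate:
  fixes A :: "real \<times> real \<Rightarrow> complex"
  assumes T: "0 < T" and t: "0 \<le> t" "t \<le> T" and \<theta>: "0 < \<theta>" "\<theta> < 1/2" and e: "0 \<le> e"
    and A[measurable]: "A \<in> borel_measurable (lborel \<Otimes>\<^sub>M lborel)"
    and AB: "\<And>s w. cmod (A (s, w)) \<le> indicator {0..t} s * m w"
    and m: "integrable lborel (\<lambda>w. m w * (1 + \<bar>w\<bar>))" "\<And>w. 0 \<le> m w"
  defines "J \<equiv> \<lambda>x. LINT p|(lborel \<Otimes>\<^sub>M lborel).
    (schr_kernel (t - fst p) (x - e * snd p) - schr_kernel (t - fst p) x) * A p"
  shows "square_integrable J"
    "(L2norm J)\<^sup>2 \<le> (8 * e powr (2 * \<theta>)) * T * sing_mass T (1/2 + \<theta>) * (LINT w|lborel. m w * (1 + \<bar>w\<bar>))\<^sup>2"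
proof -
  let ?m = "\<lambda>w. m w * (1 + \<bar>w\<bar>)"
  let ?k = "\<lambda>x p. (schr_kernel (t - fst p) (x - e * snd p) - schr_kernel (t - fst p) x) * A p"
  have km: "(\<lambda>p. ?k (fst p) (snd p)) \<in> borel_measurable (lborel \<Otimes>\<^sub>M (lborel \<Otimes>\<^sub>M lborel))"
    by measurable
  have m0: "0 \<le> ?m w" "m w \<le> ?m w" for w
    using m(2)[of w] by (auto simp: distrib_left)
  have kB: "cmod (?k x (s, w)) \<le> 2 * (sing_kernel T (1/2) (t - s) * ?m w)" for x s w
  proof (cases "s \<in> {0..t}")
    case True
    have "cmod (schr_kernel (t - s) (x - e * w) - schr_kernel (t - s) x) \<le> \<bar>t - s\<bar> powr - (1/2) + \<bar>t - s\<bar> powr - (1/2)"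
      by (rule order_trans[OF norm_triangle_ineq4]) (intro add_mono norm_schr_kernel_le)
    also have "\<dots> = 2 * sing_kernel T (1/2) (t - s)" using sing_kernel_eq[OF True t(2), of "1/2"] by simp
    finally have "cmod (?k x (s, w)) \<le> (2 * sing_kernel T (1/2) (t - s)) * ?m w"
      using AB[of s w] True m0(2)[of w] sing_kernel_nonneg[of T "1/2" "t - s"]
      by (simp only: norm_mult fst_conv snd_conv) (intro mult_mono, auto)
    then show ?thesis by simp
  next
    case False
    then have "A (s, w) = 0" using AB[of s w] by simp
    then show ?thesis using m0(1)[of w] by (simp add: sing_kernel_nonneg)
  qed
  have pair: "cmod (LINT x|lborel. of_real (exp (- \<eta> * x\<^sup>2)) * (?k x (s, w) * cnj (?k x (s', w'))))
       \<le> (8 * e powr (2 * \<theta>)) * (indicator {0..T} s * ?m w) * (sing_kernel T (1/2 + \<theta>) (s - s') * ?m w')"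
    if \<eta>: "0 < \<eta>" "4 * \<eta> * T \<le> 1" and ss: "s \<noteq> s'" for \<eta> s w s' w'
  proof (cases "s \<in> {0..<t} \<and> s' \<in> {0..<t}")
    case True
    define a b where "a = t - s" and "b = t - s'"
    have ab: "0 < \<bar>a - b\<bar>" "\<bar>a - b\<bar> = \<bar>s - s'\<bar>" using ss by (auto simp: a_def b_def)
    let ?I = "\<lambda>h h'. LINT x|lborel. of_real (exp (- \<eta> * x\<^sup>2)) * (schr_kernel a (x - h) * cnj (schr_kernel b (x - h')))"
    have pre: "0 < a" "a \<le> T" "0 < b" "b \<le> T" "a \<noteq> b"
      using True t ss by (auto simp: a_def b_def)
    obtain Z where Z: "cmod Z \<le> \<bar>a - b\<bar> powr - (1/2)"
     "\<And>h h'. \<exists>z. Re z \<le> 0 \<and> cmod z \<le> (h\<^sup>2 + h'\<^sup>2) / \<bar>a - b\<bar> \<and> ?I h h' = Z * exp z"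
      by (rule schr_pairing[OF pre \<eta>], rule that)
    define h h' where "h = e * w" and "h' = e * w'"
    define r where "r = (h\<^sup>2 + h'\<^sup>2) / \<bar>a - b\<bar>"
    \<comment> \<open>All four pairings share the factor Z, which depends on the two times but not
      on the displacements.\<close>
    have E: "\<exists>E. cmod (E - 1) \<le> 2 * r powr \<theta> \<and> ?I g g' = Z * E" if "g = 0 \<or> g = h" "g' = 0 \<or> g' = h'" for g g'
    proof -
      obtain z where z: "Re z \<le> 0" "cmod z \<le> (g\<^sup>2 + g'\<^sup>2) / \<bar>a - b\<bar>" "?I g g' = Z * exp z"
        using Z(2) by blast
      have "(g\<^sup>2 + g'\<^sup>2) / \<bar>a - b\<bar> \<le> r"
        unfolding r_def using that by (intro divide_right_mono) auto
      then have "cmod (exp z - 1) \<le> 2 * r powr \<theta>"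
        using z \<theta> by (intro norm_exp_minus_1_le_powr) auto
      then show ?thesis using z(3) by blast
    qed
    obtain E1 E2 E3 E4 where EE: "cmod (E1 - 1) \<le> 2 * r powr \<theta>" "?I h h' = Z * E1"
      "cmod (E2 - 1) \<le> 2 * r powr \<theta>" "?I h 0 = Z * E2" "cmod (E3 - 1) \<le> 2 * r powr \<theta>" "?I 0 h' = Z * E3"
      "cmod (E4 - 1) \<le> 2 * r powr \<theta>" "?I 0 0 = Z * E4"
      using E[of h h'] E[of h 0] E[of 0 h'] E[of 0 0] by blast
    have int: "integrable lborel (\<lambda>x. of_real (exp (- \<eta> * x\<^sup>2)) * (schr_kernel a (x - g) * cnj (schr_kernel b (x - g'))))" for g g'
    proof (rule Bochner_Integration.integrable_bound)
      show "integrable lborel (\<lambda>x. (\<bar>a\<bar> powr - (1/2) * \<bar>b\<bar> powr - (1/2)) * (\<bar>x\<bar> ^ 0 * exp (- \<eta> * x\<^sup>2)))"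
        by (intro integrable_mult_right integrable_gaussian_moment \<eta>)
      show "AE x in lborel. norm (of_real (exp (- \<eta> * x\<^sup>2)) * (schr_kernel a (x - g) * cnj (schr_kernel b (x - g'))))
        \<le> norm ((\<bar>a\<bar> powr - (1/2) * \<bar>b\<bar> powr - (1/2)) * (\<bar>x\<bar> ^ 0 * exp (- \<eta> * x\<^sup>2)))"
        using mult_mono[OF norm_schr_kernel_le[of a] norm_schr_kernel_le[of b]]
        by (intro AE_I2) (simp add: norm_mult mult.commute)
    qed measurable
    have "of_real (exp (- \<eta> * x\<^sup>2)) * (?k x (s, w) * cnj (?k x (s', w'))) =
        (A (s, w) * cnj (A (s', w'))) *
         (of_real (exp (- \<eta> * x\<^sup>2)) * (schr_kernel a (x - h) * cnj (schr_kernel b (x - h')))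
          - of_real (exp (- \<eta> * x\<^sup>2)) * (schr_kernel a (x - h) * cnj (schr_kernel b (x - 0)))
          - of_real (exp (- \<eta> * x\<^sup>2)) * (schr_kernel a (x - 0) * cnj (schr_kernel b (x - h')))
          + of_real (exp (- \<eta> * x\<^sup>2)) * (schr_kernel a (x - 0) * cnj (schr_kernel b (x - 0))))" for x
      by (simp add: algebra_simps a_def b_def h_def h'_def)
    then have "(LINT x|lborel. of_real (exp (- \<eta> * x\<^sup>2)) * (?k x (s, w) * cnj (?k x (s', w')))) =
       (A (s, w) * cnj (A (s', w'))) * (?I h h' - ?I h 0 - ?I 0 h' + ?I 0 0)"
      by (simp only: integral_mult_right_zero Bochner_Integration.integral_add Bochner_Integration.integral_diff
          Bochner_Integration.integrable_diff Bochner_Integration.integrable_add int)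
    \<comment> \<open>In the alternating sum the four constants 1 cancel. Four errors of size 2
      r^theta remain, whence the constant 8.\<close>
    also have "\<dots> = (A (s, w) * cnj (A (s', w'))) * (Z * (((E1 - 1) - (E2 - 1)) - ((E3 - 1) - (E4 - 1))))"
      unfolding EE by (simp add: algebra_simps)
    finally have "cmod (LINT x|lborel. of_real (exp (- \<eta> * x\<^sup>2)) * (?k x (s, w) * cnj (?k x (s', w'))))
        = (cmod (A (s, w)) * cmod (A (s', w'))) * (cmod Z * cmod (((E1 - 1) - (E2 - 1)) - ((E3 - 1) - (E4 - 1))))"
      by (simp only: norm_mult complex_mod_cnj)
    also have "\<dots> \<le> (m w * m w') * (\<bar>a - b\<bar> powr - (1/2) * (8 * r powr \<theta>))"
    proof (intro mult_mono Z)
      show "cmod (A (s, w)) \<le> m w" "cmod (A (s', w')) \<le> m w'"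
        using AB[of s w] AB[of s' w'] True by auto
      show "cmod (((E1 - 1) - (E2 - 1)) - ((E3 - 1) - (E4 - 1))) \<le> 8 * r powr \<theta>"
        using norm_triangle_ineq4[of "(E1 - 1) - (E2 - 1)" "(E3 - 1) - (E4 - 1)"]
          norm_triangle_ineq4[of "E1 - 1" "E2 - 1"] norm_triangle_ineq4[of "E3 - 1" "E4 - 1"] EE(1,3,5,7)
        by linarith
    qed (use m(2) in auto)
    also have "\<dots> = 8 * (m w * m w') * \<bar>a - b\<bar> powr - (1/2 + \<theta>) * (h\<^sup>2 + h'\<^sup>2) powr \<theta>"
    proof -
      have "\<bar>a - b\<bar> powr - (1/2 + \<theta>) = \<bar>a - b\<bar> powr - (1/2) * (1 / \<bar>a - b\<bar> powr \<theta>)"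
        by (simp only: minus_add_distrib powr_add powr_minus_divide[of _ \<theta>])
      moreover have "r powr \<theta> = (h\<^sup>2 + h'\<^sup>2) powr \<theta> * (1 / \<bar>a - b\<bar> powr \<theta>)"
        by (simp add: r_def powr_divide)
      ultimately show ?thesis by (simp only: mult_ac)
    qed
    also have "\<dots> \<le> 8 * (m w * m w') * \<bar>a - b\<bar> powr - (1/2 + \<theta>) * (e powr (2 * \<theta>) * ((1 + \<bar>w\<bar>) * (1 + \<bar>w'\<bar>)))"
      unfolding h_def h'_def using m(2)[of w] m(2)[of w'] sum_squares_powr_le[OF e \<theta>]
      by (intro mult_left_mono) auto
    also have "\<dots> = (8 * e powr (2 * \<theta>)) * (1 * ?m w) * (\<bar>a - b\<bar> powr - (1/2 + \<theta>) * ?m w')"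
      by (simp only: mult_ac mult_1)
    also have "\<dots> = (8 * e powr (2 * \<theta>)) * (indicator {0..T} s * ?m w) * (sing_kernel T (1/2 + \<theta>) (s - s') * ?m w')"
    proof -
      have "indicator {0..T} s = (1::real)" "sing_kernel T (1/2 + \<theta>) (s - s') = \<bar>a - b\<bar> powr - (1/2 + \<theta>)"
        using True t ab(2) by (auto simp: sing_kernel_def indicator_def)
      then show ?thesis by (simp only:)
    qed
    finally show ?thesis .
  next
    case False
    have "?k x (s, w) = 0 \<or> ?k x (s', w') = 0" for x
    proof (rule ccontr)
      assume "\<not> ?thesis"
      then have "A (s, w) \<noteq> 0" "A (s', w') \<noteq> 0" "t \<noteq> s" "t \<noteq> s'" by auto
      then show False using False AB[of s w] AB[of s' w'] by (auto simp: indicator_def split: if_splits)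
    qed
    then have "of_real (exp (- \<eta> * x\<^sup>2)) * (?k x (s, w) * cnj (?k x (s', w'))) = 0" for x
      by (metis complex_cnj_zero mult_zero_left mult_zero_right)
    then show ?thesis
      using m0(1)[of w] m0(1)[of w'] by (simp only:) (simp add: sing_kernel_nonneg)
  qed
  show "square_integrable J"
    "(L2norm J)\<^sup>2 \<le> (8 * e powr (2 * \<theta>)) * T * sing_mass T (1/2 + \<theta>) * (LINT w|lborel. m w * (1 + \<bar>w\<bar>))\<^sup>2"
    using L2_estimate_from_pairing[where k = ?k and \<gamma> = "1/2 + \<theta>" and D = "8 * e powr (2 * \<theta>)", OF T _ _ km kB m(1) m0(1) pair] \<theta>
    unfolding J_def by auto
qed

lemma L2norm_shift:
  assumes "square_integrable f"
  shows "square_integrable (\<lambda>x. f (x - a))" "L2norm (\<lambda>x. f (x - a)) = L2norm f"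
proof -
  have "integrable lborel (\<lambda>x. (cmod (f x))\<^sup>2)" and [measurable]: "f \<in> borel_measurable borel"
    using assms by (auto simp: square_integrable_def)
  then show "square_integrable (\<lambda>x. f (x - a))"
    using lborel_integrable_real_affine[of "\<lambda>x. (cmod (f x))\<^sup>2" 1 "- a"] by (simp add: square_integrable_def)
  show "L2norm (\<lambda>x. f (x - a)) = L2norm f"
    using lborel_integral_real_affine[of 1 "\<lambda>x. (cmod (f x))\<^sup>2" "- a"] by (simp add: L2norm_def)
qed

section \<open>Duhamel terms\<close>

definition power_nl :: "real \<Rightarrow> complex \<Rightarrow> complex" where
  "power_nl q z = of_real (cmod z powr q) * z"

lemma power_nl_measurable [measurable]: "power_nl q \<in> borel_measurable borel"
  unfolding power_nl_def by measurable

lemma power_nl_0 [simp]: "power_nl q 0 = 0"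
  by (simp add: power_nl_def)

lemma norm_power_nl_le:
  assumes "0 \<le> q" "cmod z \<le> K"
  shows "cmod (power_nl q z) \<le> K powr q * K"
proof -
  have "cmod z powr q * cmod z \<le> K powr q * K"
    using assms by (intro mult_mono powr_mono2) auto
  then show ?thesis by (simp add: power_nl_def norm_mult)
qed

lemma powr_diff_le:
  fixes a b q :: real
  assumes "0 < q" "0 \<le> b" "b \<le> a" "a \<le> K"
  shows "a powr (q + 1) - b powr (q + 1) \<le> (q + 1) * K powr q * (a - b)"
proof (cases "a = b")
  case False
  then have "b < a" using assms by simp
  have "\<exists>l z. b < z \<and> z < a \<and> ((\<lambda>x. x powr (q + 1)) has_real_derivative l) (at z) \<and>
      a powr (q + 1) - b powr (q + 1) = (a - b) * l"
  proof (rule MVT)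
    show "continuous_on {b..a} (\<lambda>x. x powr (q + 1))"
      using assms by (intro continuous_on_powr' continuous_intros) auto
    show "(\<lambda>x. x powr (q + 1)) differentiable (at x)" if "b < x" "x < a" for x
      using that assms by (auto simp: real_differentiable_def intro!: exI has_real_derivative_powr)
  qed fact
  then obtain l z where z: "b < z" "z < a" "((\<lambda>x. x powr (q + 1)) has_real_derivative l) (at z)"
    "a powr (q + 1) - b powr (q + 1) = (a - b) * l" by blast
  have "((\<lambda>x. x powr (q + 1)) has_real_derivative (q + 1) * z powr (q + 1 - 1)) (at z)"
    using z assms by (intro has_real_derivative_powr) auto
  then have "l = (q + 1) * z powr q" using DERIV_unique[OF z(3)] by fastforce
  also have "\<dots> \<le> (q + 1) * K powr q"
    using assms z by (intro mult_left_mono powr_mono2) auto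
  finally show ?thesis
    using z(4) \<open>b < a\<close> by (simp add: mult.commute mult_left_mono)
qed simp

text \<open>The constant q + 2 is the sum of 1, from varying z at frozen modulus, and q + 1, from
  the derivative of the power q + 1.\<close>

lemma power_nl_lipschitz:
  assumes "0 < q" "cmod a \<le> K" "cmod b \<le> K"
  shows "cmod (power_nl q a - power_nl q b) \<le> (q + 2) * K powr q * cmod (a - b)"
proof -
  have *: "cmod (power_nl q a - power_nl q b) \<le> (q + 2) * K powr q * cmod (a - b)"
    if "cmod b \<le> cmod a" "cmod a \<le> K" for a b
  proof -
    \<comment> \<open>The difference of the moduli multiplies the larger number a, and |b|^q |a|
      dominates |b|^(q+1). So only the power q + 1 has to be differentiated, which stays harmless
      near 0 even for q < 1.\<close>
    have "power_nl q a - power_nl q b =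
        of_real (cmod b powr q) * (a - b) + of_real (cmod a powr q - cmod b powr q) * a"
      by (simp add: power_nl_def algebra_simps)
    then have "cmod (power_nl q a - power_nl q b) \<le>
        cmod (of_real (cmod b powr q) * (a - b)) + cmod (of_real (cmod a powr q - cmod b powr q) * a)"
      by (simp only: norm_triangle_ineq)
    also have "\<dots> = cmod b powr q * cmod (a - b) + (cmod a powr q - cmod b powr q) * cmod a"
    proof -
      have "cmod b powr q \<le> cmod a powr q" using that assms by (intro powr_mono2) auto
      then show ?thesis by (simp only: norm_mult norm_of_real) simp
    qed
    also have "(cmod a powr q - cmod b powr q) * cmod a \<le> cmod a powr (q + 1) - cmod b powr (q + 1)"
    proof -
      have "cmod b powr q * cmod b \<le> cmod b powr q * cmod a" using that by (intro mult_left_mono) auto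
      then show ?thesis by (simp add: powr_add algebra_simps)
    qed
    also have "\<dots> \<le> (q + 1) * K powr q * (cmod a - cmod b)"
      using that assms by (intro powr_diff_le) auto
    also have "\<dots> \<le> (q + 1) * K powr q * cmod (a - b)"
      using assms by (intro mult_left_mono norm_triangle_ineq2) auto
    also have "cmod b powr q * cmod (a - b) \<le> K powr q * cmod (a - b)"
      using that assms by (intro mult_right_mono powr_mono2) auto
    finally show ?thesis by (simp add: algebra_simps)
  qed
  show ?thesis
    using *[of b a] *[of a b] assms by (cases "cmod b \<le> cmod a") (auto simp: norm_minus_commute)
qed

text \<open>The density of the Duhamel integral in the pair (s, w), so that the L^2 estimates for
  amplitudes on the plane apply. The time cut-off is part of it, since nothing is known about the
  path at negative times.\<close>

definition duh_amp :: "real \<Rightarrow> real \<Rightarrow> (real \<Rightarrow> real) \<Rightarrow> real \<Rightarrow> (real \<Rightarrow> real \<Rightarrow> complex) \<Rightarrow> real \<Rightarrow> real \<times> real \<Rightarrow> complex" where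
  "duh_amp Y q V e \<psi> t p = indicator {0..t} (fst p) *\<^sub>R (of_real (V (snd p)) * power_nl q (\<psi> (fst p) (Y + e * snd p)))"

text \<open>The Duhamel term of (R) in the variable w with z = Y + e w; at e = 0 it is that of (L).\<close>

definition duhamel :: "real \<Rightarrow> real \<Rightarrow> (real \<Rightarrow> real) \<Rightarrow> real \<Rightarrow> (real \<Rightarrow> real \<Rightarrow> complex) \<Rightarrow> real \<Rightarrow> real \<Rightarrow> complex" where
  "duhamel Y q V e \<psi> t x =
     (LINT p|(lborel \<Otimes>\<^sub>M lborel). schr_kernel (t - fst p) (x - (Y + e * snd p)) * duh_amp Y q V e \<psi> t p)"

lemma H1_path_measurable:
  assumes "H1_path \<psi>"
  shows "(\<lambda>p. indicator {0..t} (fst p) *\<^sub>R \<psi> (fst p) (Y + e * snd p)) \<in> borel_measurable (lborel \<Otimes>\<^sub>M lborel)"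
proof -
  have "(\<lambda>p::real \<times> real. indicator ({0..t} \<times> UNIV) p *\<^sub>R \<psi> (fst p) (Y + e * snd p)) \<in> borel_measurable borel"
  proof (rule borel_measurable_continuous_on_indicator)
    show "{0..t} \<times> (UNIV :: real set) \<in> sets borel" by (intro borel_closed closed_Times) auto
    have "continuous_on ({0..t} \<times> UNIV) (\<lambda>p. (\<lambda>p. \<psi> (fst p) (snd p)) (fst p, Y + e * snd p))"
      by (rule continuous_on_compose2[OF H1_path_jointly_continuous[OF assms]])
         (auto intro!: continuous_intros)
    then show "continuous_on ({0..t} \<times> UNIV) (\<lambda>p. \<psi> (fst p) (Y + e * snd p))" by simp
  qed
  moreover have "(\<lambda>p::real \<times> real. indicator ({0..t} \<times> UNIV) p *\<^sub>R \<psi> (fst p) (Y + e * snd p)) =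
      (\<lambda>p. indicator {0..t} (fst p) *\<^sub>R \<psi> (fst p) (Y + e * snd p))"
    by (auto simp: indicator_def fun_eq_iff)
  ultimately show ?thesis by (simp add: lborel_prod)
qed

lemma duh_amp_measurable:
  assumes "H1_path \<psi>" and [measurable]: "V \<in> borel_measurable lborel"
  shows "duh_amp Y q V e \<psi> t \<in> borel_measurable (lborel \<Otimes>\<^sub>M lborel)"
proof -
  note [measurable] = H1_path_measurable[OF assms(1), of t Y e]
  \<comment> \<open>A second indicator inside the nonlinearity changes nothing under the outer one,
    and it makes the inner function measurable on the whole plane.\<close>
  have "(\<lambda>p. indicator {0..t} (fst p) *\<^sub>R
      (of_real (V (snd p)) * power_nl q (indicator {0..t} (fst p) *\<^sub>R \<psi> (fst p) (Y + e * snd p))))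
     \<in> borel_measurable (lborel \<Otimes>\<^sub>M lborel)"
    by measurable
  moreover have "(\<lambda>p. indicator {0..t} (fst p) *\<^sub>R
      (of_real (V (snd p)) * power_nl q (indicator {0..t} (fst p) *\<^sub>R \<psi> (fst p) (Y + e * snd p)))) = duh_amp Y q V e \<psi> t"
    by (auto simp: duh_amp_def indicator_def fun_eq_iff)
  ultimately show ?thesis by simp
qed

lemma duhamel_integrand_bound:
  assumes "0 \<le> q" "0 \<le> t" "t \<le> T" and K: "\<And>s z. s \<in> {0..t} \<Longrightarrow> cmod (\<psi> s z) \<le> K"
  shows "cmod (schr_kernel (t - fst p) (x - c) * duh_amp Y q V e \<psi> t p)
      \<le> (K powr q * K) * (sing_kernel T (1/2) (t - fst p) * \<bar>V (snd p)\<bar>)"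
proof (cases "fst p \<in> {0..t}")
  case True
  have "cmod (schr_kernel (t - fst p) (x - c)) * (\<bar>V (snd p)\<bar> * cmod (power_nl q (\<psi> (fst p) (Y + e * snd p))))
      \<le> sing_kernel T (1/2) (t - fst p) * (\<bar>V (snd p)\<bar> * (K powr q * K))"
    unfolding sing_kernel_eq[OF True assms(3)]
    by (intro mult_mono norm_schr_kernel_le norm_power_nl_le K True assms) auto
  then show ?thesis using True by (simp add: duh_amp_def norm_mult mult_ac)
next
  case False
  have "0 \<le> K" using order_trans[OF norm_ge_zero K[of 0 0]] assms by simp
  then show ?thesis using False by (simp add: duh_amp_def sing_kernel_nonneg)
qed

lemma duhamel_integrable:
  assumes "H1_path \<psi>" "V \<in> borel_measurable lborel" "integrable lborel V"
    "0 \<le> q" "0 \<le> t" "c \<in> borel_measurable borel"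
  shows "integrable (lborel \<Otimes>\<^sub>M lborel) (\<lambda>p. schr_kernel (t - fst p) (x - c (snd p)) * duh_amp Y q V e \<psi> t p)"
proof -
  obtain K where K: "\<And>s z. 0 \<le> s \<Longrightarrow> s \<le> t \<Longrightarrow> cmod (\<psi> s z) \<le> K"
    by (rule H1_path_bounds[OF assms(1), of t], rule that)
  note [measurable] = duh_amp_measurable[OF assms(1,2)] assms(6)
  show ?thesis
  proof (rule Bochner_Integration.integrable_bound)
    show "integrable (lborel \<Otimes>\<^sub>M lborel) (\<lambda>p. (K powr q * K) * (sing_kernel t (1/2) (t - fst p) * \<bar>V (snd p)\<bar>))"
      using assms by (intro integrable_mult_right tensor_sing_kernel) auto
    have "cmod (schr_kernel (t - fst p) (x - c (snd p)) * duh_amp Y q V e \<psi> t p)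
      \<le> norm ((K powr q * K) * (sing_kernel t (1/2) (t - fst p) * \<bar>V (snd p)\<bar>))" for p
      unfolding real_norm_def
      by (rule order_trans[OF duhamel_integrand_bound abs_ge_self]) (use assms K in auto)
    then show "AE p in lborel \<Otimes>\<^sub>M lborel. norm (schr_kernel (t - fst p) (x - c (snd p)) * duh_amp Y q V e \<psi> t p)
      \<le> norm ((K powr q * K) * (sing_kernel t (1/2) (t - fst p) * \<bar>V (snd p)\<bar>))" by (intro AE_I2)
  qed measurable
qed

text \<open>Continuity in x, by dominated convergence, upgrades the almost everywhere identities for
  solutions to identities at every point, in particular at the centres.\<close>

lemma duhamel_continuous:
  assumes "H1_path \<psi>" "V \<in> borel_measurable lborel" "integrable lborel V" "0 \<le> q" "0 \<le> t"
  shows "continuous_on UNIV (duhamel Y q V e \<psi> t)"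
proof -
  obtain K where K: "\<And>s z. 0 \<le> s \<Longrightarrow> s \<le> t \<Longrightarrow> cmod (\<psi> s z) \<le> K"
    by (rule H1_path_bounds[OF assms(1), of t], rule that)
  note [measurable] = duh_amp_measurable[OF assms(1,2)]
  have "(duhamel Y q V e \<psi> t \<circ> f) \<longlonglongrightarrow> duhamel Y q V e \<psi> t x" if "f \<longlonglongrightarrow> x" for f x
    unfolding duhamel_def comp_def
  proof (rule integral_dominated_convergence[where w = "\<lambda>p. (K powr q * K) * (sing_kernel t (1/2) (t - fst p) * \<bar>V (snd p)\<bar>)"])
    show "integrable (lborel \<Otimes>\<^sub>M lborel) (\<lambda>p. (K powr q * K) * (sing_kernel t (1/2) (t - fst p) * \<bar>V (snd p)\<bar>))"
      using assms by (intro integrable_mult_right tensor_sing_kernel) auto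
    show "AE p in lborel \<Otimes>\<^sub>M lborel. (\<lambda>i. schr_kernel (t - fst p) (f i - (Y + e * snd p)) * duh_amp Y q V e \<psi> t p)
       \<longlonglongrightarrow> schr_kernel (t - fst p) (x - (Y + e * snd p)) * duh_amp Y q V e \<psi> t p"
      using that by (intro AE_I2 tendsto_intros isCont_tendsto_compose[OF isCont_schr_kernel])
    show "AE p in lborel \<Otimes>\<^sub>M lborel. norm (schr_kernel (t - fst p) (f i - (Y + e * snd p)) * duh_amp Y q V e \<psi> t p)
      \<le> (K powr q * K) * (sing_kernel t (1/2) (t - fst p) * \<bar>V (snd p)\<bar>)" for i
      by (intro AE_I2 duhamel_integrand_bound) (use assms K in auto)
  qed measurable
  then show ?thesis by (auto simp: continuous_on_eq_continuous_at continuous_at_sequentially)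
qed

lemma duhamel_iterated:
  assumes "H1_path \<psi>" "V \<in> borel_measurable lborel" "integrable lborel V" "0 \<le> q" "0 \<le> t"
  shows "duhamel Y q V e \<psi> t x = (LINT s:{0..t}|lborel. LINT w|lborel.
      schr_kernel (t - s) (x - (Y + e * w)) * (of_real (V w) * power_nl q (\<psi> s (Y + e * w))))"
proof -
  have "duhamel Y q V e \<psi> t x =
     (LINT s|lborel. LINT w|lborel. schr_kernel (t - s) (x - (Y + e * w)) * duh_amp Y q V e \<psi> t (s, w))"
    unfolding duhamel_def
    using lborel_pair.integral_fst'[OF duhamel_integrable[OF assms, of "\<lambda>w. Y + e * w" x Y e]] by simp
  also have "\<dots> = (LINT s|lborel. indicator {0..t} s *\<^sub>R (LINT w|lborel.
      schr_kernel (t - s) (x - (Y + e * w)) * (of_real (V w) * power_nl q (\<psi> s (Y + e * w)))))"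
    by (intro Bochner_Integration.integral_cong) (auto simp: duh_amp_def indicator_def)
  finally show ?thesis by (simp add: set_lebesgue_integral_def)
qed

text \<open>The Jacobian of z = Y + e w cancels the factor 1/e of the rescaled potential.\<close>

lemma duhamel_R:
  assumes "H1_path \<psi>" "V \<in> borel_measurable lborel" "integrable lborel V" "0 \<le> q" "0 \<le> t" "0 < e"
  shows "(LINT s:{0..t}|lborel. LINT z|lborel. schr_kernel (t - s) (x - z) * of_real ((1 / e) * V ((z - Y) / e))
             * of_real (cmod (\<psi> s z) powr q) * \<psi> s z) = duhamel Y q V e \<psi> t x"
proof -
  have "(LINT z|lborel. schr_kernel (t - s) (x - z) * of_real ((1 / e) * V ((z - Y) / e))
             * of_real (cmod (\<psi> s z) powr q) * \<psi> s z)
      = (LINT w|lborel. schr_kernel (t - s) (x - (Y + e * w)) * (of_real (V w) * power_nl q (\<psi> s (Y + e * w))))"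
    (is "(LINT z|lborel. ?F z) = ?r") for s
  proof -
    have "(LINT z|lborel. ?F z) = \<bar>e\<bar> *\<^sub>R (LINT w|lborel. ?F (Y + e * w))"
      by (rule lborel_integral_real_affine) (use \<open>0 < e\<close> in simp)
    also have "\<dots> = (LINT w|lborel. \<bar>e\<bar> *\<^sub>R ?F (Y + e * w))"
      by (rule integral_scaleR_right[symmetric])
    also have "\<dots> = ?r"
      using \<open>0 < e\<close>
      by (intro Bochner_Integration.integral_cong) (auto simp: power_nl_def scaleR_conv_of_real)
    finally show ?thesis .
  qed
  then show ?thesis by (simp only: duhamel_iterated[OF assms(1-5)])
qed

text \<open>At scale 0 neither the kernel nor the solution depends on w, so the w-integral leaves
  only the total mass of V.\<close>

lemma duhamel_L:
  assumes "H1_path \<psi>" "V \<in> borel_measurable lborel" "integrable lborel V" "0 \<le> q" "0 \<le> t"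
  shows "of_real (LINT w|lborel. V w) * (LINT s:{0..t}|lborel. schr_kernel (t - s) (x - Y)
             * of_real (cmod (\<psi> s Y) powr q) * \<psi> s Y) = duhamel Y q V 0 \<psi> t x"
proof -
  have "(LINT w|lborel. schr_kernel (t - s) (x - (Y + 0 * w)) * (of_real (V w) * power_nl q (\<psi> s (Y + 0 * w))))
      = of_real (LINT w|lborel. V w) * (schr_kernel (t - s) (x - Y) * of_real (cmod (\<psi> s Y) powr q) * \<psi> s Y)" for s
    by (simp add: power_nl_def mult_ac)
  then show ?thesis
    unfolding duhamel_iterated[OF assms]
    by (simp only: set_lebesgue_integral_def mult_scaleR_right[symmetric] integral_mult_right_zero)
qed

text \<open>\<open>free_evol\<close> is a relation, an L^2 limit of truncated kernel integrals. Two
  limits of the same truncations agree almost everywhere, which is all that cancelling the free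
  evolution requires.\<close>

lemma free_evol_unique:
  assumes "free_evol t f g" "free_evol t f h"
  shows "AE x in lborel. g x = h x"
proof (cases "t = 0")
  case True
  then show ?thesis using assms by (auto simp: free_evol_def elim: AE_mp)
next
  case False
  define k where "k R x = (LINT y:{-R..R}|lborel. schr_kernel t (x - y) * f y)" for R x
  have g: "square_integrable g" "square_integrable h"
    "\<And>R. square_integrable (\<lambda>x. g x - k R x)" "\<And>R. square_integrable (\<lambda>x. h x - k R x)"
    "((\<lambda>R. L2norm (\<lambda>x. g x - k R x)) \<longlongrightarrow> 0) at_top" "((\<lambda>R. L2norm (\<lambda>x. h x - k R x)) \<longlongrightarrow> 0) at_top"
    using assms False by (auto simp: free_evol_def k_def)
  define I where "I = (LINT x|lborel. (cmod (g x - h x))\<^sup>2)"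
  have int: "integrable lborel (\<lambda>x. (cmod (g x - h x))\<^sup>2)"
    using square_integrable_diff[OF g(1,2)] by (simp add: square_integrable_def)
  have "I \<le> 2 * (L2norm (\<lambda>x. g x - k R x))\<^sup>2 + 2 * (L2norm (\<lambda>x. h x - k R x))\<^sup>2" for R
  proof -
    have i: "integrable lborel (\<lambda>x. (cmod (g x - k R x))\<^sup>2)" "integrable lborel (\<lambda>x. (cmod (h x - k R x))\<^sup>2)"
      using g(3,4) by (auto simp: square_integrable_def)
    have "I \<le> (LINT x|lborel. 2 * (cmod (g x - k R x))\<^sup>2 + 2 * (cmod (h x - k R x))\<^sup>2)"
      unfolding I_def
    proof (rule integral_mono[OF int])
      fix x
      show "(cmod (g x - h x))\<^sup>2 \<le> 2 * (cmod (g x - k R x))\<^sup>2 + 2 * (cmod (h x - k R x))\<^sup>2"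
        using norm_diff_squared_le[of "g x - k R x" "h x - k R x"] by simp
    qed (use i in auto)
    then show ?thesis using i by (simp add: L2norm_squared)
  qed
  moreover have "((\<lambda>R. 2 * (L2norm (\<lambda>x. g x - k R x))\<^sup>2 + 2 * (L2norm (\<lambda>x. h x - k R x))\<^sup>2) \<longlongrightarrow> 2 * 0\<^sup>2 + 2 * 0\<^sup>2) at_top"
    by (intro tendsto_intros g)
  ultimately have "I \<le> 2 * 0\<^sup>2 + 2 * 0\<^sup>2"
    by (intro tendsto_lowerbound[where F = at_top]) auto
  moreover have "0 \<le> I" unfolding I_def by (intro Bochner_Integration.integral_nonneg) auto
  ultimately have "I = 0" by simp
  then have "AE x in lborel. (cmod (g x - h x))\<^sup>2 = 0"
    unfolding I_def using integral_nonneg_eq_0_iff_AE[OF int] by simp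
  then show ?thesis by eventually_elim auto
qed

text \<open>The set where two continuous functions differ is open, and a nonempty open set has
  positive measure.\<close>

lemma continuous_AE_eq_imp_eq:
  fixes f g :: "real \<Rightarrow> complex"
  assumes "continuous_on UNIV f" "continuous_on UNIV g" "AE x in lborel. f x = g x"
  shows "f x = g x"
proof (rule ccontr)
  assume neq: "f x \<noteq> g x"
  have "open {x. f x \<noteq> g x}" using assms(1,2) by (rule open_Collect_neq)
  then have "\<exists>d>0. ball x d \<subseteq> {x. f x \<noteq> g x}"
    using neq unfolding open_contains_ball by simp
  then obtain d where d: "0 < d" "ball x d \<subseteq> {x. f x \<noteq> g x}" by blast
  have "AE z in lborel. z \<notin> {x..x + d / 2}"
    using assms(3)
  proof eventually_elim
    case (elim z)
    show ?case
    proof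
      assume "z \<in> {x..x + d / 2}"
      then have "z \<in> ball x d" using d by (auto simp: dist_real_def)
      then show False using d elim by auto
    qed
  qed
  then have "{x..x + d / 2} \<in> null_sets lborel" by (subst (asm) AE_iff_null_sets[symmetric]) auto
  then show False using d by (auto simp: null_sets_def)
qed

section \<open>Stability with respect to the scale\<close>

locale concentrated_nls =
  fixes N :: nat and y \<mu> :: "nat \<Rightarrow> real" and V :: "nat \<Rightarrow> real \<Rightarrow> real" and \<psi>0 :: "real \<Rightarrow> complex"
  assumes mu_pos: "k \<in> {1..N} \<Longrightarrow> 0 < \<mu> k"
    and V_meas: "k \<in> {1..N} \<Longrightarrow> V k \<in> borel_measurable lborel"
    and V_moment: "k \<in> {1..N} \<Longrightarrow> integrable lborel (\<lambda>x. (1 + \<bar>x\<bar>) * V k x)"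
begin

abbreviation "nl k \<equiv> power_nl (2 * \<mu> k)"

abbreviation "amp k e u s w \<equiv> nl k (u s (y k + e * w))"

abbreviation "ker k e r x w \<equiv> schr_kernel r (x - (y k + e * w))"

abbreviation "duh k \<equiv> duhamel (y k) (2 * \<mu> k) (V k)"

definition lip :: "nat \<Rightarrow> real \<Rightarrow> real" where "lip k K = (2 * \<mu> k + 2) * K powr (2 * \<mu> k)"

definition sup_nl :: "nat \<Rightarrow> real \<Rightarrow> real" where "sup_nl k K = K powr (2 * \<mu> k) * K"

definition moment :: "nat \<Rightarrow> real" where "moment k = (LINT w|lborel. \<bar>V k w\<bar> * (1 + \<bar>w\<bar>))"

text \<open>One constant that converts the weight at y_k + e w into 1 + |w| for all centres and all
  scales in \<open>{0..1}\<close>.\<close>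

definition centre_bound :: real where "centre_bound = 1 + (\<Sum>k\<in>{1..N}. \<bar>y k\<bar>)"

definition mild :: "real \<Rightarrow> (real \<Rightarrow> real \<Rightarrow> complex) \<Rightarrow> bool" where
  "mild e \<psi> \<longleftrightarrow> H1_path \<psi> \<and> (\<forall>t\<ge>0. \<exists>g. free_evol t \<psi>0 g \<and>
     (AE x in lborel. \<psi> t x = g x - \<i> * (\<Sum>k\<in>{1..N}. duh k e \<psi> t x)))"

lemma centre_bound: "k \<in> {1..N} \<Longrightarrow> 1 + \<bar>y k\<bar> \<le> centre_bound" "1 \<le> centre_bound"
proof -
  show "1 \<le> centre_bound" by (simp add: centre_bound_def sum_nonneg)
  assume "k \<in> {1..N}"
  then have "\<bar>y k\<bar> \<le> (\<Sum>k\<in>{1..N}. \<bar>y k\<bar>)" by (intro member_le_sum) auto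
  then show "1 + \<bar>y k\<bar> \<le> centre_bound" by (simp add: centre_bound_def)
qed

lemma V_integrable:
  assumes "k \<in> {1..N}"
  shows "integrable lborel (\<lambda>w. \<bar>V k w\<bar> * (1 + \<bar>w\<bar>))" "integrable lborel (V k)"
proof -
  have "\<bar>(1 + \<bar>w\<bar>) * V k w\<bar> = \<bar>V k w\<bar> * (1 + \<bar>w\<bar>)" for w by (simp add: abs_mult mult.commute)
  then show 1: "integrable lborel (\<lambda>w. \<bar>V k w\<bar> * (1 + \<bar>w\<bar>))"
    using integrable_abs[OF V_moment[OF assms]] by simp
  show "integrable lborel (V k)"
    by (rule Bochner_Integration.integrable_bound[OF 1 V_meas[OF assms]]) (auto simp: distrib_left)
qed

lemma moment_nonneg: "0 \<le> moment k"
  unfolding moment_def by (intro Bochner_Integration.integral_nonneg) auto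

lemma lip_nonneg: "k \<in> {1..N} \<Longrightarrow> 0 \<le> lip k K"
  using mu_pos[of k] by (simp add: lip_def)

lemma sup_nl_nonneg: "0 \<le> K \<Longrightarrow> 0 \<le> sup_nl k K"
  by (simp add: sup_nl_def)

text \<open>Both sides are continuous in x, so the identity holds for every x although the equations
  hold only almost everywhere.\<close>

lemma mild_difference:
  assumes u: "mild e u" and v: "mild e' v" and t: "0 \<le> t"
  shows "u t x - v t x = - \<i> * (\<Sum>k\<in>{1..N}. duh k e u t x - duh k e' v t x)"
proof -
  have cd: "continuous_on UNIV (duh k e \<psi> t)" if "k \<in> {1..N}" "H1_path \<psi>" for k e \<psi>
    using that mu_pos[of k] V_integrable(2)[of k] V_meas[of k] t by (intro duhamel_continuous) auto
  have H: "H1_path u" "H1_path v" using u v by (auto simp: mild_def)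
  then have cont: "continuous_on UNIV (u t)" "continuous_on UNIV (v t)"
    using t by (auto simp: H1_path_def)
  obtain g h where g: "free_evol t \<psi>0 g"
      "AE x in lborel. u t x = g x - \<i> * (\<Sum>k\<in>{1..N}. duh k e u t x)"
    and h: "free_evol t \<psi>0 h"
      "AE x in lborel. v t x = h x - \<i> * (\<Sum>k\<in>{1..N}. duh k e' v t x)"
    using u v t unfolding mild_def by blast
  show ?thesis
  proof (rule continuous_AE_eq_imp_eq[where f = "\<lambda>x. u t x - v t x"])
    show "AE x in lborel. u t x - v t x = - \<i> * (\<Sum>k\<in>{1..N}. duh k e u t x - duh k e' v t x)"
      using g(2) h(2) free_evol_unique[OF g(1) h(1)]
      by eventually_elim (simp add: sum_subtractf right_diff_distrib)
  qed (intro continuous_intros cont cd H; assumption)+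
qed

text \<open>Three slots for singularities in time: the weighted estimate uses the exponents 3/4, 1/2
  and 1/2 + \<open>\<theta>\<close>, the supremum estimate only 1/2. The factor 1 + |w| integrates
  against |V_k| to \<open>moment k\<close>.\<close>

lemma duhamel_diff_bound:
  assumes k: "k \<in> {1..N}" and H: "H1_path u" "H1_path v" and t: "0 \<le> t" "t \<le> T" "0 < T"
    and \<gamma>: "\<gamma>1 < 1" "\<gamma>2 < 1" "\<gamma>3 < 1"
    and bound: "\<And>s w. s \<in> {0..t} \<Longrightarrow>
      cmod (ker k e (t - s) x w * amp k e u s w
        - ker k e' (t - s) x w * amp k e' v s w)
      \<le> (c1 * sing_kernel T \<gamma>1 (t - s) + c2 * sing_kernel T \<gamma>2 (t - s) + c3 * sing_kernel T \<gamma>3 (t - s)) * (1 + \<bar>w\<bar>)"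
    and c: "0 \<le> c1" "0 \<le> c2" "0 \<le> c3"
  shows "cmod (duh k e u t x - duh k e' v t x)
    \<le> (c1 * sing_mass T \<gamma>1 + c2 * sing_mass T \<gamma>2 + c3 * sing_mass T \<gamma>3) * moment k"
proof -
  let ?W = "\<lambda>w. \<bar>V k w\<bar> * (1 + \<bar>w\<bar>)"
  let ?g = "\<lambda>p. c1 * (sing_kernel T \<gamma>1 (t - fst p) * ?W (snd p)) + c2 * (sing_kernel T \<gamma>2 (t - fst p) * ?W (snd p))
        + c3 * (sing_kernel T \<gamma>3 (t - fst p) * ?W (snd p))"
  have q: "0 \<le> 2 * \<mu> k" using mu_pos[OF k] by simp
  note ts = tensor_sing_kernel[OF less_imp_le[OF t(3)] _ V_integrable(1)[OF k]]
  have int: "integrable (lborel \<Otimes>\<^sub>M lborel) (\<lambda>p. schr_kernel (t - fst p) (x - (y k + e * snd p)) * duh_amp (y k) (2 * \<mu> k) (V k) e u t p)"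
    if "H1_path u" for e u
    using duhamel_integrable[OF that V_meas[OF k] V_integrable(2)[OF k] q t(1), of "\<lambda>w. y k + e * w"] by simp
  have "duh k e u t x - duh k e' v t x =
     (LINT p|(lborel \<Otimes>\<^sub>M lborel). schr_kernel (t - fst p) (x - (y k + e * snd p)) * duh_amp (y k) (2 * \<mu> k) (V k) e u t p
       - schr_kernel (t - fst p) (x - (y k + e' * snd p)) * duh_amp (y k) (2 * \<mu> k) (V k) e' v t p)"
    unfolding duhamel_def using int H by simp
  then have "cmod (duh k e u t x - duh k e' v t x)
      \<le> (LINT p|(lborel \<Otimes>\<^sub>M lborel). ?g p)"
  proof (simp only:, intro norm_integral_le)
    show "integrable (lborel \<Otimes>\<^sub>M lborel) ?g"
      by (intro Bochner_Integration.integrable_add integrable_mult_right ts \<gamma>)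
    fix p :: "real \<times> real"
    obtain s w where p: "p = (s, w)" by (cases p)
    show "cmod (schr_kernel (t - fst p) (x - (y k + e * snd p)) * duh_amp (y k) (2 * \<mu> k) (V k) e u t p
       - schr_kernel (t - fst p) (x - (y k + e' * snd p)) * duh_amp (y k) (2 * \<mu> k) (V k) e' v t p) \<le> ?g p"
    proof (cases "s \<in> {0..t}")
      case True
      have "schr_kernel (t - fst p) (x - (y k + e * snd p)) * duh_amp (y k) (2 * \<mu> k) (V k) e u t p
       - schr_kernel (t - fst p) (x - (y k + e' * snd p)) * duh_amp (y k) (2 * \<mu> k) (V k) e' v t p =
         of_real (V k w) * (ker k e (t - s) x w * amp k e u s w
        - ker k e' (t - s) x w * amp k e' v s w)"
        using True by (simp add: p duh_amp_def algebra_simps)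
      then have "cmod (schr_kernel (t - fst p) (x - (y k + e * snd p)) * duh_amp (y k) (2 * \<mu> k) (V k) e u t p
       - schr_kernel (t - fst p) (x - (y k + e' * snd p)) * duh_amp (y k) (2 * \<mu> k) (V k) e' v t p) \<le>
        \<bar>V k w\<bar> * ((c1 * sing_kernel T \<gamma>1 (t - s) + c2 * sing_kernel T \<gamma>2 (t - s) + c3 * sing_kernel T \<gamma>3 (t - s)) * (1 + \<bar>w\<bar>))"
        by (simp only: norm_mult norm_of_real) (intro mult_left_mono bound True, simp)
      also have "\<dots> = ?g p" by (simp add: p algebra_simps)
      finally show ?thesis .
    next
      case False
      then have "duh_amp (y k) (2 * \<mu> k) (V k) e u t p = 0" "duh_amp (y k) (2 * \<mu> k) (V k) e' v t p = 0"
        by (auto simp: duh_amp_def p)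
      then show ?thesis using c by (simp add: sing_kernel_nonneg)
    qed
  qed
  also have "\<dots> = (c1 * sing_mass T \<gamma>1 + c2 * sing_mass T \<gamma>2 + c3 * sing_mass T \<gamma>3) * moment k"
  proof -
    have "(LINT p|(lborel \<Otimes>\<^sub>M lborel). ?g p) = c1 * (sing_mass T \<gamma>1 * moment k) + c2 * (sing_mass T \<gamma>2 * moment k) + c3 * (sing_mass T \<gamma>3 * moment k)"
      by (simp only: Bochner_Integration.integral_add Bochner_Integration.integrable_add integrable_mult_right
          ts \<gamma> integral_mult_right_zero moment_def)
    then show ?thesis by (simp add: algebra_simps)
  qed
  finally show ?thesis .
qed

lemma abs_shift_le:
  assumes "k \<in> {1..N}" "0 \<le> e" "e \<le> 1"
  shows "1 + \<bar>y k + e * w\<bar> \<le> centre_bound * (1 + \<bar>w\<bar>)"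
proof -
  have "\<bar>e * w\<bar> \<le> 1 * \<bar>w\<bar>" unfolding abs_mult using assms by (intro mult_right_mono) auto
  then have "1 + \<bar>y k + e * w\<bar> \<le> (1 + \<bar>y k\<bar>) + \<bar>w\<bar>" by linarith
  also have "\<dots> \<le> centre_bound + centre_bound * \<bar>w\<bar>"
    using centre_bound(1)[OF assms(1)] mult_right_mono[OF centre_bound(2), of "\<bar>w\<bar>"] by simp
  finally show ?thesis by (simp add: algebra_simps)
qed

text \<open>The comparison passes through v at the point of u: first a change of solution, measured
  in the weighted norm, then a change of position, measured by the Hoelder bound of v alone.\<close>

lemma nl_difference:
  assumes k: "k \<in> {1..N}" and e: "0 \<le> e" "e \<le> 1" "0 \<le> e'" "e' \<le> 1" and \<theta>: "0 < \<theta>" "\<theta> < 1/2"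
    and u: "\<And>z. cmod (u z) \<le> K" and v: "\<And>z. cmod (v z) \<le> K"
    and H: "\<And>z z'. cmod (v z - v z') \<le> H * sqrt \<bar>z - z'\<bar>" "0 \<le> H"
    and G: "\<And>z. cmod (u z - v z) \<le> G * (1 + \<bar>z\<bar>)" "0 \<le> G"
  shows "cmod (nl k (u (y k + e * w)) - nl k (v (y k + e' * w)))
    \<le> lip k K * (G * centre_bound + H * \<bar>e - e'\<bar> powr \<theta>) * (1 + \<bar>w\<bar>)"
proof -
  have "cmod (u (y k + e * w) - v (y k + e' * w)) \<le>
      cmod (u (y k + e * w) - v (y k + e * w)) + cmod (v (y k + e * w) - v (y k + e' * w))"
    using norm_triangle_ineq[of "u (y k + e * w) - v (y k + e * w)" "v (y k + e * w) - v (y k + e' * w)"] by simp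
  also have "\<dots> \<le> G * (centre_bound * (1 + \<bar>w\<bar>)) + H * (\<bar>e - e'\<bar> powr \<theta> * (1 + \<bar>w\<bar>))"
  proof (rule add_mono)
    show "cmod (u (y k + e * w) - v (y k + e * w)) \<le> G * (centre_bound * (1 + \<bar>w\<bar>))"
      by (rule order_trans[OF G(1)]) (intro mult_left_mono abs_shift_le k e G)
    have "sqrt \<bar>(y k + e * w) - (y k + e' * w)\<bar> = sqrt \<bar>e - e'\<bar> * sqrt \<bar>w\<bar>"
    proof -
      have "(y k + e * w) - (y k + e' * w) = (e - e') * w" by (simp add: algebra_simps)
      then show ?thesis by (simp only: abs_mult real_sqrt_mult)
    qed
    also have "\<dots> \<le> \<bar>e - e'\<bar> powr \<theta> * (1 + \<bar>w\<bar>)"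
    proof (rule mult_mono)
      show "sqrt \<bar>e - e'\<bar> \<le> \<bar>e - e'\<bar> powr \<theta>"
      proof -
        \<comment> \<open>The exponent is lowered from 1/2 to \<open>\<theta>\<close>, as |e - e'|
          is at most 1.\<close>
        have "\<bar>e - e'\<bar> powr (1/2) \<le> \<bar>e - e'\<bar> powr \<theta>"
          using e \<theta> by (intro powr_mono') auto
        then show ?thesis by (simp add: powr_half_sqrt)
      qed
      show "sqrt \<bar>w\<bar> \<le> 1 + \<bar>w\<bar>"
      proof (rule real_le_lsqrt)
        have "\<bar>w\<bar> \<le> 1 + 2 * \<bar>w\<bar> + \<bar>w\<bar> * \<bar>w\<bar>" by simp
        then show "\<bar>w\<bar> \<le> (1 + \<bar>w\<bar>)\<^sup>2" by (simp add: power2_eq_square algebra_simps)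
      qed auto
    qed auto
    finally have "H * sqrt \<bar>(y k + e * w) - (y k + e' * w)\<bar> \<le> H * (\<bar>e - e'\<bar> powr \<theta> * (1 + \<bar>w\<bar>))"
      using H(2) by (intro mult_left_mono)
    then show "cmod (v (y k + e * w) - v (y k + e' * w)) \<le> H * (\<bar>e - e'\<bar> powr \<theta> * (1 + \<bar>w\<bar>))"
      by (rule order_trans[OF H(1)])
  qed
  finally have d: "cmod (u (y k + e * w) - v (y k + e' * w)) \<le> (G * centre_bound + H * \<bar>e - e'\<bar> powr \<theta>) * (1 + \<bar>w\<bar>)"
    by (simp add: algebra_simps)
  have "cmod (nl k (u (y k + e * w)) - nl k (v (y k + e' * w))) \<le> lip k K * cmod (u (y k + e * w) - v (y k + e' * w))"
    unfolding lip_def using mu_pos[OF k] by (intro power_nl_lipschitz u v) auto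
  also have "\<dots> \<le> lip k K * ((G * centre_bound + H * \<bar>e - e'\<bar> powr \<theta>) * (1 + \<bar>w\<bar>))"
    by (intro mult_left_mono d lip_nonneg k)
  finally show ?thesis by (simp add: mult.assoc)
qed

lemma kernel_difference:
  assumes k: "k \<in> {1..N}" and e: "0 \<le> e" "e \<le> 1" "0 \<le> e'" "e' \<le> 1" and \<theta>: "0 < \<theta>" "\<theta> < 1/2"
  shows "cmod (ker k e r x w - ker k e' r x w)
    \<le> 4 * centre_bound * (1 + \<bar>x\<bar>) * \<bar>e - e'\<bar> powr \<theta> * (1 + \<bar>w\<bar>) * \<bar>r\<bar> powr - (1/2 + \<theta>)"
proof -
  define a b where "a = x - (y k + e * w)" and "b = x - (y k + e' * w)"
  \<comment> \<open>All weights are collected in X so that |a^2 - b^2| is at most 2 |e - e'| X^2.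
    The power \<open>\<theta>\<close> turns X^2 into at most X, since 2 \<open>\<theta>\<close> is
    below 1, and keeps the growth in x and in w linear.\<close>
  define X where "X = (1 + \<bar>w\<bar>) * (1 + \<bar>x\<bar>) * centre_bound"
  have X: "1 \<le> X"
    unfolding X_def using mult_mono[of 1 "(1 + \<bar>w\<bar>) * (1 + \<bar>x\<bar>)" 1 centre_bound]
      mult_mono[of 1 "1 + \<bar>w\<bar>" 1 "1 + \<bar>x\<bar>"] centre_bound(2) by simp
  have "\<bar>a\<^sup>2 - b\<^sup>2\<bar> = \<bar>a - b\<bar> * \<bar>a + b\<bar>"
    by (simp add: power2_eq_square square_diff_square_factored abs_mult mult.commute)
  also have "\<bar>a - b\<bar> = \<bar>e - e'\<bar> * \<bar>w\<bar>"
  proof -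
    have "a - b = (e' - e) * w" by (simp add: a_def b_def algebra_simps)
    then show ?thesis by (simp add: abs_mult abs_minus_commute)
  qed
  also have "\<bar>e - e'\<bar> * \<bar>w\<bar> * \<bar>a + b\<bar> \<le> \<bar>e - e'\<bar> * \<bar>w\<bar> * (2 * ((1 + \<bar>x\<bar>) * (1 + \<bar>w\<bar>) * centre_bound))"
  proof (rule mult_left_mono)
    have ew: "\<bar>e * w\<bar> \<le> \<bar>w\<bar>" "\<bar>e' * w\<bar> \<le> \<bar>w\<bar>"
      unfolding abs_mult using e by (auto intro: mult_left_le_one_le)
    have "\<bar>a + b\<bar> \<le> 2 * (\<bar>x\<bar> + (\<bar>y k\<bar> + \<bar>w\<bar>))"
    proof -
      have "\<bar>x - (c + p)\<bar> \<le> \<bar>x\<bar> + (\<bar>c\<bar> + d)" if "\<bar>p\<bar> \<le> d" for c d p :: real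
        using that by linarith
      then have "\<bar>a\<bar> \<le> \<bar>x\<bar> + (\<bar>y k\<bar> + \<bar>w\<bar>)" "\<bar>b\<bar> \<le> \<bar>x\<bar> + (\<bar>y k\<bar> + \<bar>w\<bar>)"
        using ew unfolding a_def b_def by blast+
      then show ?thesis unfolding mult_2 by (rule order_trans[OF abs_triangle_ineq add_mono])
    qed
    also have "\<dots> \<le> 2 * (\<bar>x\<bar> * ((1 + \<bar>w\<bar>) * centre_bound) + 1 * ((1 + \<bar>w\<bar>) * centre_bound))"
    proof (intro mult_left_mono add_mono)
      have 1: "1 * 1 \<le> (1 + \<bar>w\<bar>) * centre_bound" using centre_bound(2) by (intro mult_mono) auto
      show "\<bar>x\<bar> \<le> \<bar>x\<bar> * ((1 + \<bar>w\<bar>) * centre_bound)" using 1 mult_left_mono[of 1 _ "\<bar>x\<bar>"] by simp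
      show "\<bar>y k\<bar> + \<bar>w\<bar> \<le> 1 * ((1 + \<bar>w\<bar>) * centre_bound)"
        using centre_bound(1)[OF k] mult_right_mono[OF centre_bound(2), of "\<bar>w\<bar>"] by (simp add: algebra_simps)
    qed auto
    finally show "\<bar>a + b\<bar> \<le> 2 * ((1 + \<bar>x\<bar>) * (1 + \<bar>w\<bar>) * centre_bound)" by (simp add: algebra_simps)
  qed auto
  also have "\<dots> \<le> \<bar>e - e'\<bar> * (2 * X\<^sup>2)"
  proof -
    have "\<bar>w\<bar> * ((1 + \<bar>x\<bar>) * (1 + \<bar>w\<bar>) * centre_bound) \<le> X * X"
    proof (rule mult_mono)
      have "\<bar>w\<bar> * 1 \<le> (1 + \<bar>w\<bar>) * ((1 + \<bar>x\<bar>) * centre_bound)"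
        using mult_mono[of 1 "1 + \<bar>x\<bar>" 1 centre_bound] centre_bound(2) by (intro mult_mono) auto
      then show "\<bar>w\<bar> \<le> X" by (simp add: X_def mult_ac)
    qed (use X centre_bound(2) in \<open>auto simp: X_def mult_ac\<close>)
    then have "\<bar>e - e'\<bar> * (2 * (\<bar>w\<bar> * ((1 + \<bar>x\<bar>) * (1 + \<bar>w\<bar>) * centre_bound))) \<le> \<bar>e - e'\<bar> * (2 * (X * X))"
      by (intro mult_left_mono) auto
    then show ?thesis by (simp add: power2_eq_square mult_ac)
  qed
  finally have "\<bar>a\<^sup>2 - b\<^sup>2\<bar> powr \<theta> \<le> (\<bar>e - e'\<bar> * (2 * X\<^sup>2)) powr \<theta>"
    using \<theta> by (intro powr_mono2) auto
  also have "\<dots> = \<bar>e - e'\<bar> powr \<theta> * (2 powr \<theta> * X powr (2 * \<theta>))"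
    using X by (simp add: powr_mult powr_powr flip: powr_numeral)
  also have "\<dots> \<le> \<bar>e - e'\<bar> powr \<theta> * (2 powr 1 * X powr 1)"
    using X \<theta> by (intro mult_left_mono mult_mono powr_mono) auto
  finally have p: "\<bar>a\<^sup>2 - b\<^sup>2\<bar> powr \<theta> \<le> \<bar>e - e'\<bar> powr \<theta> * (2 * X)" using X by simp
  have "cmod (schr_kernel r a - schr_kernel r b) \<le> 2 * \<bar>a\<^sup>2 - b\<^sup>2\<bar> powr \<theta> * \<bar>r\<bar> powr - (1/2 + \<theta>)"
    using \<theta> by (intro norm_schr_kernel_diff_le) auto
  also have "\<dots> \<le> 2 * (\<bar>e - e'\<bar> powr \<theta> * (2 * X)) * \<bar>r\<bar> powr - (1/2 + \<theta>)"
    by (intro mult_right_mono mult_left_mono p) auto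
  also have "\<dots> = 4 * centre_bound * (1 + \<bar>x\<bar>) * \<bar>e - e'\<bar> powr \<theta> * (1 + \<bar>w\<bar>) * \<bar>r\<bar> powr - (1/2 + \<theta>)"
    by (simp add: X_def)
  finally show ?thesis by (simp only: a_def b_def)
qed

end

text \<open>With r = t - s this says r^(-1/2) exp(-l r) is at most l^(-1/4) r^(-3/4): a quarter
  power of the time singularity is traded for a factor that is small for large l, and the result is
  still integrable.\<close>

lemma sing_kernel_exp_le:
  assumes s: "s \<in> {0..t}" "t \<le> T" and l: "0 < l"
  shows "sing_kernel T (1/2) (t - s) * exp (l * s) \<le> exp (l * t) * l powr - (1/4) * sing_kernel T (3/4) (t - s)"
proof (cases "s = t")
  case False
  define r where "r = t - s"
  have r: "0 < r" using s False by (simp add: r_def)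
  have "(l * r) powr (1/4) \<le> exp (l * r)"
  proof -
    have "(l * r) powr (1/4) \<le> 1 + l * r"
    proof (cases "l * r \<le> 1")
      case True
      then have "(l * r) powr (1/4) \<le> 1 powr (1/4)" using l r by (intro powr_mono2) auto
      then show ?thesis using l r by simp (smt (verit) mult_pos_pos)
    next
      case False
      then have "(l * r) powr (1/4) \<le> (l * r) powr 1" by (intro powr_mono) auto
      then show ?thesis using l r by simp
    qed
    then show ?thesis using exp_ge_add_one_self[of "l * r"] by linarith
  qed
  then have "exp (- (l * r)) \<le> (l * r) powr - (1/4)"
    using l r by (simp add: exp_minus powr_minus le_imp_inverse_le)
  then have "r powr - (1/2) * (exp (l * t) * exp (- (l * r))) \<le> r powr - (1/2) * (exp (l * t) * (l * r) powr - (1/4))"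
    by (intro mult_left_mono) auto
  moreover have "exp (l * t) * exp (- (l * r)) = exp (l * s)"
    by (simp add: r_def algebra_simps flip: exp_add)
  moreover have "r powr - (1/2) * (exp (l * t) * (l * r) powr - (1/4)) = exp (l * t) * l powr - (1/4) * r powr - (3/4)"
  proof -
    have "r powr - (3/4) = r powr - (1/2) * r powr - (1/4)" by (simp flip: powr_add)
    then show ?thesis using l r by (simp add: powr_mult)
  qed
  moreover have "sing_kernel T \<gamma> (t - s) = r powr - \<gamma>" for \<gamma>
    using sing_kernel_eq[OF s, of \<gamma>] r by (simp add: r_def)
  ultimately show ?thesis by (simp only:)
qed (simp add: sing_kernel_def)

lemma norm_mult_diff_le: "cmod (p * a - q * b) \<le> cmod p * cmod (a - b) + cmod (p - q) * cmod b"
proof -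
  have "p * a - q * b = p * (a - b) + (p - q) * b" by (simp add: algebra_simps)
  then show ?thesis using norm_triangle_ineq[of "p * (a - b)" "(p - q) * b"] by (simp add: norm_mult)
qed

section \<open>Stability in the weighted norm\<close>

context concentrated_nls
begin

lemma mild_difference_le:
  assumes "mild e u" "mild e' v" "0 \<le> t"
    and "\<And>k. k \<in> {1..N} \<Longrightarrow> cmod (duh k e u t x - duh k e' v t x) \<le> B k"
  shows "cmod (u t x - v t x) \<le> (\<Sum>k\<in>{1..N}. B k)"
proof -
  have "cmod (u t x - v t x) =
      cmod (\<Sum>k\<in>{1..N}. duh k e u t x - duh k e' v t x)"
    unfolding mild_difference[OF assms(1-3)] by (simp add: norm_mult)
  also have "\<dots> \<le> (\<Sum>k\<in>{1..N}. B k)" by (intro sum_norm_le assms(4))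
  finally show ?thesis .
qed

text \<open>The Hoelder condition concerns v only. For u just a supremum bound is asked, which is
  what a continuity argument can supply.\<close>

definition controlled :: "real \<Rightarrow> real \<Rightarrow> real \<Rightarrow> (real \<Rightarrow> real \<Rightarrow> complex) \<Rightarrow> (real \<Rightarrow> real \<Rightarrow> complex) \<Rightarrow> bool" where
  "controlled K H t0 u v \<longleftrightarrow> (\<forall>s\<in>{0..t0}. \<forall>z z'. cmod (u s z) \<le> K \<and> cmod (v s z) \<le> K \<and>
     cmod (v s z - v s z') \<le> H * sqrt \<bar>z - z'\<bar>)"

text \<open>
  The constant does not depend on the parameters or on the solutions. Instead of a singular Gronwall
  inequality the proof uses the norm with the additional weight exp (- l s), for l large.
\<close>

lemma weighted_stability:
  assumes T: "0 < T" and K: "0 < K" and H: "0 \<le> H" and \<theta>: "0 < \<theta>" "\<theta> < 1/2"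
  obtains C where "0 \<le> C"
    "\<And>e e' u v t0 t x. 0 \<le> e \<Longrightarrow> e \<le> 1 \<Longrightarrow> 0 \<le> e' \<Longrightarrow> e' \<le> 1 \<Longrightarrow> mild e u \<Longrightarrow> mild e' v \<Longrightarrow> t0 \<le> T \<Longrightarrow>
      controlled K H t0 u v \<Longrightarrow> t \<in> {0..t0} \<Longrightarrow>
      cmod (u t x - v t x) \<le> C * \<bar>e - e'\<bar> powr \<theta> * (1 + \<bar>x\<bar>)"
proof -
  define a0 where "a0 = (\<Sum>k\<in>{1..N}. lip k K * centre_bound * sing_mass T (3/4) * moment k)"
  define b0 where "b0 = (\<Sum>k\<in>{1..N}. (lip k K * H * sing_mass T (1/2) + 4 * centre_bound * sup_nl k K * sing_mass T (1/2 + \<theta>)) * moment k)"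
  \<comment> \<open>Chosen so that a0 l^(-1/4) = a0 / (2 a0 + 1) is at most 1/2; l depends neither
    on the scales nor on the solutions.\<close>
  define l where "l = (2 * a0 + 1) powr 4"
  have cb: "0 \<le> centre_bound" using centre_bound(2) by simp
  have a0: "0 \<le> a0" unfolding a0_def
    by (intro sum_nonneg mult_nonneg_nonneg lip_nonneg sing_mass_nonneg moment_nonneg cb)
  have b0: "0 \<le> b0" unfolding b0_def using H K
    by (intro sum_nonneg mult_nonneg_nonneg add_nonneg_nonneg lip_nonneg sing_mass_nonneg moment_nonneg sup_nl_nonneg cb) auto
  have l: "0 < l" "l powr - (1/4) = 1 / (2 * a0 + 1)"
    using a0 by (auto simp: l_def powr_powr powr_minus_divide simp del: powr_numeral)
  show ?thesis
  proof (rule that)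
    show "0 \<le> 2 * b0 * exp (l * T)" using b0 by simp
    fix e e' :: real and u v and t0 t x :: real
    assume e: "0 \<le> e" "e \<le> 1" "0 \<le> e'" "e' \<le> 1" and m: "mild e u" "mild e' v" and t0: "t0 \<le> T"
      and con: "controlled K H t0 u v" and tt: "t \<in> {0..t0}"
    have uK: "cmod (u s z) \<le> K" and vK: "cmod (v s z) \<le> K"
      and vH: "cmod (v s z - v s z') \<le> H * sqrt \<bar>z - z'\<bar>" if "s \<in> {0..t0}" for s z z'
      using con that unfolding controlled_def by blast+
    define \<kappa> where "\<kappa> = \<bar>e - e'\<bar> powr \<theta>"
    have \<kappa>: "0 \<le> \<kappa>" by (simp add: \<kappa>_def)
    define Q where "Q p = cmod (u (fst p) (snd p) - v (fst p) (snd p)) * exp (- (l * fst p)) / (1 + \<bar>snd p\<bar>)" for p :: "real \<times> real"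
    \<comment> \<open>The weighted distance of the two solutions. It is finite because both are
      bounded by K, which is what permits its absorption at the end.\<close>
    define E where "E = Sup (Q ` ({0..t0} \<times> UNIV))"
    have Q_le: "Q p \<le> 2 * K" if "p \<in> {0..t0} \<times> UNIV" for p
    proof -
      have p: "fst p \<in> {0..t0}" using that by auto
      have "cmod (u (fst p) (snd p) - v (fst p) (snd p)) \<le> 2 * K"
        using norm_triangle_ineq4[of "u (fst p) (snd p)" "v (fst p) (snd p)"] uK[OF p, of "snd p"] vK[OF p, of "snd p"] by linarith
      then have "cmod (u (fst p) (snd p) - v (fst p) (snd p)) * exp (- (l * fst p)) \<le> (2 * K) * 1"
        using p l K by (intro mult_mono) auto
      also have "\<dots> \<le> (2 * K) * (1 + \<bar>snd p\<bar>)" using K by (intro mult_left_mono) auto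
      finally show ?thesis unfolding Q_def by (simp add: pos_divide_le_eq)
    qed
    then have bdd: "bdd_above (Q ` ({0..t0} \<times> UNIV))" by (intro bdd_aboveI2)
    have QE: "Q p \<le> E" if "p \<in> {0..t0} \<times> UNIV" for p
      unfolding E_def using that bdd by (intro cSup_upper) auto
    have E0: "0 \<le> E"
    proof -
      have "0 \<le> Q (t, x)" by (simp add: Q_def)
      also have "Q (t, x) \<le> E" using tt by (intro QE) auto
      finally show ?thesis .
    qed
    have DE: "cmod (u s z - v s z) \<le> (E * exp (l * s)) * (1 + \<bar>z\<bar>)" if "s \<in> {0..t0}" for s z
    proof -
      have "cmod (u s z - v s z) * exp (- (l * s)) \<le> E * (1 + \<bar>z\<bar>)"
        using QE[of "(s, z)"] that by (simp add: Q_def pos_divide_le_eq)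
      then have "cmod (u s z - v s z) * exp (- (l * s)) * exp (l * s) \<le> E * (1 + \<bar>z\<bar>) * exp (l * s)"
        by (intro mult_right_mono) auto
      moreover have "exp (- (l * s)) * exp (l * s) = 1" by (simp add: exp_minus)
      ultimately show ?thesis by (simp only: mult.assoc mult_1_right) (simp add: mult_ac)
    qed
    have step: "cmod (u t x - v t x) \<le> (1 + \<bar>x\<bar>) * (a0 * (E * exp (l * t) * l powr - (1/4)) + b0 * \<kappa>)"
      if t: "t \<in> {0..t0}" for t x
    proof -
      define c1 where "c1 k = lip k K * centre_bound * (E * exp (l * t) * l powr - (1/4))" for k
      define c2 where "c2 k = lip k K * H * \<kappa>" for k
      define c3 where "c3 k = 4 * centre_bound * (1 + \<bar>x\<bar>) * \<kappa> * sup_nl k K" for k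
      have c: "0 \<le> c1 k" "0 \<le> c2 k" "0 \<le> c3 k" if "k \<in> {1..N}" for k
        unfolding c1_def c2_def c3_def using that H K
        by (auto intro!: mult_nonneg_nonneg lip_nonneg E0 \<kappa> cb sup_nl_nonneg)
      have "cmod (u t x - v t x) \<le> (\<Sum>k\<in>{1..N}. (c1 k * sing_mass T (3/4) + c2 k * sing_mass T (1/2) + c3 k * sing_mass T (1/2 + \<theta>)) * moment k)"
      proof (rule mild_difference_le[OF m])
        show "0 \<le> t" using t by simp
        fix k assume k: "k \<in> {1..N}"
        show "cmod (duh k e u t x - duh k e' v t x)
          \<le> (c1 k * sing_mass T (3/4) + c2 k * sing_mass T (1/2) + c3 k * sing_mass T (1/2 + \<theta>)) * moment k"
        proof (rule duhamel_diff_bound[OF k])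
          fix s w assume s: "s \<in> {0..t}"
          then have s0: "s \<in> {0..t0}" using t by auto
          have tT: "t \<le> T" using t t0 by simp
          let ?S = "\<lambda>\<gamma>. sing_kernel T \<gamma> (t - s)"
          have "cmod (ker k e (t - s) x w * amp k e u s w
              - ker k e' (t - s) x w * amp k e' v s w) \<le>
            cmod (ker k e (t - s) x w) * cmod (amp k e u s w - amp k e' v s w)
            + cmod (ker k e (t - s) x w - ker k e' (t - s) x w) * cmod (amp k e' v s w)"
            by (rule norm_mult_diff_le)
          also have "\<dots> \<le> ?S (1/2) * (lip k K * ((E * exp (l * s)) * centre_bound + H * \<kappa>) * (1 + \<bar>w\<bar>))
             + (4 * centre_bound * (1 + \<bar>x\<bar>) * \<kappa> * (1 + \<bar>w\<bar>) * ?S (1/2 + \<theta>)) * sup_nl k K"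
          proof (intro add_mono mult_mono)
            show "cmod (ker k e (t - s) x w) \<le> ?S (1/2)"
              unfolding sing_kernel_eq[OF s tT] by (rule norm_schr_kernel_le)
            show "cmod (amp k e u s w - amp k e' v s w)
               \<le> lip k K * ((E * exp (l * s)) * centre_bound + H * \<kappa>) * (1 + \<bar>w\<bar>)"
              unfolding \<kappa>_def using E0
              by (intro nl_difference[OF k e \<theta>] uK[OF s0] vK[OF s0] vH[OF s0] H DE[OF s0]) auto
            show "cmod (ker k e (t - s) x w - ker k e' (t - s) x w)
               \<le> 4 * centre_bound * (1 + \<bar>x\<bar>) * \<kappa> * (1 + \<bar>w\<bar>) * ?S (1/2 + \<theta>)"
              unfolding sing_kernel_eq[OF s tT] \<kappa>_def by (rule kernel_difference[OF k e \<theta>])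
            show "cmod (amp k e' v s w) \<le> sup_nl k K"
              unfolding sup_nl_def using mu_pos[OF k] by (intro norm_power_nl_le vK[OF s0]) auto
            show "0 \<le> 4 * centre_bound * (1 + \<bar>x\<bar>) * \<kappa> * (1 + \<bar>w\<bar>) * ?S (1/2 + \<theta>)"
              using cb \<kappa> by (simp add: sing_kernel_nonneg)
          qed (auto simp: sing_kernel_nonneg)
          also have "\<dots> = (lip k K * centre_bound * E * (?S (1/2) * exp (l * s)) + c2 k * ?S (1/2) + c3 k * ?S (1/2 + \<theta>)) * (1 + \<bar>w\<bar>)"
            by (simp add: c2_def c3_def algebra_simps)
          also have "\<dots> \<le> (lip k K * centre_bound * E * (exp (l * t) * l powr - (1/4) * ?S (3/4)) + c2 k * ?S (1/2) + c3 k * ?S (1/2 + \<theta>)) * (1 + \<bar>w\<bar>)"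
            by (intro mult_right_mono add_mono mult_left_mono sing_kernel_exp_le[OF s tT l(1)] mult_nonneg_nonneg
                lip_nonneg k cb E0 order_refl) auto
          also have "\<dots> = (c1 k * ?S (3/4) + c2 k * ?S (1/2) + c3 k * ?S (1/2 + \<theta>)) * (1 + \<bar>w\<bar>)"
            by (simp add: c1_def mult_ac)
          finally show "cmod (ker k e (t - s) x w * amp k e u s w
              - ker k e' (t - s) x w * amp k e' v s w) \<le>
              (c1 k * ?S (3/4) + c2 k * ?S (1/2) + c3 k * ?S (1/2 + \<theta>)) * (1 + \<bar>w\<bar>)" .
        qed (use m t t0 T \<theta> c[OF k] in \<open>auto simp: mild_def\<close>)
      qed
      also have "\<dots> \<le> (\<Sum>k\<in>{1..N}. (1 + \<bar>x\<bar>) * ((lip k K * centre_bound * sing_mass T (3/4) * moment k) * (E * exp (l * t) * l powr - (1/4))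
          + ((lip k K * H * sing_mass T (1/2) + 4 * centre_bound * sup_nl k K * sing_mass T (1/2 + \<theta>)) * moment k) * \<kappa>))"
      proof (rule sum_mono)
        fix k assume k: "k \<in> {1..N}"
        \<comment> \<open>Only the third term carries the weight 1 + |x|, from the displaced kernel;
          the two others are enlarged by it to reach a common form.\<close>
        define A B where "A = c1 k * sing_mass T (3/4) * moment k" and "B = c2 k * sing_mass T (1/2) * moment k"
        have "0 \<le> A" "0 \<le> B" unfolding A_def B_def
          using c[OF k] by (auto intro!: mult_nonneg_nonneg sing_mass_nonneg moment_nonneg)
        then have "A + B \<le> (1 + \<bar>x\<bar>) * (A + B)" by (simp add: algebra_simps)
        then show "(c1 k * sing_mass T (3/4) + c2 k * sing_mass T (1/2) + c3 k * sing_mass T (1/2 + \<theta>)) * moment k \<le>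
           (1 + \<bar>x\<bar>) * ((lip k K * centre_bound * sing_mass T (3/4) * moment k) * (E * exp (l * t) * l powr - (1/4))
          + ((lip k K * H * sing_mass T (1/2) + 4 * centre_bound * sup_nl k K * sing_mass T (1/2 + \<theta>)) * moment k) * \<kappa>)"
          by (simp add: A_def B_def c1_def c2_def c3_def algebra_simps)
      qed
      also have "\<dots> = (1 + \<bar>x\<bar>) * (a0 * (E * exp (l * t) * l powr - (1/4)) + b0 * \<kappa>)"
        unfolding a0_def b0_def by (simp only: sum_distrib_left[symmetric] sum.distrib sum_distrib_right[symmetric])
      finally show ?thesis .
    qed
    \<comment> \<open>By the choice of l the solution-dependent term contributes at most half of E,
      so E is at most twice the inhomogeneous term.\<close>
    have "E \<le> E / 2 + b0 * \<kappa>"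
      unfolding E_def
    proof (rule cSup_least)
      show "Q ` ({0..t0} \<times> UNIV) \<noteq> {}" using tt by auto
      fix q assume "q \<in> Q ` ({0..t0} \<times> UNIV)"
      then obtain s z where s: "s \<in> {0..t0}" and q: "q = Q (s, z)" by auto
      have "cmod (u s z - v s z) * exp (- (l * s)) \<le> (1 + \<bar>z\<bar>) * (a0 * (E * exp (l * s) * l powr - (1/4)) + b0 * \<kappa>) * exp (- (l * s))"
        by (intro mult_right_mono step[OF s]) auto
      also have "\<dots> = (1 + \<bar>z\<bar>) * (a0 * l powr - (1/4) * E * (exp (l * s) * exp (- (l * s))) + b0 * \<kappa> * exp (- (l * s)))"
        by (simp only: algebra_simps)
      also have "\<dots> \<le> (1 + \<bar>z\<bar>) * (1 / 2 * E * 1 + b0 * \<kappa> * 1)"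
      proof (intro mult_left_mono add_mono mult_mono)
        show "a0 * l powr - (1/4) \<le> 1 / 2" using a0 by (simp add: l field_simps)
        show "exp (- (l * s)) \<le> 1" using s l by simp
      qed (use E0 b0 \<kappa> a0 in \<open>auto simp: exp_minus\<close>)
      finally show "q \<le> Sup (Q ` ({0..t0} \<times> UNIV)) / 2 + b0 * \<kappa>"
        unfolding q Q_def E_def[symmetric] by (simp add: pos_divide_le_eq mult.commute)
    qed
    then have "E \<le> 2 * b0 * \<kappa>" by simp
    then have "E * exp (l * t) * (1 + \<bar>x\<bar>) \<le> (2 * b0 * \<kappa>) * exp (l * T) * (1 + \<bar>x\<bar>)"
      using l tt t0 b0 \<kappa> by (intro mult_right_mono mult_mono) auto
    then show "cmod (u t x - v t x) \<le> 2 * b0 * exp (l * T) * \<bar>e - e'\<bar> powr \<theta> * (1 + \<bar>x\<bar>)"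
      using DE[OF tt, of x] by (simp add: \<kappa>_def mult_ac)
  qed
qed

end

section \<open>Finite sums in L^2, and a continuity argument in time\<close>

lemma L2norm_sum_le:
  assumes "finite I" "\<And>i. i \<in> I \<Longrightarrow> square_integrable (f i)"
  shows "(L2norm (\<lambda>x. \<Sum>i\<in>I. f i x))\<^sup>2 \<le> real (card I) * (\<Sum>i\<in>I. (L2norm (f i))\<^sup>2)"
proof -
  have i: "integrable lborel (\<lambda>x. real (card I) * (\<Sum>i\<in>I. (cmod (f i x))\<^sup>2))"
    using assms by (intro integrable_mult_right Bochner_Integration.integrable_sum) (auto simp: square_integrable_def)
  have "(L2norm (\<lambda>x. \<Sum>i\<in>I. f i x))\<^sup>2 = (LINT x|lborel. (cmod (\<Sum>i\<in>I. f i x))\<^sup>2)"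
    by (rule L2norm_squared)
  also have "\<dots> \<le> (LINT x|lborel. real (card I) * (\<Sum>i\<in>I. (cmod (f i x))\<^sup>2))"
  proof (rule integral_mono'[OF i])
    fix x
    have "(cmod (\<Sum>i\<in>I. f i x))\<^sup>2 \<le> (\<Sum>i\<in>I. cmod (f i x))\<^sup>2"
      by (intro power_mono norm_sum) auto
    also have "\<dots> \<le> real (card I) * (\<Sum>i\<in>I. (cmod (f i x))\<^sup>2)"
      using sum_squared_le_sum_of_squares[of "\<lambda>i. cmod (f i x)" I] by (simp add: mult.commute)
    finally show "(cmod (\<Sum>i\<in>I. f i x))\<^sup>2 \<le> real (card I) * (\<Sum>i\<in>I. (cmod (f i x))\<^sup>2)" .
  qed (auto intro!: mult_nonneg_nonneg sum_nonneg)
  also have "\<dots> = real (card I) * (\<Sum>i\<in>I. (L2norm (f i))\<^sup>2)"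
    using assms by (simp add: L2norm_squared Bochner_Integration.integral_sum square_integrable_def)
  finally show ?thesis .
qed

lemma square_integrable_add:
  assumes "square_integrable f" "square_integrable g"
  shows "square_integrable (\<lambda>x. f x + g x)" "(L2norm (\<lambda>x. f x + g x))\<^sup>2 \<le> 2 * (L2norm f)\<^sup>2 + 2 * (L2norm g)\<^sup>2"
proof -
  have fg: "f \<in> borel_measurable borel" "g \<in> borel_measurable borel"
    "integrable lborel (\<lambda>x. (cmod (f x))\<^sup>2)" "integrable lborel (\<lambda>x. (cmod (g x))\<^sup>2)"
    using assms by (auto simp: square_integrable_def)
  have i: "integrable lborel (\<lambda>x. 2 * (cmod (f x))\<^sup>2 + 2 * (cmod (g x))\<^sup>2)" using fg by auto
  have "integrable lborel (\<lambda>x. (cmod (f x + g x))\<^sup>2)"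
    by (rule Bochner_Integration.integrable_bound[OF i]) (use fg in \<open>auto simp: norm_add_squared_le\<close>)
  then show "square_integrable (\<lambda>x. f x + g x)" using fg by (simp add: square_integrable_def)
  have "(LINT x|lborel. (cmod (f x + g x))\<^sup>2) \<le> (LINT x|lborel. 2 * (cmod (f x))\<^sup>2 + 2 * (cmod (g x))\<^sup>2)"
    by (rule integral_mono'[OF i]) (auto simp: norm_add_squared_le)
  then show "(L2norm (\<lambda>x. f x + g x))\<^sup>2 \<le> 2 * (L2norm f)\<^sup>2 + 2 * (L2norm g)\<^sup>2"
    using fg by (simp add: L2norm_squared)
qed

lemma duhamel_at_0: "duhamel Y q V e \<psi> 0 x = 0"
proof -
  have "schr_kernel (0 - fst p) (x - (Y + e * snd p)) * duh_amp Y q V e \<psi> 0 p = 0" for p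
    by (cases "fst p = 0") (auto simp: duh_amp_def)
  then show ?thesis unfolding duhamel_def by (simp only: integral_zero)
qed

text \<open>At the first time b where the bound K could fail, the improved bound K - 1 leaves a
  margin of 1, and uniform continuity in time carries the bound K beyond b.\<close>

lemma continuity_method:
  assumes u: "H1_path u" and T: "0 \<le> T" and init: "\<And>z. cmod (u 0 z) \<le> K"
    and improve: "\<And>t z. 0 \<le> t \<Longrightarrow> t \<le> T \<Longrightarrow> (\<And>s z. s \<in> {0..t} \<Longrightarrow> cmod (u s z) \<le> K) \<Longrightarrow> cmod (u t z) \<le> K - 1"
    and t: "t \<in> {0..T}"
  shows "cmod (u t x) \<le> K"
proof (rule ccontr)
  define B where "B = {s \<in> {0..T}. \<exists>z. K < cmod (u s z)}"
  assume "\<not> cmod (u t x) \<le> K"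
  then have "t \<in> B" using t by (auto simp: B_def not_le)
  then have ne: "B \<noteq> {}" by blast
  have bdd: "bdd_below B" unfolding B_def by (rule bdd_belowI[of _ 0]) auto
  define b where "b = Inf B"
  have b0: "0 \<le> b" unfolding b_def using ne by (intro cInf_greatest) (auto simp: B_def)
  have bT: "b \<le> T"
  proof -
    obtain s where "s \<in> B" using ne by auto
    then have "b \<le> s" unfolding b_def by (intro cInf_lower bdd)
    then show ?thesis using \<open>s \<in> B\<close> by (auto simp: B_def)
  qed
  have before: "cmod (u s z) \<le> K" if "0 \<le> s" "s < b" for s z
  proof (rule ccontr)
    assume "\<not> cmod (u s z) \<le> K"
    then have "s \<in> B" using that bT by (auto simp: B_def not_le)
    then have "b \<le> s" unfolding b_def by (intro cInf_lower bdd)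
    then show False using that by simp
  qed
  \<comment> \<open>Closedness: the bound passes to b from earlier times, or is the initial bound if
    b = 0.\<close>
  have at_b: "cmod (u b z) \<le> K" for z
  proof (cases "b = 0")
    case False
    show ?thesis
    proof (rule field_le_epsilon)
      fix r :: real assume "0 < r"
      obtain d where d: "0 < d" "\<And>s x. 0 \<le> s \<Longrightarrow> \<bar>s - b\<bar> < d \<Longrightarrow> cmod (u s x - u b x) \<le> r"
        by (rule H1_path_continuity[OF u b0 \<open>0 < r\<close>], rule that)
      define s where "s = max 0 (b - d / 2)"
      have s: "0 \<le> s" "s < b" "\<bar>s - b\<bar> < d" using False b0 d(1) by (auto simp: s_def max_def)
      show "cmod (u b z) \<le> K + r"
        using norm_triangle_ineq4[of "u s z" "u s z - u b z"] before[OF s(1,2), of z] d(2)[OF s(1,3), of z] by simp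
    qed
  qed (use init in auto)
  have K1: "cmod (u b z) \<le> K - 1" for z
  proof (rule improve[OF b0 bT])
    fix s z assume "s \<in> {0..b}"
    then show "cmod (u s z) \<le> K" using before[of s z] at_b[of z] by (cases "s = b") auto
  qed
  obtain d where d: "0 < d" "\<And>s x. 0 \<le> s \<Longrightarrow> \<bar>s - b\<bar> < d \<Longrightarrow> cmod (u s x - u b x) \<le> 1"
    by (rule H1_path_continuity[OF u b0 zero_less_one], rule that)
  \<comment> \<open>Openness: no violation occurs within distance d after b, which contradicts the
    choice of b as the infimum of the violating times.\<close>
  have "b + d \<le> Inf B"
  proof (rule cInf_greatest[OF ne])
    fix s assume sB: "s \<in> B"
    then obtain z where z: "K < cmod (u s z)" "0 \<le> s" by (auto simp: B_def)
    have "b \<le> s" unfolding b_def using sB by (intro cInf_lower bdd)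
    show "b + d \<le> s"
    proof (rule ccontr)
      assume "\<not> b + d \<le> s"
      then have "cmod (u s z - u b z) \<le> 1" using \<open>b \<le> s\<close> z by (intro d(2)) auto
      then show False using norm_triangle_ineq[of "u s z - u b z" "u b z"] K1[of z] z by simp
    qed
  qed
  then show False using d by (simp add: b_def)
qed

section \<open>Bounds uniform in the scale\<close>

context concentrated_nls
begin

text \<open>The kernel difference is bounded by twice the kernel, hence without weight in x and
  without gain. The price is the term with \<open>sup_nl k M\<close>, which sees only the bound M of
  the reference solution v; the bootstrap level K enters only through differences of
  amplitudes.\<close>

lemma sup_difference_bound:
  assumes T: "0 < T" and e: "0 \<le> e" "e \<le> 1" "0 \<le> e'" "e' \<le> 1" and \<theta>: "0 < \<theta>" "\<theta> < 1/2"
    and m: "mild e u" "mild e' v" and t: "0 \<le> t" "t \<le> T"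
    and uK: "\<And>s z. s \<in> {0..t} \<Longrightarrow> cmod (u s z) \<le> K" and vK: "\<And>s z. s \<in> {0..t} \<Longrightarrow> cmod (v s z) \<le> K"
    and vM: "\<And>s z. s \<in> {0..t} \<Longrightarrow> cmod (v s z) \<le> M" "0 \<le> M"
    and vH: "\<And>s z z'. s \<in> {0..t} \<Longrightarrow> cmod (v s z - v s z') \<le> H * sqrt \<bar>z - z'\<bar>" "0 \<le> H"
    and G: "\<And>s z. s \<in> {0..t} \<Longrightarrow> cmod (u s z - v s z) \<le> G * (1 + \<bar>z\<bar>)" "0 \<le> G"
  shows "cmod (u t x - v t x) \<le> (\<Sum>k\<in>{1..N}.
    (lip k K * (G * centre_bound + H * \<bar>e - e'\<bar> powr \<theta>) + 2 * sup_nl k M) * sing_mass T (1/2) * moment k)"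
proof (rule mild_difference_le[OF m t(1)])
  fix k assume k: "k \<in> {1..N}"
  define c1 where "c1 = lip k K * (G * centre_bound + H * \<bar>e - e'\<bar> powr \<theta>)"
  have c1: "0 \<le> c1" unfolding c1_def using G vH centre_bound(2)
    by (intro mult_nonneg_nonneg add_nonneg_nonneg lip_nonneg k) auto
  have "cmod (duh k e u t x - duh k e' v t x)
    \<le> (c1 * sing_mass T (1/2) + 2 * sup_nl k M * sing_mass T (1/2) + 0 * sing_mass T (1/2)) * moment k"
  proof (rule duhamel_diff_bound[OF k])
    fix s w assume s: "s \<in> {0..t}"
    let ?S = "\<lambda>\<gamma>. sing_kernel T \<gamma> (t - s)"
    have U: "cmod (schr_kernel (t - s) z) \<le> ?S (1/2)" for z
      unfolding sing_kernel_eq[OF s t(2)] by (rule norm_schr_kernel_le)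
    have "cmod (ker k e (t - s) x w * amp k e u s w
        - ker k e' (t - s) x w * amp k e' v s w) \<le>
      cmod (ker k e (t - s) x w) * cmod (amp k e u s w - amp k e' v s w)
      + cmod (ker k e (t - s) x w - ker k e' (t - s) x w) * cmod (amp k e' v s w)"
      by (rule norm_mult_diff_le)
    also have "\<dots> \<le> ?S (1/2) * (c1 * (1 + \<bar>w\<bar>)) + (2 * ?S (1/2)) * (sup_nl k M * (1 + \<bar>w\<bar>))"
    proof (intro add_mono mult_mono U)
      show "cmod (amp k e u s w - amp k e' v s w) \<le> c1 * (1 + \<bar>w\<bar>)"
        unfolding c1_def by (intro nl_difference[OF k e \<theta>] uK[OF s] vK[OF s] vH(1)[OF s] vH(2) G(1)[OF s] G(2))
      show "cmod (ker k e (t - s) x w - ker k e' (t - s) x w) \<le> 2 * ?S (1/2)"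
        using norm_triangle_ineq4[of "ker k e (t - s) x w" "ker k e' (t - s) x w"]
          U[of "x - (y k + e * w)"] U[of "x - (y k + e' * w)"] by linarith
      have "cmod (amp k e' v s w) \<le> sup_nl k M"
        unfolding sup_nl_def using mu_pos[OF k] by (intro norm_power_nl_le vM(1)[OF s]) auto
      also have "\<dots> \<le> sup_nl k M * (1 + \<bar>w\<bar>)"
        using sup_nl_nonneg[OF vM(2), of k] by (simp add: distrib_left)
      finally show "cmod (amp k e' v s w) \<le> sup_nl k M * (1 + \<bar>w\<bar>)" .
    qed (auto simp: sing_kernel_nonneg)
    also have "\<dots> = (c1 * ?S (1/2) + 2 * sup_nl k M * ?S (1/2) + 0 * ?S (1/2)) * (1 + \<bar>w\<bar>)"
      by (simp add: algebra_simps)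
    finally show "cmod (ker k e (t - s) x w * amp k e u s w
        - ker k e' (t - s) x w * amp k e' v s w) \<le>
        (c1 * ?S (1/2) + 2 * sup_nl k M * ?S (1/2) + 0 * ?S (1/2)) * (1 + \<bar>w\<bar>)" .
  qed (use m t T c1 sup_nl_nonneg[OF vM(2), of k] in \<open>auto simp: mild_def\<close>)
  then show "cmod (duh k e u t x - duh k e' v t x)
    \<le> (lip k K * (G * centre_bound + H * \<bar>e - e'\<bar> powr \<theta>) + 2 * sup_nl k M) * sing_mass T (1/2) * moment k"
    by (simp add: c1_def distrib_right)
qed

lemma mild_initial:
  assumes "mild e u" "mild e' v"
  shows "u 0 x = v 0 x"
  using mild_difference[OF assms order_refl, of x] by (simp add: duhamel_at_0)

text \<open>The radius r and the bound K depend on the solution v at the scale e', but not on the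
  nearby solutions. The exponent 1/4 is an arbitrary choice in the admissible range.\<close>

lemma locally_uniform_bound:
  assumes T: "0 < T" and e': "0 \<le> e'" "e' \<le> 1" and v: "mild e' v"
  shows "\<exists>r>0. \<exists>K. \<forall>e u. 0 \<le> e \<longrightarrow> e \<le> 1 \<longrightarrow> \<bar>e - e'\<bar> < r \<longrightarrow> mild e u \<longrightarrow> (\<forall>t\<in>{0..T}. \<forall>x. cmod (u t x) \<le> K)"
proof -
  have pv: "H1_path v" using v by (simp add: mild_def)
  obtain M where M: "0 < M" "\<And>t x. 0 \<le> t \<Longrightarrow> t \<le> T \<Longrightarrow> cmod (v t x) \<le> M"
    "\<And>t x z. 0 \<le> t \<Longrightarrow> t \<le> T \<Longrightarrow> cmod (v t x - v t z) \<le> M * sqrt \<bar>x - z\<bar>"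
    by (rule H1_path_bounds[OF pv, of T], rule that)
  define K0 where "K0 = (\<Sum>k\<in>{1..N}. 2 * sup_nl k M * sing_mass T (1/2) * moment k)"
  have K0: "0 \<le> K0" unfolding K0_def using M(1)
    by (intro sum_nonneg mult_nonneg_nonneg sup_nl_nonneg sing_mass_nonneg moment_nonneg) auto
  \<comment> \<open>M bounds v, K0 is the part of the difference that is not small, one unit is for
    the part that is, and one unit is the margin required by
    \<open>continuity_method\<close>.\<close>
  define K where "K = M + K0 + 2"
  have K: "0 < K" "M \<le> K" using M K0 by (auto simp: K_def)
  have \<theta>: "(0::real) < 1/4" "(1/4::real) < 1/2" by auto
  obtain C where C: "0 \<le> C"
    "\<And>e e' u v t0 t x. 0 \<le> e \<Longrightarrow> e \<le> 1 \<Longrightarrow> 0 \<le> e' \<Longrightarrow> e' \<le> 1 \<Longrightarrow> mild e u \<Longrightarrow> mild e' v \<Longrightarrow> t0 \<le> T \<Longrightarrow>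
      controlled K M t0 u v \<Longrightarrow> t \<in> {0..t0} \<Longrightarrow>
      cmod (u t x - v t x) \<le> C * \<bar>e - e'\<bar> powr (1/4) * (1 + \<bar>x\<bar>)"
    by (rule weighted_stability[OF T K(1) less_imp_le[OF M(1)] \<theta>], rule that)
  define B where "B = (\<Sum>k\<in>{1..N}. lip k K * (C * centre_bound + M) * sing_mass T (1/2) * moment k)"
  have B: "0 \<le> B" unfolding B_def using M(1) C(1) centre_bound(2)
    by (intro sum_nonneg mult_nonneg_nonneg add_nonneg_nonneg lip_nonneg sing_mass_nonneg moment_nonneg) auto
  \<comment> \<open>For |e - e'| < r the small part is at most B / (B + 1), hence at most 1. B
    depends on K, but K was fixed without reference to B.\<close>
  define r where "r = (1 / (B + 1)) powr 4"
  have r: "0 < r" "r powr (1/4) = 1 / (B + 1)"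
    using B by (auto simp: r_def powr_powr simp del: powr_numeral)
  have "cmod (u t x) \<le> K"
    if e: "0 \<le> e" "e \<le> 1" "\<bar>e - e'\<bar> < r" and u: "mild e u" and t: "t \<in> {0..T}" for e u t x
  proof (rule continuity_method[OF _ _ _ _ t])
    show "H1_path u" using u by (simp add: mild_def)
    show "cmod (u 0 z) \<le> K" for z
      using M(2)[of 0 z] T K(2) by (simp add: mild_initial[OF u v])
    fix t z assume t: "0 \<le> t" "t \<le> T" and uK: "\<And>s z. s \<in> {0..t} \<Longrightarrow> cmod (u s z) \<le> K"
    define \<kappa> where "\<kappa> = \<bar>e - e'\<bar> powr (1/4)"
    have \<kappa>: "0 \<le> \<kappa>" by (simp add: \<kappa>_def)
    have vK: "cmod (v s z) \<le> K" and vM: "cmod (v s z) \<le> M"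
      and vH: "cmod (v s z - v s z') \<le> M * sqrt \<bar>z - z'\<bar>" if "s \<in> {0..t}" for s z z'
      using that t M(2)[of s z] M(3)[of s z z'] K(2) by auto
    have con: "controlled K M t u v" unfolding controlled_def using uK vK vH by blast
    have "cmod (u s z - v s z) \<le> C * \<kappa> * (1 + \<bar>z\<bar>)" if "s \<in> {0..t}" for s z
      unfolding \<kappa>_def by (rule C(2)[OF e(1,2) e' u v t(2) con that])
    then have "cmod (u t z - v t z) \<le> (\<Sum>k\<in>{1..N}.
      (lip k K * (C * \<kappa> * centre_bound + M * \<bar>e - e'\<bar> powr (1/4)) + 2 * sup_nl k M) * sing_mass T (1/2) * moment k)"
      using C(1) \<kappa> M(1)
      by (intro sup_difference_bound[OF T e(1,2) e' \<theta> u v t uK vK vM _ vH]) auto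
    also have "\<dots> = (\<Sum>k\<in>{1..N}. lip k K * (C * centre_bound + M) * sing_mass T (1/2) * moment k * \<kappa>
        + 2 * sup_nl k M * sing_mass T (1/2) * moment k)"
      by (intro sum.cong) (auto simp: \<kappa>_def algebra_simps)
    also have "\<dots> = B * \<kappa> + K0"
      unfolding B_def K0_def by (simp only: sum.distrib sum_distrib_right)
    also have "B * \<kappa> \<le> B * (1 / (B + 1))"
    proof (rule mult_left_mono[OF _ B])
      have "\<kappa> \<le> r powr (1/4)" unfolding \<kappa>_def using e by (intro powr_mono2) auto
      then show "\<kappa> \<le> 1 / (B + 1)" using r by simp
    qed
    also have "B * (1 / (B + 1)) \<le> 1" using B by simp
    finally have "cmod (u t z - v t z) \<le> 1 + K0" by simp
    moreover have "cmod (v t z) \<le> M" using t by (intro vM) auto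
    ultimately show "cmod (u t z) \<le> K - 1"
      using norm_triangle_ineq[of "u t z - v t z" "v t z"] by (simp add: K_def)
  qed (use T in auto)
  then show ?thesis using r(1) by blast
qed

lemma uniform_bound:
  assumes T: "0 < T" and \<Psi>: "\<And>e. e \<in> {0..1} \<Longrightarrow> mild e (\<Psi> e)"
  obtains K where "0 < K" "\<And>e t x. e \<in> {0..1} \<Longrightarrow> t \<in> {0..T} \<Longrightarrow> cmod (\<Psi> e t x) \<le> K"
proof -
  have "\<exists>K. \<forall>e\<in>{0..1}. \<forall>t\<in>{0..T}. \<forall>x. cmod (\<Psi> e t x) \<le> K"
  proof (rule compact_locally_bounded_imp_bounded)
    show "compact {0..1::real}" by simp
    fix e' :: real assume e': "e' \<in> {0..1}"
    obtain r K where "r > 0" and rK: "\<forall>e u. 0 \<le> e \<longrightarrow> e \<le> 1 \<longrightarrow> \<bar>e - e'\<bar> < r \<longrightarrow> mild e u \<longrightarrow> (\<forall>t\<in>{0..T}. \<forall>x. cmod (u t x) \<le> K)"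
      using locally_uniform_bound[OF T _ _ \<Psi>[OF e']] e' by auto
    have "\<forall>e\<in>{0..1}. dist e e' < r \<longrightarrow> (\<forall>t\<in>{0..T}. \<forall>x. cmod (\<Psi> e t x) \<le> K)"
    proof (intro ballI impI)
      fix e t assume "e \<in> {0..1}" "dist e e' < r" "t \<in> {0..T}"
      then show "\<forall>x. cmod (\<Psi> e t x) \<le> K"
        using rK[rule_format, of e "\<Psi> e" t] \<Psi>[of e] by (simp add: dist_real_def)
    qed
    then show "\<exists>d>0. \<exists>K. \<forall>e\<in>{0..1}. dist e e' < d \<longrightarrow> (\<forall>t\<in>{0..T}. \<forall>x. cmod (\<Psi> e t x) \<le> K)"
      using \<open>r > 0\<close> by blast
  qed (meson order_trans)
  then obtain K where K: "\<forall>e\<in>{0..1}. \<forall>t\<in>{0..T}. \<forall>x. cmod (\<Psi> e t x) \<le> K" by blast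
  have "cmod (\<Psi> e t x) \<le> max K 1" if "e \<in> {0..1}" "t \<in> {0..T}" for e t x
    using K that by (meson max.coboundedI1)
  then show ?thesis by (intro that[of "max K 1"]) auto
qed

section \<open>The rate of convergence in L^2\<close>

lemma duhamel_L2_difference:
  assumes T: "0 < T" and \<theta>: "0 < \<theta>" "\<theta> < 1/2" and e: "0 \<le> e" and k: "k \<in> {1..N}"
    and H: "H1_path u" "H1_path v" and t: "0 \<le> t" "t \<le> T"
    and amp: "\<And>s w. s \<in> {0..t} \<Longrightarrow> cmod (amp k e u s w - nl k (v s (y k))) \<le> A * (1 + \<bar>w\<bar>)" "0 \<le> A"
    and vM: "\<And>s. s \<in> {0..t} \<Longrightarrow> cmod (v s (y k)) \<le> M" "0 \<le> M"
  defines "F \<equiv> \<lambda>x. duh k e u t x - duh k 0 v t x"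
  shows "square_integrable F" "(L2norm F)\<^sup>2 \<le> 2 * (T * sing_mass T (1/2) * (A * moment k)\<^sup>2)
     + 2 * (8 * e powr (2 * \<theta>) * T * sing_mass T (1/2 + \<theta>) * (sup_nl k M * moment k)\<^sup>2)"
proof -
  let ?P = "lborel \<Otimes>\<^sub>M lborel :: (real \<times> real) measure"
  let ?q = "2 * \<mu> k"
  have q: "0 \<le> ?q" using mu_pos[OF k] by simp
  define au where "au = duh_amp (y k) ?q (V k) e u t"
  define av where "av = duh_amp (y k) ?q (V k) 0 v t"
  have [measurable]: "au \<in> borel_measurable ?P" "av \<in> borel_measurable ?P"
    unfolding au_def av_def by (intro duh_amp_measurable H V_meas k)+
  define U where "U c x p = schr_kernel (t - fst p) (x - (y k + c * snd p))" for c x and p :: "real \<times> real"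
  have int: "integrable ?P (\<lambda>p. U c x p * au p)" "integrable ?P (\<lambda>p. U c x p * av p)" for c x
    unfolding U_def au_def av_def
    using duhamel_integrable[OF H(1) V_meas[OF k] V_integrable(2)[OF k] q t(1), of "\<lambda>w. y k + c * w"]
      duhamel_integrable[OF H(2) V_meas[OF k] V_integrable(2)[OF k] q t(1), of "\<lambda>w. y k + c * w"]
    by simp_all
  \<comment> \<open>J1 changes the amplitude at fixed displaced kernels; J2 moves the kernels at the
    fixed limit amplitude. J2 is written with the centre at the origin and translated back by y_k,
    which preserves the L^2 norm.\<close>
  define J1 where "J1 x = (LINT p|?P. U e x p * (au p - av p))" for x
  define J2 where "J2 x = (LINT p|?P. (schr_kernel (t - fst p) (x - e * snd p) - schr_kernel (t - fst p) x) * av p)" for x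
  have F_eq: "F x = J1 x + J2 (x - y k)" for x
  proof -
    have "J1 x = (LINT p|?P. U e x p * au p) - (LINT p|?P. U e x p * av p)"
      unfolding J1_def right_diff_distrib by (intro Bochner_Integration.integral_diff int)
    moreover have "J2 (x - y k) = (LINT p|?P. U e x p * av p) - (LINT p|?P. U 0 x p * av p)"
    proof -
      have "J2 (x - y k) = (LINT p|?P. U e x p * av p - U 0 x p * av p)"
        unfolding J2_def U_def by (simp add: left_diff_distrib diff_diff_eq)
      also have "\<dots> = (LINT p|?P. U e x p * av p) - (LINT p|?P. U 0 x p * av p)"
        by (intro Bochner_Integration.integral_diff int)
      finally show ?thesis .
    qed
    moreover have "F x = (LINT p|?P. U e x p * au p) - (LINT p|?P. U 0 x p * av p)"
      unfolding F_def duhamel_def U_def au_def av_def ..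
    ultimately show ?thesis by simp
  qed
  let ?m1 = "\<lambda>w. A * (\<bar>V k w\<bar> * (1 + \<bar>w\<bar>))"
  have J1: "square_integrable J1" "(L2norm J1)\<^sup>2 \<le> T * sing_mass T (1/2) * (LINT w|lborel. ?m1 w)\<^sup>2"
  proof -
    have c: "(\<lambda>w. y k + e * w) \<in> borel_measurable borel" by measurable
    have a: "(\<lambda>p. au p - av p) \<in> borel_measurable ?P" by measurable
    have b: "cmod (au (s, w) - av (s, w)) \<le> indicator {0..t} s * ?m1 w" for s w
    proof (cases "s \<in> {0..t}")
      case True
      have "au (s, w) - av (s, w) = of_real (V k w) * (amp k e u s w - nl k (v s (y k)))"
        using True by (simp add: au_def av_def duh_amp_def right_diff_distrib)
      then have "cmod (au (s, w) - av (s, w)) = \<bar>V k w\<bar> * cmod (amp k e u s w - nl k (v s (y k)))"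
        by (simp add: norm_mult)
      also have "\<dots> \<le> \<bar>V k w\<bar> * (A * (1 + \<bar>w\<bar>))" by (intro mult_left_mono amp True) auto
      finally show ?thesis using True by (simp add: mult_ac)
    qed (simp add: au_def av_def duh_amp_def)
    have m: "integrable lborel ?m1" by (intro integrable_mult_right V_integrable k)
    have m0: "0 \<le> ?m1 w" for w using amp(2) by simp
    show "square_integrable J1" "(L2norm J1)\<^sup>2 \<le> T * sing_mass T (1/2) * (LINT w|lborel. ?m1 w)\<^sup>2"
      using schr_L2_estimate[OF T t a c b m m0] unfolding J1_def[abs_def] U_def by auto
  qed
  let ?m2 = "\<lambda>w. sup_nl k M * \<bar>V k w\<bar>"
  have J2: "square_integrable J2"
    "(L2norm J2)\<^sup>2 \<le> 8 * e powr (2 * \<theta>) * T * sing_mass T (1/2 + \<theta>) * (LINT w|lborel. ?m2 w * (1 + \<bar>w\<bar>))\<^sup>2"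
  proof -
    have b: "cmod (av (s, w)) \<le> indicator {0..t} s * ?m2 w" for s w
    proof (cases "s \<in> {0..t}")
      case True
      have "cmod (nl k (v s (y k))) \<le> sup_nl k M"
        unfolding sup_nl_def using q by (intro norm_power_nl_le vM True)
      then have "\<bar>V k w\<bar> * cmod (nl k (v s (y k))) \<le> \<bar>V k w\<bar> * sup_nl k M" by (intro mult_left_mono) auto
      then show ?thesis using True by (simp add: av_def duh_amp_def norm_mult mult.commute)
    qed (simp add: av_def duh_amp_def)
    have "integrable lborel (\<lambda>w. sup_nl k M * (\<bar>V k w\<bar> * (1 + \<bar>w\<bar>)))" by (intro integrable_mult_right V_integrable k)
    then have m: "integrable lborel (\<lambda>w. ?m2 w * (1 + \<bar>w\<bar>))" by (simp only: mult.assoc)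
    have m0: "0 \<le> ?m2 w" for w using sup_nl_nonneg[OF vM(2), of k] by simp
    have a: "av \<in> borel_measurable ?P" by measurable
    show "square_integrable J2"
      "(L2norm J2)\<^sup>2 \<le> 8 * e powr (2 * \<theta>) * T * sing_mass T (1/2 + \<theta>) * (LINT w|lborel. ?m2 w * (1 + \<bar>w\<bar>))\<^sup>2"
      using schr_shift_L2_estimate[OF T t \<theta> e a b m m0] unfolding J2_def[abs_def] by auto
  qed
  note J2' = L2norm_shift[OF J2(1), of "y k"]
  have F: "F = (\<lambda>x. J1 x + J2 (x - y k))" using F_eq by auto
  show "square_integrable F" unfolding F by (rule square_integrable_add(1)[OF J1(1) J2'(1)])
  have "(L2norm F)\<^sup>2 \<le> 2 * (L2norm J1)\<^sup>2 + 2 * (L2norm J2)\<^sup>2"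
    unfolding F using square_integrable_add(2)[OF J1(1) J2'(1)] J2'(2) by simp
  also have "\<dots> \<le> 2 * (T * sing_mass T (1/2) * (A * moment k)\<^sup>2)
     + 2 * (8 * e powr (2 * \<theta>) * T * sing_mass T (1/2 + \<theta>) * (sup_nl k M * moment k)\<^sup>2)"
  proof -
    have i1: "(LINT w|lborel. ?m1 w) = A * moment k" unfolding moment_def by (rule integral_mult_right_zero)
    have i2: "(LINT w|lborel. ?m2 w * (1 + \<bar>w\<bar>)) = sup_nl k M * moment k"
      unfolding moment_def mult.assoc by (rule integral_mult_right_zero)
    show ?thesis using J1(2)[unfolded i1] J2(2)[unfolded i2] by (intro add_mono mult_left_mono) auto
  qed
  finally show "(L2norm F)\<^sup>2 \<le> 2 * (T * sing_mass T (1/2) * (A * moment k)\<^sup>2)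
     + 2 * (8 * e powr (2 * \<theta>) * T * sing_mass T (1/2 + \<theta>) * (sup_nl k M * moment k)\<^sup>2)" .
qed

text \<open>Weighted stability is used with exponent \<open>\<delta>\<close> itself; the change of
  amplitude and the move of the kernels then both contribute the order
  \<open>e powr \<delta>\<close> in L^2.\<close>

lemma L2_convergence_rate:
  assumes T: "0 < T" and \<delta>: "0 < \<delta>" "\<delta> < 1/2" and \<Psi>: "\<And>e. e \<in> {0..1} \<Longrightarrow> mild e (\<Psi> e)"
  shows "\<exists>c>0. \<forall>e\<in>{0<..1}. \<forall>t\<in>{0..T}. L2norm (\<lambda>x. \<Psi> e t x - \<Psi> 0 t x) \<le> c * e powr \<delta>"
proof -
  obtain K where K: "0 < K" "\<And>e t x. e \<in> {0..1} \<Longrightarrow> t \<in> {0..T} \<Longrightarrow> cmod (\<Psi> e t x) \<le> K"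
    by (rule uniform_bound[OF T \<Psi>], assumption, rule that)
  have m0: "mild 0 (\<Psi> 0)" by (intro \<Psi>) auto
  then have p0: "H1_path (\<Psi> 0)" by (simp add: mild_def)
  obtain H where H: "0 < H" "\<And>t x z. 0 \<le> t \<Longrightarrow> t \<le> T \<Longrightarrow> cmod (\<Psi> 0 t x - \<Psi> 0 t z) \<le> H * sqrt \<bar>x - z\<bar>"
    by (rule H1_path_bounds[OF p0, of T], rule that)
  obtain C where C: "0 \<le> C"
    "\<And>e e' u v t0 t x. 0 \<le> e \<Longrightarrow> e \<le> 1 \<Longrightarrow> 0 \<le> e' \<Longrightarrow> e' \<le> 1 \<Longrightarrow> mild e u \<Longrightarrow> mild e' v \<Longrightarrow> t0 \<le> T \<Longrightarrow>
      controlled K H t0 u v \<Longrightarrow> t \<in> {0..t0} \<Longrightarrow>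
      cmod (u t x - v t x) \<le> C * \<bar>e - e'\<bar> powr \<delta> * (1 + \<bar>x\<bar>)"
    by (rule weighted_stability[OF T K(1) less_imp_le[OF H(1)] \<delta>], rule that)
  \<comment> \<open>The constant for the change of amplitude: C from the change of solution, whose
    weight becomes \<open>centre_bound\<close> times 1 + |w|, and H from the change of
    position.\<close>
  define L where "L k = lip k K * (C * centre_bound + H)" for k
  define c0 where "c0 = real N * (\<Sum>k\<in>{1..N}. 2 * (T * sing_mass T (1/2) * (L k * moment k)\<^sup>2)
     + 2 * (8 * T * sing_mass T (1/2 + \<delta>) * (sup_nl k K * moment k)\<^sup>2))"
  have c0: "0 \<le> c0" unfolding c0_def using T
    by (intro mult_nonneg_nonneg sum_nonneg add_nonneg_nonneg sing_mass_nonneg) auto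
  \<comment> \<open>The summand 1 makes the constant strictly positive even if c0 vanishes.\<close>
  have "L2norm (\<lambda>x. \<Psi> e t x - \<Psi> 0 t x) \<le> (sqrt c0 + 1) * e powr \<delta>" if e: "e \<in> {0<..1}" and t: "t \<in> {0..T}" for e t
  proof -
    have e': "0 \<le> e" "e \<le> 1" "e \<in> {0..1}" and t': "0 \<le> t" "t \<le> T" using e t by auto
    define \<kappa> where "\<kappa> = e powr \<delta>"
    have \<kappa>: "0 \<le> \<kappa>" "e powr (2 * \<delta>) = \<kappa>\<^sup>2"
      using e by (auto simp: \<kappa>_def power2_eq_square simp flip: powr_add)
    have me: "mild e (\<Psi> e)" by (intro \<Psi> e')
    then have pe: "H1_path (\<Psi> e)" by (simp add: mild_def)
    have con: "controlled K H t (\<Psi> e) (\<Psi> 0)"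
      unfolding controlled_def using K(2) e' t' H(2) by auto
    have D: "cmod (\<Psi> e s z - \<Psi> 0 s z) \<le> (C * \<kappa>) * (1 + \<bar>z\<bar>)" if "s \<in> {0..t}" for s z
      using C(2)[OF e'(1,2) order_refl zero_le_one me m0 t'(2) con that, of z] e' by (simp add: \<kappa>_def)
    define F where "F k x = duh k e (\<Psi> e) t x - duh k 0 (\<Psi> 0) t x" for k x
    have F: "square_integrable (F k)" "(L2norm (F k))\<^sup>2 \<le> (2 * (T * sing_mass T (1/2) * (L k * moment k)\<^sup>2)
     + 2 * (8 * T * sing_mass T (1/2 + \<delta>) * (sup_nl k K * moment k)\<^sup>2)) * \<kappa>\<^sup>2" if k: "k \<in> {1..N}" for k
    proof -
      have amp: "cmod (nl k (\<Psi> e s (y k + e * w)) - nl k (\<Psi> 0 s (y k))) \<le> (L k * \<kappa>) * (1 + \<bar>w\<bar>)"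
        if s: "s \<in> {0..t}" for s w
      proof -
        have sT: "s \<in> {0..T}" "0 \<le> s" "s \<le> T" using s t' by auto
        have "cmod (nl k (\<Psi> e s (y k + e * w)) - nl k (\<Psi> 0 s (y k + 0 * w)))
          \<le> lip k K * ((C * \<kappa>) * centre_bound + H * \<bar>e - 0\<bar> powr \<delta>) * (1 + \<bar>w\<bar>)"
          using C(1) \<kappa>(1) K(2)[OF e'(3) sT(1)] K(2)[OF _ sT(1), of 0] H(2)[OF sT(2,3)] less_imp_le[OF H(1)]
          by (intro nl_difference[OF k e'(1,2) order_refl zero_le_one \<delta>] D[OF s]) auto
        then show ?thesis using e' by (simp add: L_def \<kappa>_def algebra_simps)
      qed
      have L0: "0 \<le> L k * \<kappa>" unfolding L_def using C(1) H(1) \<kappa>(1) centre_bound(2)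
        by (intro mult_nonneg_nonneg add_nonneg_nonneg lip_nonneg k) auto
      have vM: "cmod (\<Psi> 0 s (y k)) \<le> K" if "s \<in> {0..t}" for s
        using that t' by (intro K(2)) auto
      note est = duhamel_L2_difference[OF T \<delta> e'(1) k pe p0 t' amp L0 vM less_imp_le[OF K(1)]]
      show "square_integrable (F k)" unfolding F_def[abs_def] using est(1) by simp
      have "(L2norm (F k))\<^sup>2 \<le> 2 * (T * sing_mass T (1/2) * (L k * \<kappa> * moment k)\<^sup>2)
         + 2 * (8 * e powr (2 * \<delta>) * T * sing_mass T (1/2 + \<delta>) * (sup_nl k K * moment k)\<^sup>2)"
        unfolding F_def[abs_def] using est(2) by simp
      also have "\<dots> = (2 * (T * sing_mass T (1/2) * (L k * moment k)\<^sup>2)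
         + 2 * (8 * T * sing_mass T (1/2 + \<delta>) * (sup_nl k K * moment k)\<^sup>2)) * \<kappa>\<^sup>2"
        unfolding \<kappa>(2) power_mult_distrib by (simp add: algebra_simps)
      finally show "(L2norm (F k))\<^sup>2 \<le> \<dots>" .
    qed
    have "cmod (\<Psi> e t x - \<Psi> 0 t x) = cmod (\<Sum>k\<in>{1..N}. F k x)" for x
      unfolding mild_difference[OF me m0 t'(1)] F_def by (simp add: norm_mult)
    then have "(L2norm (\<lambda>x. \<Psi> e t x - \<Psi> 0 t x))\<^sup>2 = (L2norm (\<lambda>x. \<Sum>k\<in>{1..N}. F k x))\<^sup>2"
      by (simp only: L2norm_def)
    also have "\<dots> \<le> real (card {1..N}) * (\<Sum>k\<in>{1..N}. (L2norm (F k))\<^sup>2)"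
      by (intro L2norm_sum_le F) auto
    also have "\<dots> \<le> real (card {1..N}) * (\<Sum>k\<in>{1..N}. (2 * (T * sing_mass T (1/2) * (L k * moment k)\<^sup>2)
         + 2 * (8 * T * sing_mass T (1/2 + \<delta>) * (sup_nl k K * moment k)\<^sup>2)) * \<kappa>\<^sup>2)"
      by (intro mult_left_mono sum_mono F) auto
    also have "\<dots> = c0 * \<kappa>\<^sup>2"
      unfolding c0_def by (simp only: sum_distrib_right[symmetric] mult.assoc card_atLeastAtMost diff_Suc_1)
    also have "\<dots> = (sqrt c0 * \<kappa>)\<^sup>2" using c0 by (simp add: power_mult_distrib)
    finally have "L2norm (\<lambda>x. \<Psi> e t x - \<Psi> 0 t x) \<le> sqrt c0 * \<kappa>"
      by (rule power2_le_imp_le) (use c0 \<kappa> in simp)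
    also have "\<dots> \<le> (sqrt c0 + 1) * \<kappa>" using \<kappa> by (intro mult_right_mono) auto
    finally show ?thesis by (simp add: \<kappa>_def)
  qed
  moreover have "0 < sqrt c0 + 1" using c0 by (simp add: add_nonneg_pos)
  ultimately show ?thesis by blast
qed

end

theorem theorem2p2:
  fixes N :: nat and y :: "nat \<Rightarrow> real" and \<mu> :: "nat \<Rightarrow> real"
    and V :: "nat \<Rightarrow> real \<Rightarrow> real" and \<psi>0 :: "real \<Rightarrow> complex"
    and \<psi>\<epsilon> :: "real \<Rightarrow> real \<Rightarrow> real \<Rightarrow> complex" and \<psi> :: "real \<Rightarrow> real \<Rightarrow> complex"
    and \<delta> T :: real
  assumes "N \<ge> 1"
    and "inj_on y {1..N}"
    and "\<forall>k\<in>{1..N}. \<mu> k > 0"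
    and "\<forall>k\<in>{1..N}. integrable lborel (\<lambda>x. (1 + \<bar>x\<bar>) * V k x)"
    and "\<forall>k\<in>{1..N}. V k \<in> borel_measurable lborel"
    and "\<forall>k\<in>{1..N}. \<exists>M. AE x in lborel. \<bar>V k x\<bar> \<le> M"
    and "\<forall>k\<in>{1..N}. (AE x in lborel. V k x \<ge> 0) \<or> \<mu> k < 1"
    and "H1 \<psi>0"
    and "\<forall>\<epsilon>\<in>{0<..1}. is_R_solution N y \<mu> V \<epsilon> \<psi>0 (\<psi>\<epsilon> \<epsilon>)"
    and "is_L_solution N y \<mu> (\<lambda>k. LINT x|lborel. V k x) \<psi>0 \<psi>"
    and "0 < \<delta>" and "\<delta> < 1/2"
    and "T > 0"
  shows "\<exists>c>0. \<forall>\<epsilon>\<in>{0<..1}. \<forall>t\<in>{0..T}.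
           L2norm (\<lambda>x. \<psi>\<epsilon> \<epsilon> t x - \<psi> t x) \<le> c * \<epsilon> powr \<delta>"
proof -
  interpret concentrated_nls N y \<mu> V \<psi>0
    using assms(3-5) by unfold_locales auto
  have conv: "k \<in> {1..N} \<Longrightarrow> 0 \<le> 2 * \<mu> k" for k using mu_pos[of k] by simp
  have R: "mild e (\<psi>\<epsilon> e)" if e: "e \<in> {0<..1}" for e
  proof -
    have sol: "is_R_solution N y \<mu> V e \<psi>0 (\<psi>\<epsilon> e)" using assms(9) e by blast
    then have p: "H1_path (\<psi>\<epsilon> e)" by (simp add: is_R_solution_def)
    have eq: "(\<Sum>k\<in>{1..N}. LINT s:{0..t}|lborel. LINT z|lborel.
             schr_kernel (t - s) (x - z) * of_real ((1 / e) * V k ((z - y k) / e))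
             * of_real (cmod (\<psi>\<epsilon> e s z) powr (2 * \<mu> k)) * \<psi>\<epsilon> e s z)
        = (\<Sum>k\<in>{1..N}. duhamel (y k) (2 * \<mu> k) (V k) e (\<psi>\<epsilon> e) t x)" if "0 \<le> t" for t x
      using e that by (intro sum.cong refl duhamel_R p V_meas V_integrable conv) auto
    show ?thesis
      unfolding mild_def
    proof (intro conjI allI impI p)
      fix t :: real assume t: "0 \<le> t"
      show "\<exists>g. free_evol t \<psi>0 g \<and> (AE x in lborel. \<psi>\<epsilon> e t x =
          g x - \<i> * (\<Sum>k\<in>{1..N}. duhamel (y k) (2 * \<mu> k) (V k) e (\<psi>\<epsilon> e) t x))"
        using sol t unfolding is_R_solution_def eq[OF t, symmetric] by blast
    qed
  qed
  have L: "mild 0 \<psi>"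
  proof -
    have p: "H1_path \<psi>" using assms(10) by (simp add: is_L_solution_def)
    have eq: "(\<Sum>k\<in>{1..N}. of_real (LINT x|lborel. V k x) *
           (LINT s:{0..t}|lborel. schr_kernel (t - s) (x - y k)
             * of_real (cmod (\<psi> s (y k)) powr (2 * \<mu> k)) * \<psi> s (y k)))
        = (\<Sum>k\<in>{1..N}. duhamel (y k) (2 * \<mu> k) (V k) 0 \<psi> t x)" if "0 \<le> t" for t x
      using that by (intro sum.cong refl duhamel_L p V_meas V_integrable conv) auto
    show ?thesis
      unfolding mild_def
    proof (intro conjI allI impI p)
      fix t :: real assume t: "0 \<le> t"
      show "\<exists>g. free_evol t \<psi>0 g \<and> (AE x in lborel. \<psi> t x =
          g x - \<i> * (\<Sum>k\<in>{1..N}. duhamel (y k) (2 * \<mu> k) (V k) 0 \<psi> t x))"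
        using assms(10) t unfolding is_L_solution_def eq[OF t, symmetric] by blast
    qed
  qed
  \<comment> \<open>Placing the limit solution at scale 0 closes the half-open range of scales to
    the compact interval \<open>{0..1}\<close>, as the uniform bound requires.\<close>
  define \<Psi> where "\<Psi> e = (if e = 0 then \<psi> else \<psi>\<epsilon> e)" for e
  have "mild e (\<Psi> e)" if "e \<in> {0..1}" for e
    using that R[of e] L by (auto simp: \<Psi>_def)
  from L2_convergence_rate[OF \<open>T > 0\<close> \<open>0 < \<delta>\<close> \<open>\<delta> < 1/2\<close> this]
  show ?thesis by (simp add: \<Psi>_def)
qed

end
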